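(* Let $q\ge2$ be a fixed integer. Then, as $d\to\infty$, $$\mathrm{BH}^{\mathrm{deg}}_{d,q}\le \exp\left(c_q\sqrt{d\log d}+O_q\left(\sqrt{\frac{d}{\log d}}\,\log\log d\right)\right).$$ In particular, $\mathrm{BH}^{\mathrm{deg}}_{d,q}=\exp(o(d))$ as $d\to\infty$.
   Context: Let $C_q=\{1,\omega,\dots,\omega^{q-1}\}\subset\mathbb C$, $\omega=e^{2\pi i/q}$. Every $f:C_q^N\to\mathbb C$ has a unique Fourier expansion $f(x)=\sum_{\alpha\in\{0,\dots,q-1\}^N}\widehat f(\alpha)x^\alpha$, where $x^\alpha=x_1^{\alpha_1}\cdots x_N^{\alpha_N}$ and $\widehat f(\alpha)=q^{-N}\sum_{x\in C_q^N}f(x)\overline{x^\alpha}$. Put $\|f\|_\infty=\max_{x\in C_q^N}|f(x)|$. The total degree of a Fourier index is $|\alpha|=\alpha_1+\cdots+\alpha_N$ (ordinary integer sum of the representatives in $\{0,\dots,q-1\}$). For an integer $d\ge1$ let $p_d=\frac{2d}{d+1}$. $\mathrm{BH}^{\mathrm{deg}}_{d,q}$ denotes the least constant, independent of $N$, such that $\left(\sum_{|\alpha|\le d}|\widehat f(\alpha)|^{p_d}\right)^{1/p_d}\le \mathrm{BH}^{\mathrm{deg}}_{d,q}\|f\|_\infty$ for every $N\ge1$ and every $f:C_q^N\to\mathbb C$ with $\widehat f(\alpha)=0$ whenever $|\alpha|>d$. Constants: $\gamma_2=\frac12$, $\gamma_q=\frac{q\log(q-1)}{4(q-2)}$ for $q\ge3$,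 and $c_q=2\sqrt{2\gamma_q}$. $O_q(\cdot)$ means that the implied constant may depend on $q$ only. *)

theory Defs
  imports Complex_Main "HOL-Library.FuncSet" "HOL-Library.Extended_Real"
    "HOL-Library.Landau_Symbols"
begin

definition root_unity :: "nat \<Rightarrow> complex" where
  "root_unity q = exp (2 * of_real pi * \<i> / of_nat q)"

definition cyclic_roots :: "nat \<Rightarrow> complex set" where
  "cyclic_roots q = {root_unity q ^ k | k. k < q}"

text \<open>Coordinates are indexed by 0,...,N-1. A function on the N-th power of the group is
  a total function of which only the values on this set are ever used.\<close>

definition cyclic_cube :: "nat \<Rightarrow> nat \<Rightarrow> (nat \<Rightarrow> complex) set" where
  "cyclic_cube q N = {..<N} \<rightarrow>\<^sub>E cyclic_roots q"

definition fourier_indices :: "nat \<Rightarrow> nat \<Rightarrow> (nat \<Rightarrow> nat) set" where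
  "fourier_indices q N = {..<N} \<rightarrow>\<^sub>E {..<q}"

definition monomial :: "nat \<Rightarrow> (nat \<Rightarrow> nat) \<Rightarrow> (nat \<Rightarrow> complex) \<Rightarrow> complex" where
  "monomial N \<alpha> x = (\<Prod>i<N. x i ^ \<alpha> i)"

definition fourier_coeff ::
  "nat \<Rightarrow> nat \<Rightarrow> ((nat \<Rightarrow> complex) \<Rightarrow> complex) \<Rightarrow> (nat \<Rightarrow> nat) \<Rightarrow> complex" where
  "fourier_coeff q N f \<alpha> =
     (\<Sum>x\<in>cyclic_cube q N. f x * cnj (monomial N \<alpha> x)) / of_nat q ^ N"

definition sup_norm :: "nat \<Rightarrow> nat \<Rightarrow> ((nat \<Rightarrow> complex) \<Rightarrow> complex) \<Rightarrow> real" where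
  "sup_norm q N f = Max ((\<lambda>x. cmod (f x)) ` cyclic_cube q N)"

definition total_degree :: "nat \<Rightarrow> (nat \<Rightarrow> nat) \<Rightarrow> nat" where
  "total_degree N \<alpha> = (\<Sum>i<N. \<alpha> i)"

definition BH_exponent :: "nat \<Rightarrow> real" where
  "BH_exponent d = 2 * real d / (real d + 1)"

definition coeff_norm ::
  "nat \<Rightarrow> nat \<Rightarrow> nat \<Rightarrow> ((nat \<Rightarrow> complex) \<Rightarrow> complex) \<Rightarrow> real" where
  "coeff_norm d q N f =
     (\<Sum>\<alpha> | \<alpha> \<in> fourier_indices q N \<and> total_degree N \<alpha> \<le> d.
        cmod (fourier_coeff q N f \<alpha>) powr BH_exponent d) powr (1 / BH_exponent d)"

definition degree_at_most ::
  "nat \<Rightarrow> nat \<Rightarrow> nat \<Rightarrow> ((nat \<Rightarrow> complex) \<Rightarrow> complex) \<Rightarrow> bool" where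
  "degree_at_most d q N f \<longleftrightarrow>
     (\<forall>\<alpha>\<in>fourier_indices q N. total_degree N \<alpha> > d \<longrightarrow> fourier_coeff q N f \<alpha> = 0)"

text \<open>The least admissible constant is taken in the extended reals, so that it is
  \<open>\<infinity>\<close> when no real constant is admissible; a real upper bound on it therefore
  includes the existence of an admissible constant. The set of admissible constants is closed
  and (for \<open>q \<ge> 1\<close>) bounded below, so if nonempty its infimum is attained.
  Only \<open>d \<ge> 1\<close> is meaningful.\<close>

definition BH_deg :: "nat \<Rightarrow> nat \<Rightarrow> ereal" where
  "BH_deg d q = Inf {ereal C | C :: real.
     \<forall>N\<ge>1. \<forall>f. degree_at_most d q N f \<longrightarrow> coeff_norm d q N f \<le> C * sup_norm q N f}"

definition BH_gamma :: "nat \<Rightarrow> real" where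
  "BH_gamma q =
     (if q = 2 then 1 / 2 else real q * ln (real q - 1) / (4 * (real q - 2)))"

definition BH_c :: "nat \<Rightarrow> real" where
  "BH_c q = 2 * sqrt (2 * BH_gamma q)"

end

theory Submission
  imports Defs "HOL-Complex_Analysis.Complex_Analysis" "HOL-Real_Asymp.Real_Asymp"
begin

text \<open>Let \<open>f\<close> have degree at most \<open>d\<close>, let \<open>M\<close> be its sup norm and \<open>c\<close> its Fourier coefficients.
Only the level of an index counts below, that is, the number of its nonzero entries; it is at
most the total degree. The coefficients of level \<open>m\<close> are estimated with a parameter \<open>\<kappa>\<close>, the
size of a block of coordinates, in three moves.

First, the support of every index of level \<open>m\<close> is cut into blocks of about \<open>\<kappa>\<close> coordinates. A
Hoelder inequality (\<open>Blei_projections\<close>) bounds the \<open>\<ell>\<^sub>p\<close> norm with \<open>p = 2 m / (m + 1)\<close> by a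
geometric mean of mixed norms, one for each block: \<open>\<ell>\<^sub>2\<close> over the coordinates outside the block,
then \<open>\<ell>\<^sub>p\<close> with \<open>p = 2 \<kappa> / (\<kappa> + 1)\<close> over the block.

Second, \<open>hypercontractivity\<close> turns the inner \<open>\<ell>\<^sub>2\<close> norm into a moment of order \<open>2 \<kappa> / (\<kappa> + 1)\<close> at
the price of a factor \<open>(1 - 4 \<gamma> / \<kappa>)\<close> to the power \<open>- m / 2\<close>, which is about \<open>exp (2 \<gamma> m / \<kappa>)\<close>.
The number \<open>4 \<gamma>\<close> is the logarithmic Sobolev constant of the complete graph on \<open>q\<close> points
(\<open>log_sobolev_complete_graph\<close>); the leading constant of the result depends on its sharp value.

Third, at a fixed point of the cube there remain the derivatives of \<open>f\<close> of order \<open>\<kappa>\<close>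
(\<open>deriv_coeff\<close>). Replace the unit mass at the point by \<open>1 - e\<close> times this mass plus \<open>e\<close> times a
probability density \<open>1 + t \<phi>\<close> with \<open>\<phi>\<close> of mean zero. The expectation of \<open>f\<close> stays bounded
by \<open>M\<close>, it is a polynomial in \<open>t\<close> of degree at most \<open>d\<close>, and its coefficient of order \<open>\<kappa>\<close> is a
homogeneous form in \<open>\<phi>\<close> whose coefficients are the derivatives, up to the factor \<open>e\<^sup>\<kappa>\<close>.
Reading off this coefficient costs
\<open>(exp 2 d / (\<kappa> e))\<^sup>\<kappa>\<close> by a Markov type inequality (\<open>poly_coeff_bound\<close>), and a Bohnenblust-Hille
inequality for the form costs only another factor \<open>C\<^sup>\<kappa>\<close> (\<open>deriv_coeff_BH\<close>).

With \<open>e = \<kappa> / d\<close> the logarithm of the resulting constant is \<open>2 \<gamma> d / \<kappa> + \<kappa> ln (d\<^sup>2 / \<kappa>\<^sup>2) + O(\<kappa>)\<close>.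
For \<open>\<kappa>\<close> near \<open>sqrt (2 \<gamma> d / ln d)\<close> one has \<open>ln (d\<^sup>2 / \<kappa>\<^sup>2) = ln d + ln (ln d) + O(1)\<close>, so that
both terms have size \<open>sqrt (2 \<gamma> d ln d)\<close>; this gives the constant \<open>2 sqrt (2 \<gamma>)\<close>, and \<open>\<kappa> ln (ln d)\<close>
is the error term. Levels below \<open>\<kappa> ln d\<close> are treated with blocks of constant size, or directly
with the third move, and the sum over all levels costs a factor \<open>d + 1\<close>. The constant function \<open>1\<close> shows that the
Bohnenblust-Hille constant is at least \<open>1\<close>, whence it equals \<open>exp (r d)\<close> with \<open>r\<close> between \<open>0\<close>
and the exponent just found.\<close>

section \<open>The sharp logarithmic Sobolev inequality on the complete graph\<close>

lemma ln_ge_frac: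
  fixes u :: real assumes "u \<ge> 1" shows "ln u \<ge> 2 * (u - 1) / (u + 1)"
proof -
  let ?f = "\<lambda>u::real. ln u - 2 * (u - 1) / (u + 1)"
  have "?f 1 \<le> ?f u"
  proof (rule DERIV_nonneg_imp_nondecreasing[OF assms])
    fix x :: real assume x: "1 \<le> x" "x \<le> u"
    have "(?f has_real_derivative (1 / x - 4 / (x+1)^2)) (at x)"
      using x by (auto intro!: derivative_eq_intros) (simp add: power2_eq_square field_simps)
    moreover have "4 / (x+1)^2 \<le> 1 / x"
      using x sum_squares_ge_zero[of "x - 1" 0] by (simp add: divide_simps power2_eq_square algebra_simps)
    ultimately show "\<exists>y. (?f has_real_derivative y) (at x) \<and> y \<ge> 0"
      by force
  qed
  then show ?thesis by simp
qed

lemma x_ln_x_ge: fixes x :: real assumes "x > 0" shows "x * ln x \<ge> x - 1"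
  using ln_le_minus_one[of "1/x"] assms by (simp add: ln_div field_simps)

text \<open>The function \<open>x\<^sup>2 ln x\<^sup>2\<close> vanishes at \<open>1\<close> with slope \<open>2\<close>, so the quotient of this expression by
\<open>(x - 1)\<^sup>2\<close> is its second divided difference with double node \<open>1\<close>. This quotient is increasing,
because \<open>x\<^sup>2 ln x\<^sup>2\<close> has a positive third derivative. Its value at \<open>1\<close> is \<open>3\<close>, which bridges the two
sides of \<open>1\<close>.\<close>

definition second_difference_num :: "real \<Rightarrow> real" where "second_difference_num x = x^2 * ln (x^2) - 2 * (x - 1)"

lemma second_difference_vs_3:
  assumes "x > 0"
  shows "x \<le> 1 \<Longrightarrow> second_difference_num x \<le> 3 * (x - 1)^2" and "x \<ge> 1 \<Longrightarrow> second_difference_num x \<ge> 3 * (x - 1)^2"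
proof -
  let ?M = "\<lambda>x. 2 * x^2 * ln x - 2*(x-1) - 3 * (x - 1)^2"
  have D: "\<exists>y. (?M has_real_derivative y) (at x) \<and> y \<ge> 0" if "x > 0" for x
  proof -
    have "(?M has_real_derivative 4 * (x * ln x - x + 1)) (at x)"
      using that by (auto intro!: derivative_eq_intros simp: power2_eq_square algebra_simps)
    with x_ln_x_ge[OF that] show ?thesis by (intro exI[of _ "4 * (x * ln x - x + 1)"]) auto
  qed
  have e: "second_difference_num x = 2 * x^2 * ln x - 2*(x-1)"
    using assms by (simp add: second_difference_num_def ln_realpow)
  show "x \<le> 1 \<Longrightarrow> second_difference_num x \<le> 3 * (x - 1)^2"
    using DERIV_nonneg_imp_nondecreasing[of x 1 ?M] D assms e by fastforce
  show "x \<ge> 1 \<Longrightarrow> second_difference_num x \<ge> 3 * (x - 1)^2"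
    using DERIV_nonneg_imp_nondecreasing[of 1 x ?M] D assms e by fastforce
qed

lemma second_difference_mono:
  assumes "1 < x" "x \<le> X"
  shows "second_difference_num x / (x - 1)^2 \<le> second_difference_num X / (X - 1)^2"
proof -
  let ?k = "\<lambda>x::real. (2 * x^2 * ln x - 2*(x-1)) / (x - 1)^2"
  have "?k x \<le> ?k X"
  proof (rule DERIV_nonneg_imp_nondecreasing[OF assms(2)])
    fix z assume z: "x \<le> z" "z \<le> X"
    then have z1: "z > 1" using assms by simp
    have "(?k has_real_derivative (((4 * z * ln z + 2 * z - 2) * (z-1)^2 - (2 * z^2 * ln z - 2*(z-1)) * (2 * (z-1))) / ((z-1)^2 * (z-1)^2))) (at z)"
      using z1 by (auto intro!: derivative_eq_intros) (simp add: power2_eq_square algebra_simps)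
    moreover have "((4 * z * ln z + 2 * z - 2) * (z-1)^2 - (2 * z^2 * ln z - 2*(z-1)) * (2 * (z-1)))
        = 2 * (z - 1) * (z^2 - 1 - 2 * z * ln z)"
      by (simp add: power2_eq_square algebra_simps)
    moreover have "2 * z * ln z \<le> z^2 - 1"
    proof -
      let ?g = "\<lambda>z::real. z - 1/z - 2 * ln z"
      have "1 \<le> z" using z1 by simp
      then have "?g 1 \<le> ?g z"
      proof (rule DERIV_nonneg_imp_nondecreasing)
        fix s :: real assume s: "1 \<le> s" "s \<le> z"
        have "(?g has_real_derivative (1 - 1/s)^2) (at s)"
          using s by (auto intro!: derivative_eq_intros simp: power2_eq_square field_simps)
        then show "\<exists>y. (?g has_real_derivative y) (at s) \<and> y \<ge> 0" by (intro exI) auto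
      qed
      then show ?thesis using z1 by (simp add: field_simps power2_eq_square)
    qed
    ultimately show "\<exists>y. (?k has_real_derivative y) (at z) \<and> y \<ge> 0"
      using z1 by (intro exI[of _ "2 * (z - 1) * (z^2 - 1 - 2 * z * ln z) / ((z-1)^2 * (z-1)^2)"]) auto
  qed
  moreover have "second_difference_num x = 2 * x^2 * ln x - 2*(x-1)" "second_difference_num X = 2 * X^2 * ln X - 2*(X-1)"
    using assms by (simp_all add: second_difference_num_def ln_realpow)
  ultimately show ?thesis by simp
qed

lemma sq_ln_sq_le_quadratic_normalized:
  assumes "0 \<le> x" "x \<le> X" "1 < X"
  shows "x^2 * ln (x^2) \<le> 2 * (x - 1) + second_difference_num X / (X - 1)^2 * (x - 1)^2"
proof -
  let ?K = "second_difference_num X / (X - 1)^2"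
  have K3: "?K \<ge> 3" using second_difference_vs_3(2)[of X] assms by (simp add: field_simps)
  consider "x = 0" | "0 < x" "x \<le> 1" | "1 < x" using assms by linarith
  then show ?thesis
  proof cases
    case 1 then show ?thesis using K3 by simp
  next
    case 2
    have "second_difference_num x \<le> 3 * (x-1)^2" using second_difference_vs_3(1) 2 by simp
    also have "\<dots> \<le> ?K * (x-1)^2" by (rule mult_right_mono[OF K3]) simp
    finally show ?thesis by (simp add: second_difference_num_def)
  next
    case 3
    have "second_difference_num x = second_difference_num x / (x-1)^2 * (x-1)^2" using 3 by simp
    also have "\<dots> \<le> ?K * (x-1)^2" by (rule mult_right_mono[OF second_difference_mono]) (use 3 assms in auto)
    finally show ?thesis by (simp add: second_difference_num_def)
  qed
qed

text \<open>The quadratic polynomial interpolates \<open>x\<^sup>2 ln x\<^sup>2\<close> doubly at \<open>y\<close> and simply at \<open>X\<close>. The error of the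
interpolation is the positive third derivative times \<open>(x - y)\<^sup>2 (x - X)\<close>, hence not positive to
the left of \<open>X\<close>. The scaling \<open>x = y z\<close> changes \<open>x\<^sup>2 ln x\<^sup>2\<close> only by a multiple of \<open>x\<^sup>2\<close> and reduces
the case of positive \<open>y\<close> to \<open>y = 1\<close>.\<close>

lemma sq_ln_sq_le_quadratic:
  assumes "0 \<le> y" "y < X"
  obtains a b c :: real where "\<And>x. 0 \<le> x \<Longrightarrow> x \<le> X \<Longrightarrow> x^2 * ln (x^2) \<le> a + b * x + c * x^2"
    and "X^2 * ln (X^2) = a + b * X + c * X^2" and "y^2 * ln (y^2) = a + b * y + c * y^2"
proof (cases "y = 0")
  case True
  show ?thesis
  proof (rule that[of 0 0 "ln (X^2)"])
    fix x assume x: "0 \<le> x" "x \<le> X"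
    show "x\<^sup>2 * ln (x\<^sup>2) \<le> 0 + 0 * x + ln (X\<^sup>2) * x\<^sup>2"
      using x by (cases "x = 0") (auto simp: mult.commute intro!: mult_left_mono power_mono)
  qed (use True in auto)
next
  case False
  then have y: "y > 0" using assms by simp
  define K where "K = second_difference_num (X/y) / (X/y - 1)^2"
  have X1: "X / y > 1" using y assms by simp
  define Q where "Q = (\<lambda>x. y^2 * (2 * (x/y - 1) + K * (x/y - 1)^2) + x^2 * ln (y^2))"
  have scale: "x^2 * ln (x^2) = y^2 * ((x/y)^2 * ln ((x/y)^2)) + x^2 * ln (y^2)" if "x \<ge> 0" for x
    using y that by (cases "x = 0") (auto simp: ln_div power_divide field_simps)
  have Qe: "Q x = (y^2 * (K - 2)) + (2 * y - 2 * y * K) * x + (K + ln (y^2)) * x^2" for x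
    unfolding Q_def using y by (simp add: field_simps power2_eq_square)
  have le: "x^2 * ln (x^2) \<le> Q x" if "0 \<le> x" "x \<le> X" for x
  proof -
    have "(x/y)^2 * ln ((x/y)^2) \<le> 2 * (x/y - 1) + K * (x/y - 1)^2"
      unfolding K_def by (rule sq_ln_sq_le_quadratic_normalized) (use that X1 y in \<open>auto simp: divide_right_mono\<close>)
    then show ?thesis unfolding Q_def scale[OF that(1)] using y by (simp add: mult_left_mono)
  qed
  have eX: "X^2 * ln (X^2) = Q X"
  proof -
    have "K * (X/y-1)^2 = second_difference_num (X/y)" using X1 unfolding K_def by (metis (no_types) nonzero_eq_divide_eq diff_gt_0_iff_gt less_irrefl zero_less_power)
    then show ?thesis unfolding Q_def using scale[of X] assms by (simp add: second_difference_num_def)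
  qed
  have ey: "y^2 * ln (y^2) = Q y" unfolding Q_def using y by simp
  show ?thesis using that[of "y^2 * (K - 2)" "2 * y - 2 * y * K" "K + ln (y^2)"] le eX ey unfolding Qe by blast
qed

text \<open>The logarithmic Sobolev constant of the complete graph, for the Dirichlet form that is the
variance with respect to the uniform measure.\<close>

definition lsi_const :: "nat \<Rightarrow> real" where "lsi_const q = 4 * BH_gamma q"

lemma lsi_const_eq: assumes "q \<noteq> 2" shows "lsi_const q = real q * ln (real q - 1) / (real q - 2)"
proof -
  have "4 * (a / (4 * b)) = a / b" for a b :: real by simp
  with assms show ?thesis by (simp only: lsi_const_def BH_gamma_def if_False)
qed

lemma lsi_const_2: "lsi_const 2 = 2" by (simp add: lsi_const_def BH_gamma_def)

lemma lsi_const_ge_2: assumes "q \<ge> 2" shows "lsi_const q \<ge> 2"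
proof (cases "q = 2")
  case False
  then have q: "real q \<ge> 3" using assms by simp
  have "ln (real q - 1) \<ge> 2 * (real q - 2) / real q" using ln_ge_frac[of "real q - 1"] q by simp
  then show ?thesis using q False by (simp add: lsi_const_eq field_simps)
qed (simp add: lsi_const_2)

text \<open>The case of a function that is \<open>t\<close> at one point and \<open>1\<close> at the other \<open>u = q - 1\<close> points. The deficit \<open>F\<close>
has double zeros at \<open>t = 1\<close> and \<open>t = u\<close>. If it were negative in between, its normalized
derivative \<open>k\<close>, which vanishes at both ends, would be negative and then positive; so \<open>k\<close> would
decrease, increase and decrease again. This is impossible since \<open>k'\<close> has the sign of a convex
quadratic polynomial \<open>Q\<close>. Beyond \<open>u\<close> the polynomial \<open>Q\<close> is nonnegative, and \<open>F\<close> increases.\<close>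

lemma two_point_entropy:
  fixes t :: real
  assumes q: "q \<ge> 2" and t: "t \<ge> 1"
  defines "u \<equiv> real q - 1"
  shows "t^2 * ln (t^2) - (t^2 + u) * ln ((t^2 + u) / (u + 1)) \<le> lsi_const q * u / (u + 1) * (t - 1)^2"
proof -
  define B where "B = lsi_const q * u / (u + 1)"
  have u1: "u \<ge> 1" using q by (simp add: u_def)
  have Bpos: "B > 0" using lsi_const_ge_2[OF q] u1 by (simp add: B_def)
  have B2: "B * (u + 1) \<ge> 2 * u" using lsi_const_ge_2[OF q] u1 by (simp add: B_def)
  have Bu: "B * (u - 1) = u * ln u"
  proof (cases "q = 2")
    case True then show ?thesis by (simp add: u_def)
  next
    case False
    then have "u > 1" using q by (simp add: u_def)
    then show ?thesis unfolding B_def lsi_const_eq[OF False] by (simp add: u_def field_simps)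
  qed
  define F where "F = (\<lambda>t. B * (t - 1)^2 - 2 * t^2 * ln t + (t^2 + u) * (ln (t^2 + u) - ln (u + 1)))"
  define k where "k = (\<lambda>t. B * (1 - 1/t) + ln (t^2 + u) - ln (u + 1) - 2 * ln t)"
  define Q where "Q = (\<lambda>t. B * t^2 - 2 * u * t + B * u)"
  have pos: "t^2 + u > 0" for t using u1 by (simp add: add_nonneg_pos)
  have dF: "(F has_real_derivative 2 * x * k x) (at x)" if "x > 0" for x
    unfolding F_def k_def using that pos[of x]
    by (auto intro!: derivative_eq_intros) (simp add: field_simps power2_eq_square)
  have dk: "(k has_real_derivative Q x / (x^2 * (x^2 + u))) (at x)" if "x > 0" for x
  proof -
    have "(k has_real_derivative (B / x^2 + 2 * x / (x^2 + u) - 2 / x)) (at x)"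
      unfolding k_def using that pos[of x]
      by (auto intro!: derivative_eq_intros) (simp add: power2_eq_square)
    moreover have "B / x^2 + 2 * x / (x^2 + u) - 2 / x = Q x / (x^2 * (x^2 + u))"
    proof -
      have "B / x^2 = B * (x^2+u) / (x^2 * (x^2 + u))" using that pos[of x] by auto
      moreover have "2 * x / (x^2 + u) = 2 * x * x^2 / (x^2 * (x^2 + u))" using that by simp
      moreover have "2 / x = 2 * x * (x^2 + u) / (x^2 * (x^2 + u))"
        using that pos[of x] by (simp add: power2_eq_square)
      ultimately show ?thesis
        by (simp only: diff_divide_distrib[symmetric] add_divide_distrib[symmetric])
           (simp add: Q_def algebra_simps power2_eq_square)
    qed
    ultimately show ?thesis by simp
  qed
  have k1: "k 1 = 0" by (simp add: k_def add.commute)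
  have ku: "k u = 0"
  proof -
    have "u^2 + u = u * (u + 1)" by (simp add: power2_eq_square algebra_simps)
    then have "ln (u^2 + u) = ln u + ln (u + 1)" using u1 by (simp add: ln_mult)
    moreover have "B * (1 - 1/u) = ln u" using Bu u1 by (simp add: field_simps)
    ultimately show ?thesis by (simp add: k_def)
  qed
  have F1: "F 1 = 0" by (simp add: F_def add.commute)
  have Fu: "F u = 0"
  proof -
    have "u^2 + u = u * (u + 1)" by (simp add: power2_eq_square algebra_simps)
    then have l: "ln (u^2 + u) - ln (u + 1) = ln u" using u1 by (simp add: ln_mult)
    have "B * (u - 1)^2 = (B * (u - 1)) * (u - 1)" by (simp add: power2_eq_square)
    also have "\<dots> = u * ln u * (u - 1)" using Bu by simp
    finally have e: "B * (u - 1)^2 = u * ln u * (u - 1)" .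
    show ?thesis unfolding F_def l e by (simp add: power2_eq_square algebra_simps)
  qed
  have conv: "Q b \<le> max (Q a) (Q c)" if "a \<le> b" "b \<le> c" for a b c
  proof (rule ccontr)
    assume "\<not> ?thesis"
    then have "Q b > Q a" "Q b > Q c" by auto
    then have "a < b" "b < c" using that by (auto simp: less_le)
    have "Q b - Q a = (b - a) * (B * (a + b) - 2 * u)" "Q c - Q b = (c - b) * (B * (b + c) - 2 * u)"
      unfolding Q_def by (simp_all add: algebra_simps power2_eq_square)
    with \<open>Q b > Q a\<close> \<open>Q b > Q c\<close> \<open>a < b\<close> \<open>b < c\<close>
    have "B * (a + b) - 2 * u > 0" "B * (b + c) - 2 * u < 0"
      by (smt (verit) mult_pos_neg zero_less_mult_pos mult_nonneg_nonneg)+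
    moreover have "B * (a + b) < B * (b + c)" using Bpos \<open>a < b\<close> \<open>b < c\<close> by simp
    ultimately show False using \<open>B * (a + b) - 2 * u > 0\<close> \<open>B * (b + c) - 2 * u < 0\<close> by linarith
  qed
  have "F t \<ge> 0"
  proof (cases "t \<ge> u")
    case True
    have Qpos: "Q x \<ge> 0" if "x \<ge> u" for x
    proof -
      have "Q x = (x - u) * (B * (x + u) - 2 * u) + u * (B * (u + 1) - 2 * u)"
        unfolding Q_def by (simp add: algebra_simps power2_eq_square)
      moreover have "B * (x + u) \<ge> B * (u + 1)" using that u1 Bpos by simp
      ultimately show ?thesis using B2 u1 that by simp
    qed
    have kpos: "k x \<ge> 0" if "x \<ge> u" for x
    proof -
      have "k u \<le> k x"
      proof (rule DERIV_nonneg_imp_nondecreasing[OF that])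
        fix z assume z: "u \<le> z"
        then have "Q z / (z^2 * (z^2 + u)) \<ge> 0" using Qpos[of z] pos[of z] by simp
        then show "\<exists>y. (k has_real_derivative y) (at z) \<and> 0 \<le> y" using dk[of z] z u1 by auto
      qed
      then show ?thesis using ku by simp
    qed
    have "F u \<le> F t"
    proof (rule DERIV_nonneg_imp_nondecreasing[OF True])
      fix z assume z: "u \<le> z"
      then have "2 * z * k z \<ge> 0" using kpos[of z] u1 by simp
      then show "\<exists>y. (F has_real_derivative y) (at z) \<and> 0 \<le> y" using dF[of z] z u1 by auto
    qed
    then show ?thesis using Fu by simp
  next
    case False
    show ?thesis
    proof (rule ccontr)
      assume neg: "\<not> F t \<ge> 0"
      then have t1: "1 < t" using t F1 by (cases "t = 1") auto
      have tu: "t < u" using False by simp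
      obtain x1 where x1: "1 < x1" "x1 < t" "F t - F 1 = (t - 1) * (2 * x1 * k x1)"
        using MVT2[OF t1, of F "\<lambda>x. 2 * x * k x"] dF by auto
      obtain x2 where x2: "t < x2" "x2 < u" "F u - F t = (u - t) * (2 * x2 * k x2)"
        using MVT2[OF tu, of F "\<lambda>x. 2 * x * k x"] dF t1 by auto
      have k1n: "k x1 < 0"
      proof (rule ccontr)
        assume "\<not> k x1 < 0"
        then have "(t - 1) * (2 * x1 * k x1) \<ge> 0" using x1 t1 by (intro mult_nonneg_nonneg) auto
        then show False using x1(3) neg F1 by linarith
      qed
      have k2p: "k x2 > 0"
      proof (rule ccontr)
        assume "\<not> k x2 > 0"
        then have "(u - t) * (2 * x2 * k x2) \<le> 0" using x2 t1 tu
          by (intro mult_nonneg_nonpos) auto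
        then show False using x2(3) neg Fu by linarith
      qed
      have mvt: "\<exists>z. a < z \<and> z < b \<and> (sgn (Q z) = sgn (k b - k a))" if ab: "1 \<le> a" "a < b" for a b
      proof -
        have dk': "(k has_real_derivative Q x / (x^2 * (x^2 + u))) (at x)" if "a \<le> x" for x
          using dk[of x] \<open>1 \<le> a\<close> that by simp
        obtain z where z: "a < z" "z < b" "k b - k a = (b - a) * (Q z / (z^2 * (z^2 + u)))"
          using MVT2[of a b k "\<lambda>x. Q x / (x^2 * (x^2 + u))"] dk' ab by auto
        have "z^2 * (z^2 + u) > 0" using z ab pos[of z] by simp
        then have "sgn (k b - k a) = sgn (Q z)" using z(3) ab by (auto simp: sgn_if zero_less_mult_iff zero_less_divide_iff mult_less_0_iff divide_less_0_iff)
        then show ?thesis using z by metis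
      qed
      obtain z1 where z1: "1 < z1" "z1 < x1" "sgn (Q z1) = sgn (k x1 - k 1)" using mvt[of 1 x1] x1 by auto
      obtain z2 where z2: "x1 < z2" "z2 < x2" "sgn (Q z2) = sgn (k x2 - k x1)" using mvt[of x1 x2] x1 x2 by auto
      obtain z3 where z3: "x2 < z3" "z3 < u" "sgn (Q z3) = sgn (k u - k x2)" using mvt[of x2 u] x1 x2 by auto
      have "Q z1 < 0" "Q z2 > 0" "Q z3 < 0" using z1 z2 z3 k1 ku k1n k2p
        by (auto simp: sgn_if split: if_splits)
      with conv[of z1 z2 z3] z1 z2 z3 show False by auto
    qed
  qed
  moreover have "ln (t^2) = 2 * ln t" using t by (simp add: ln_realpow)
  moreover have "ln ((t^2 + u) / (u + 1)) = ln (t^2 + u) - ln (u + 1)"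
    using pos[of t] u1 by (simp add: ln_div)
  ultimately show ?thesis by (simp add: F_def B_def)
qed

text \<open>The limit \<open>t \<rightarrow> \<infinity>\<close> of the previous inequality, needed when the smaller value is zero.\<close>

lemma two_point_entropy_degenerate:
  assumes q: "q \<ge> 2"
  shows "ln (real q) \<le> lsi_const q * (1 - 1 / real q)"
proof (cases "q = 2")
  case True then show ?thesis using ln_le_minus_one[of 2] by (simp add: lsi_const_2)
next
  case False
  then have q3: "real q \<ge> 3" using q by simp
  define u where "u = real q - 1"
  have u: "u \<ge> 2" "real q = u + 1" using q3 by (auto simp: u_def)
  have "ln (u + 1) = ln u + ln (1 + 1 / u)" using u ln_mult_pos[of u "1 + 1/u"] by (simp add: distrib_left add_pos_pos)
  also have "\<dots> \<le> ln u + 1 / u" using ln_add_one_self_le_self[of "1/u"] u by simp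
  finally have 1: "ln (u + 1) \<le> ln u + 1 / u" .
  have 2: "u * ln u \<ge> u - 1" by (rule x_ln_x_ge) (use u in simp)
  have "(u - 1) * ln (u + 1) \<le> (u - 1) * (ln u + 1 / u)" using 1 u by (intro mult_left_mono) auto
  also have "\<dots> = (u - 1) * ln u + (u - 1) / u" by (simp add: algebra_simps)
  also have "(u - 1) / u \<le> ln u" using 2 u by (simp add: field_simps)
  finally have "(u - 1) * ln (u + 1) \<le> u * ln u" by (simp add: algebra_simps)
  then have "ln (u + 1) \<le> u * ln u / (u - 1)" using u by (simp add: field_simps)
  also have "u * ln u / (u - 1) = lsi_const q * (1 - 1 / real q)"
  proof -
    have "lsi_const q = (u + 1) * ln u / (u - 1)" using u by (simp add: lsi_const_eq[OF False])
    moreover have "1 - 1 / real q = u / (u + 1)" using u by (simp add: field_simps)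
    ultimately show ?thesis using u by simp
  qed
  finally show ?thesis using u by simp
qed

lemma two_point_log_sobolev:
  fixes X y :: real
  assumes q: "q \<ge> 2" and y: "0 \<le> y" and yX: "y < X"
  defines "n \<equiv> real q"
  defines "e2 \<equiv> (X^2 + (n - 1) * y^2) / n"
  shows "(X^2 * ln (X^2) + (n - 1) * (y^2 * ln (y^2))) / n - e2 * ln e2
           \<le> lsi_const q * ((n - 1) / n^2 * (X - y)^2)"
proof (cases "y = 0")
  case True
  have n: "n \<ge> 2" using q by (simp add: n_def)
  have "ln (X^2 / n) = ln (X^2) - ln n" using yX y n by (simp add: ln_div)
  then have "(X^2 * ln (X^2)) / n - X^2 / n * ln (X^2 / n) = X^2 / n * ln n" by (simp only:) (simp add: algebra_simps)
  also have "\<dots> \<le> X^2 / n * (lsi_const q * (1 - 1 / n))"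
    using two_point_entropy_degenerate[OF q] n by (intro mult_left_mono) (auto simp: n_def)
  also have "\<dots> = lsi_const q * ((n - 1) / n^2 * X^2)" using n by (simp add: field_simps power2_eq_square)
  finally show ?thesis using True by (simp add: e2_def)
next
  case False
  then have y0: "y > 0" using y by simp
  define t where "t = X / y"
  have t: "t \<ge> 1" "X = t * y" using y0 yX by (auto simp: t_def)
  have n: "n \<ge> 2" using q by (simp add: n_def)
  have tp: "t^2 + (n - 1) > 0" using n by (simp add: add_nonneg_pos)
  have e: "e2 = y^2 * ((t^2 + (n - 1)) / n)" by (simp add: e2_def t(2) power_mult_distrib algebra_simps)
  have le: "ln e2 = ln (y^2) + ln ((t^2 + (n - 1)) / n)"
    unfolding e by (rule ln_mult_pos) (use y0 tp n in auto)
  have lX: "ln (X^2) = ln (t^2) + ln (y^2)" unfolding t(2) power_mult_distrib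
    by (rule ln_mult_pos) (use y0 t in auto)
  have "(X^2 * ln (X^2) + (n - 1) * (y^2 * ln (y^2))) / n - e2 * ln e2
      = y^2 / n * (t^2 * ln (t^2) - (t^2 + (n - 1)) * ln ((t^2 + (n - 1)) / n))"
    unfolding le lX unfolding e t(2) using n by (simp add: field_simps power_mult_distrib)
  also have "\<dots> \<le> y^2 / n * (lsi_const q * (n - 1) / n * (t - 1)^2)"
    using two_point_entropy[OF q t(1)] n by (intro mult_left_mono) (auto simp: n_def)
  also have "\<dots> = lsi_const q * ((n - 1) / n^2 * (X - y)^2)"
    using n unfolding t(2) by (simp add: field_simps power2_eq_square)
  finally show ?thesis .
qed

text \<open>Given mean and variance, the entropy is largest for the function that takes one large value \<open>X\<close>
at a single point and a common value \<open>y\<close> elsewhere. Indeed every function with these two moments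
is bounded by \<open>X\<close>, so the quadratic polynomial that interpolates \<open>x\<^sup>2 ln x\<^sup>2\<close> at \<open>y\<close> and \<open>X\<close> lies
above it on the whole range, and the mean of a quadratic polynomial depends on the two moments
only. This reduces the claim to two values.\<close>

theorem log_sobolev_complete_graph:
  fixes h :: "'a \<Rightarrow> real"
  assumes q: "card \<Omega> = q" "q \<ge> 2" and h: "\<And>x. x \<in> \<Omega> \<Longrightarrow> h x \<ge> 0"
  defines "e1 \<equiv> (\<Sum>x\<in>\<Omega>. h x) / real q"
  defines "e2 \<equiv> (\<Sum>x\<in>\<Omega>. h x ^ 2) / real q"
  shows "(\<Sum>x\<in>\<Omega>. h x ^ 2 * ln (h x ^ 2)) / real q - e2 * ln e2 \<le> lsi_const q * (e2 - e1^2)"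
proof -
  have fin: "finite \<Omega>" using q by (intro card_ge_0_finite) simp
  define n where "n = real q"
  have n: "n \<ge> 2" using q by (simp add: n_def)
  have s1: "(\<Sum>x\<in>\<Omega>. h x) = n * e1" and s2: "(\<Sum>x\<in>\<Omega>. h x ^ 2) = n * e2" and s0: "real (card \<Omega>) = n"
    using n q by (auto simp: e1_def e2_def n_def)
  define v where "v = e2 - e1^2"
  have vs: "n * v = (\<Sum>x\<in>\<Omega>. (h x - e1)^2)"
  proof -
    have "(\<Sum>x\<in>\<Omega>. (h x - e1)^2) = (\<Sum>x\<in>\<Omega>. h x ^ 2 - 2 * e1 * h x + e1^2)"
      by (simp add: power2_diff algebra_simps)
    also have "\<dots> = n * e2 - 2 * e1 * (n * e1) + n * e1^2"
      by (simp only: sum.distrib sum_subtractf sum_distrib_left[symmetric] s1 s2) (simp add: s0)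
    finally show ?thesis by (simp add: v_def algebra_simps power2_eq_square)
  qed
  have e1: "e1 \<ge> 0" unfolding e1_def using h by (intro divide_nonneg_nonneg sum_nonneg) auto
  have v0: "v \<ge> 0"
  proof -
    have "n * v \<ge> 0" unfolding vs by (intro sum_nonneg) simp
    then show ?thesis using n by (simp add: zero_le_mult_iff)
  qed
  show ?thesis
  proof (cases "v = 0")
    case True
    then have "h x = e1" if "x \<in> \<Omega>" for x using vs fin that by (simp add: sum_nonneg_eq_0_iff)
    moreover have "e2 = e1^2" using True by (simp add: v_def)
    ultimately show ?thesis using s0 n by (simp add: n_def[symmetric])
  next
    case False
    define s where "s = sqrt v"
    define r where "r = sqrt (n - 1)"
    have s: "s > 0" "s^2 = v" using v0 False by (auto simp: s_def)
    have r: "r \<ge> 1" "r^2 = n - 1" using n by (auto simp: r_def)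
    (* the masses 1/n at X and 1 - 1/n at y have mean e1 and second moment e2 *)
    define X where "X = e1 + s * r"
    define y where "y = e1 - s / r"
    have yX: "y < X" using s r by (simp add: X_def y_def) (smt (verit) divide_pos_pos mult_pos_pos)
    have hX: "h x \<le> X" if x: "x \<in> \<Omega>" for x
    proof -
      have sp: "(\<Sum>z\<in>\<Omega>. g z) = g x + (\<Sum>z\<in>\<Omega>-{x}. g z)" for g :: "'a \<Rightarrow> real"
        using fin x by (rule sum.remove)
      have "(\<Sum>z\<in>\<Omega>. h z - e1) = 0" using s0 s1 by (simp add: sum_subtractf)
      then have A: "(\<Sum>z\<in>\<Omega>-{x}. h z - e1) = - (h x - e1)" using sp[of "\<lambda>z. h z - e1"] by linarith
      have B: "(\<Sum>z\<in>\<Omega>-{x}. h z - e1)^2 \<le> (\<Sum>z\<in>\<Omega>-{x}. (1::real)^2) * (\<Sum>z\<in>\<Omega>-{x}. (h z - e1)^2)"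
        using Cauchy_Schwarz_ineq_sum[of "\<lambda>_. 1" "\<lambda>z. h z - e1" "\<Omega>-{x}"] by (simp only: mult_1_left)
      have C: "(\<Sum>z\<in>\<Omega>-{x}. (1::real)^2) = n - 1" using sp[of "\<lambda>_. 1"] s0 by simp
      have D: "(\<Sum>z\<in>\<Omega>-{x}. (h z - e1)^2) = n * v - (h x - e1)^2"
        using sp[of "\<lambda>z. (h z - e1)^2"] vs by linarith
      have "(h x - e1)^2 \<le> (n - 1) * (n * v - (h x - e1)^2)" using B unfolding A C D by (simp only: power2_minus)
      then have "n * (h x - e1)^2 \<le> n * ((n - 1) * v)" by (simp add: algebra_simps)
      then have "(h x - e1)^2 \<le> (s * r)^2" using n s r by (simp add: power_mult_distrib mult.commute)
      then show ?thesis using s r abs_le_square_iff[of "h x - e1" "s * r"] by (simp add: X_def)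
    qed
    (* this uses h >= 0: the square of a sum dominates the sum of the squares *)
    have y0: "0 \<le> y"
    proof -
      have "n * e2 \<le> (n * e1)^2"
      proof -
        have "(\<Sum>x\<in>\<Omega>. h x ^ 2) \<le> (\<Sum>x\<in>\<Omega>. h x * (\<Sum>z\<in>\<Omega>. h z))"
          unfolding power2_eq_square
          by (intro sum_mono mult_left_mono) (use h fin in \<open>auto intro: member_le_sum\<close>)
        also have "\<dots> = (\<Sum>z\<in>\<Omega>. h z)^2" by (simp add: sum_distrib_right[symmetric] power2_eq_square)
        finally show ?thesis by (simp add: s1 s2)
      qed
      then have "n * e2 \<le> n * (n * e1^2)" by (simp add: power2_eq_square algebra_simps)
      then have "e2 \<le> n * e1^2" using n by simp
      moreover have "(r * e1)^2 = n * e1^2 - e1^2" unfolding power_mult_distrib r(2) by (simp add: algebra_simps)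
      ultimately have "s^2 \<le> (r * e1)^2" using s(2) v_def by linarith
      then have "s \<le> r * e1" by (rule power2_le_imp_le) (use r e1 in simp)
      then show ?thesis using r by (simp add: y_def field_simps)
    qed
    obtain a b c where Q: "\<And>x. 0 \<le> x \<Longrightarrow> x \<le> X \<Longrightarrow> x^2 * ln (x^2) \<le> a + b * x + c * x^2"
      "X^2 * ln (X^2) = a + b * X + c * X^2" "y^2 * ln (y^2) = a + b * y + c * y^2"
      using sq_ln_sq_le_quadratic[OF y0 yX] by blast
    have m1: "X + (n - 1) * y = n * e1"
    proof -
      have "X + r^2 * y = (1 + r^2) * e1"
        using r(1) by (simp add: X_def y_def field_simps power2_eq_square)
      then show ?thesis using r(2) by simp
    qed
    have m2: "X^2 + (n - 1) * y^2 = n * e2"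
    proof -
      have "X^2 + r^2 * y^2 = (1 + r^2) * e1^2 + (r^2 + 1) * s^2"
        using r(1) by (simp add: X_def y_def field_simps power2_eq_square)
      then show ?thesis using r s by (simp add: v_def algebra_simps)
    qed
    have "(\<Sum>x\<in>\<Omega>. h x ^ 2 * ln (h x ^ 2)) \<le> (\<Sum>x\<in>\<Omega>. a + b * h x + c * h x ^ 2)"
      by (intro sum_mono Q(1) hX h)
    also have "\<dots> = n * a + b * (n * e1) + c * (n * e2)"
      by (simp add: sum.distrib sum_distrib_left[symmetric] s1 s2 s0)
    also have "\<dots> = X^2 * ln (X^2) + (n - 1) * (y^2 * ln (y^2))"
      unfolding Q(2,3) m1[symmetric] m2[symmetric] by (simp add: algebra_simps)
    finally have "(\<Sum>x\<in>\<Omega>. h x ^ 2 * ln (h x ^ 2)) / n - e2 * ln e2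
       \<le> (X^2 * ln (X^2) + (n - 1) * (y^2 * ln (y^2))) / n - e2 * ln e2"
      using n by (simp add: divide_right_mono)
    also have "\<dots> \<le> lsi_const q * ((n - 1) / n^2 * (X - y)^2)"
    proof -
      have "e2 = (X^2 + (n - 1) * y^2) / n" using m2 n by simp
      then show ?thesis using two_point_log_sobolev[OF q(2) y0 yX] by (simp only: n_def)
    qed
    also have "(n - 1) / n^2 * (X - y)^2 = v"
    proof -
      have "r * (X - y) = (1 + r^2) * s" using r(1)
        by (simp add: X_def y_def field_simps power2_eq_square)
      then have "r * (X - y) = n * s" using r(2) by simp
      then have "(r * (X - y))^2 = (n * s)^2" by simp
      then have "(n - 1) * (X - y)^2 = n^2 * v" using r s by (simp add: power_mult_distrib)
      then show ?thesis using n by (simp add: field_simps)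
    qed
    finally show ?thesis by (simp add: n_def v_def)
  qed
qed

section \<open>Hypercontractivity on powers of the cyclic group\<close>

text \<open>Jensen's inequality with respect to the density \<open>h\<^sup>2 / e2\<close> says that \<open>ln\<close> of the \<open>p\<close>-norm lies above its
tangent in \<open>1 / p\<close> at \<open>p = 2\<close>. The slope of this tangent is an entropy, which the logarithmic
Sobolev inequality bounds by the variance. The left-hand side is the second moment of the image of
\<open>h\<close> under the noise operator with parameter \<open>sqrt r\<close>.\<close>

lemma one_point_hypercontractive:
  fixes h :: "'a \<Rightarrow> real"
  assumes q: "card \<Omega> = q" "q \<ge> 2" and h: "\<And>x. x \<in> \<Omega> \<Longrightarrow> h x \<ge> 0"
    and p: "1 \<le> p" "p \<le> 2" and r: "r \<le> 1" "1 - r \<ge> lsi_const q * (2 / p - 1)"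
  shows "r * ((\<Sum>x\<in>\<Omega>. h x ^ 2) / real q) + (1 - r) * ((\<Sum>x\<in>\<Omega>. h x) / real q)^2
      \<le> ((\<Sum>x\<in>\<Omega>. h x powr p) / real q) powr (2 / p)"
proof -
  have fin: "finite \<Omega>" using q by (intro card_ge_0_finite) simp
  define n where "n = real q"
  have n: "n \<ge> 2" using q by (simp add: n_def)
  define e1 where "e1 = (\<Sum>x\<in>\<Omega>. h x) / n"
  define e2 where "e2 = (\<Sum>x\<in>\<Omega>. h x ^ 2) / n"
  define A where "A = {x\<in>\<Omega>. h x > 0}"
  have finA: "finite A" using fin by (simp add: A_def)
  define L where "L = (\<Sum>x\<in>\<Omega>. h x ^ 2 * ln (h x ^ 2)) / n"
  have restr: "(\<Sum>x\<in>\<Omega>. g x) = (\<Sum>x\<in>A. g x)" if "\<And>x. h x = 0 \<Longrightarrow> g x = 0" for g :: "'a \<Rightarrow> real"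
    using that fin h by (intro sum.mono_neutral_right) (auto simp: A_def less_le)
  show ?thesis
  proof (cases "A = {}")
    case True
    then have "h x = 0" if "x \<in> \<Omega>" for x using h[OF that] that by (force simp: A_def)
    then show ?thesis using p by simp
  next
    case False
    define T where "T = (\<Sum>x\<in>A. h x ^ 2)"
    have Tp: "T > 0" unfolding T_def using False finA by (intro sum_pos) (auto simp: A_def)
    have e2T: "e2 = T / n" unfolding e2_def T_def by (subst restr) auto
    have e2p: "e2 > 0" using Tp n by (simp add: e2T)
    define w where "w x = h x ^ 2 / T" for x
    have w: "(\<Sum>x\<in>A. w x) = 1" "\<And>x. w x \<ge> 0" using Tp by (auto simp: w_def sum_divide_distrib[symmetric] T_def[symmetric])
    have lsi: "L - e2 * ln e2 \<le> lsi_const q * (e2 - e1^2)"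
      using log_sobolev_complete_graph[OF q h] by (simp add: L_def e1_def e2_def n_def)
    (* h powr p = h^2 * exp (s * ln (h^2)), so Jensen applies to exp *)
    define s where "s = (p - 2) / 2"
    have "exp (\<Sum>x\<in>A. w x * (s * ln (h x ^ 2))) \<le> (\<Sum>x\<in>A. w x * exp (s * ln (h x ^ 2)))"
      using convex_on_sum[OF finA False exp_convex w(1), of "\<lambda>x. s * ln (h x ^ 2)"] w(2) by simp
    also have "\<dots> = (\<Sum>x\<in>A. h x powr p) / T"
      unfolding sum_divide_distrib
    proof (intro sum.cong refl)
      fix x assume "x \<in> A"
      then have hx: "h x > 0" by (simp add: A_def)
      have "exp (s * ln (h x ^ 2)) = h x powr (p - 2)"
        using hx by (simp add: s_def powr_def ln_realpow)
      moreover have "h x ^ 2 * h x powr (p - 2) = h x powr p"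
        using hx by (metis add.commute diff_add_cancel powr_add powr_numeral less_imp_le)
      ultimately show "w x * exp (s * ln (h x ^ 2)) = h x powr p / T" by (simp add: w_def)
    qed
    also have "(\<Sum>x\<in>A. h x powr p) = (\<Sum>x\<in>\<Omega>. h x powr p)" using p by (intro restr[symmetric]) simp
    finally have J: "T * exp (\<Sum>x\<in>A. w x * (s * ln (h x ^ 2))) \<le> (\<Sum>x\<in>\<Omega>. h x powr p)"
      using Tp by (simp add: field_simps)
    have "(\<Sum>x\<in>A. w x * (s * ln (h x ^ 2))) = s / T * (\<Sum>x\<in>A. h x ^ 2 * ln (h x ^ 2))"
      unfolding sum_distrib_left by (simp add: w_def field_simps)
    also have "(\<Sum>x\<in>A. h x ^ 2 * ln (h x ^ 2)) = L * n"
      unfolding L_def using n by (simp, subst restr) auto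
    also have "s / T * (L * n) = s * (L / e2)" using n by (simp add: e2T)
    finally have "e2 * exp (s * (L / e2)) \<le> (\<Sum>x\<in>\<Omega>. h x powr p) / n"
      using J n by (simp add: e2T field_simps)
    then have "(e2 * exp (s * (L / e2))) powr (2 / p) \<le> ((\<Sum>x\<in>\<Omega>. h x powr p) / n) powr (2 / p)"
      using p e2p by (intro powr_mono2) auto
    moreover have "(e2 * exp (s * (L / e2))) powr (2 / p) \<ge> e2 - (2 / p - 1) * (L - e2 * ln e2)"
    proof -
      define E where "E = L / e2 - ln e2"
      have "(e2 * exp (s * (L / e2))) powr (2 / p) = exp ((2 / p) * (ln e2 + s * (L / e2)))"
        using e2p by (simp add: powr_def ln_mult)
      also have "(2 / p) * (ln e2 + s * (L / e2)) = ln e2 - (2 / p - 1) * E"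
      proof -
        have "(2 / p) * (ln e2 + s * l) = ln e2 - (2 / p - 1) * (l - ln e2)" for l
          using p by (simp add: s_def field_simps)
        then show ?thesis unfolding E_def .
      qed
      also have "exp \<dots> = e2 * exp (- ((2 / p - 1) * E))" using e2p by (simp add: exp_diff exp_minus divide_inverse)
      also have "\<dots> \<ge> e2 * (1 - (2 / p - 1) * E)"
        using exp_ge_add_one_self[of "- ((2 / p - 1) * E)"] e2p by (intro mult_left_mono) auto
      also have "e2 * (1 - (2 / p - 1) * E) = e2 - (2 / p - 1) * (e2 * E)" by (simp add: algebra_simps)
      also have "e2 * E = L - e2 * ln e2" using e2p by (simp add: E_def algebra_simps)
      finally show ?thesis .
    qed
    moreover have "(2 / p - 1) * (L - e2 * ln e2) \<le> (1 - r) * (e2 - e1^2)"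
    proof -
      have p1: "2 / p - 1 \<ge> 0" using p by simp
      have v: "e2 - e1^2 \<ge> 0"
      proof -
        have "(\<Sum>x\<in>\<Omega>. h x)^2 \<le> (\<Sum>x\<in>\<Omega>. (1::real)^2) * (\<Sum>x\<in>\<Omega>. (h x)^2)"
          using Cauchy_Schwarz_ineq_sum[of "\<lambda>_. 1" h \<Omega>] by (simp only: mult_1_left)
        then have "(n * e1)^2 \<le> n * (n * e2)" using q n by (simp add: e1_def e2_def n_def)
        then have "n^2 * e1^2 \<le> n^2 * e2" by (simp add: power2_eq_square algebra_simps)
        then show ?thesis using n by simp
      qed
      have "(2 / p - 1) * (L - e2 * ln e2) \<le> (2 / p - 1) * (lsi_const q * (e2 - e1^2))"
        using lsi p1 by (intro mult_left_mono) auto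
      also have "\<dots> = (lsi_const q * (2 / p - 1)) * (e2 - e1^2)" by simp
      also have "\<dots> \<le> (1 - r) * (e2 - e1^2)" using r v by (intro mult_right_mono) auto
      finally show ?thesis .
    qed
    moreover have "e2 - (1 - r) * (e2 - e1^2) = r * e2 + (1 - r) * e1^2" by (simp add: algebra_simps)
    ultimately show ?thesis by (simp add: e1_def e2_def n_def)
  qed
qed

lemma root_unity_power: "root_unity q ^ k = cis (2 * pi * real k / real q)"
proof -
  have "root_unity q = cis (2 * pi / real q)"
    by (simp add: root_unity_def cis_conv_exp mult_ac)
  then have "root_unity q ^ k = cis (real k * (2 * pi / real q))" by (simp only: Complex.DeMoivre)
  then show ?thesis by (simp add: mult_ac)
qed

lemma cyclic_roots_eq: assumes "q \<ge> 1" shows "cyclic_roots q = {z. z ^ q = 1}"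
  and root_unity_inj: "inj_on (\<lambda>k. root_unity q ^ k) {..<q}"
proof -
  have b: "bij_betw (\<lambda>k. root_unity q ^ k) {..<q} {z. z ^ q = 1}"
    unfolding root_unity_power using Complex.bij_betw_roots_unity[of q] assms by simp
  then show "cyclic_roots q = {z. z ^ q = 1}" by (auto simp: cyclic_roots_def bij_betw_def)
  show "inj_on (\<lambda>k. root_unity q ^ k) {..<q}" using b by (simp add: bij_betw_def)
qed

lemma cyclic_roots_image: "cyclic_roots q = (\<lambda>k. root_unity q ^ k) ` {..<q}"
  by (auto simp: cyclic_roots_def)

lemma finite_cyclic_roots [simp]: "finite (cyclic_roots q)" by (simp add: cyclic_roots_image)

lemma card_cyclic_roots: "q \<ge> 1 \<Longrightarrow> card (cyclic_roots q) = q"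
  by (simp add: cyclic_roots_image card_image root_unity_inj)

lemma root_unity_pow_q: "q \<ge> 1 \<Longrightarrow> root_unity q ^ q = 1"
  by (simp add: root_unity_power)

lemma norm_cyclic_roots: "q \<ge> 1 \<Longrightarrow> x \<in> cyclic_roots q \<Longrightarrow> cmod x = 1"
  using power_eq_1_iff[of x q] by (simp add: cyclic_roots_eq)

lemma geometric_sum_root:
  fixes z :: complex
  assumes "z ^ q = 1"
  shows "(\<Sum>k<q. z ^ k) = (if z = 1 then of_nat q else 0)"
  using assms power_diff_1_eq[of z q] by auto

lemma characters_orthogonal:
  assumes "q \<ge> 1" "a < q" "b < q"
  shows "(\<Sum>x\<in>cyclic_roots q. x ^ a * cnj (x ^ b)) = (if a = b then of_nat q else 0)"
proof -
  let ?w = "root_unity q"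
  define z where "z = ?w ^ a * cnj (?w ^ b)"
  have wq: "?w ^ q = 1" by (rule root_unity_pow_q) fact
  have w1: "cmod ?w = 1" using wq power_eq_1_iff[of ?w q] assms by simp
  have zq: "z ^ q = 1"
    by (simp add: z_def power_mult_distrib power_mult[symmetric] mult.commute[of _ q])
       (simp add: power_mult wq complex_cnj_power[symmetric] del: complex_cnj_power)
  have z1: "z = 1 \<longleftrightarrow> a = b"
  proof
    assume "z = 1"
    have "?w ^ b * cnj (?w ^ b) = 1" using complex_norm_square[of "?w ^ b"] w1 by (simp only: norm_power power_one of_real_1)
    then have "?w ^ a = ?w ^ b" using \<open>z = 1\<close> unfolding z_def by (metis mult.commute mult.left_commute mult.right_neutral)
    then show "a = b" using root_unity_inj[OF assms(1)] assms by (auto simp: inj_on_def)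
  next
    assume "a = b" then show "z = 1" using complex_norm_square[of "?w ^ b"] w1 by (simp only: z_def norm_power power_one of_real_1)
  qed
  have "(\<Sum>x\<in>cyclic_roots q. x ^ a * cnj (x ^ b)) = (\<Sum>k<q. z ^ k)"
    unfolding cyclic_roots_image using root_unity_inj[OF assms(1)]
    by (subst sum.reindex) (auto simp: z_def power_mult_distrib power_mult[symmetric] mult.commute intro!: sum.cong)
  then show ?thesis using geometric_sum_root[OF zq] z1 by simp
qed

lemma characters_complete:
  assumes "q \<ge> 1" "x \<in> cyclic_roots q" "y \<in> cyclic_roots q"
  shows "(\<Sum>a<q. x ^ a * cnj (y ^ a)) = (if x = y then of_nat q else 0)"
proof -
  have n: "cmod x = 1" "cmod y = 1" using assms norm_cyclic_roots by auto
  have "(x * cnj y) ^ q = 1" using assms by (simp add: cyclic_roots_eq power_mult_distrib complex_cnj_power[symmetric] del: complex_cnj_power)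
  moreover have "x * cnj y = 1 \<longleftrightarrow> x = y"
  proof
    assume "x * cnj y = 1"
    moreover have "y * cnj y = 1" using n by (simp add: complex_norm_square[symmetric])
    ultimately show "x = y" by (metis mult.commute mult.left_commute mult.right_neutral)
  qed (use n in \<open>simp add: complex_norm_square[symmetric]\<close>)
  ultimately show ?thesis using geometric_sum_root[of "x * cnj y" q] by (simp add: power_mult_distrib)
qed

lemma sum_PiE_insert:
  assumes "i \<notin> I"
  shows "(\<Sum>f\<in>PiE (insert i I) A. g f) = (\<Sum>a\<in>A i. \<Sum>f\<in>PiE I A. g (f(i := a)))"
proof -
  have "(\<Sum>f\<in>PiE (insert i I) A. g f) = (\<Sum>(a, f)\<in>A i \<times> PiE I A. g (f(i := a)))"
    unfolding PiE_insert_eq using inj_combinator[OF assms, of A]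
    by (subst sum.reindex) (auto simp: case_prod_unfold)
  then show ?thesis by (simp add: sum.cartesian_product)
qed

definition char_prod :: "'i set \<Rightarrow> ('i \<Rightarrow> nat) \<Rightarrow> ('i \<Rightarrow> complex) \<Rightarrow> complex" where
  "char_prod I \<alpha> x = (\<Prod>i\<in>I. x i ^ \<alpha> i)"

abbreviation supp :: "'i set \<Rightarrow> ('i \<Rightarrow> nat) \<Rightarrow> 'i set" where
  "supp I \<alpha> \<equiv> {i\<in>I. \<alpha> i \<noteq> 0}"

text \<open>The order of an index in the sense of the Efron-Stein decomposition, as opposed to its total degree.\<close>

definition level :: "'i set \<Rightarrow> ('i \<Rightarrow> nat) \<Rightarrow> nat" where
  "level I \<alpha> = card (supp I \<alpha>)"

definition multi :: "nat \<Rightarrow> 'i set \<Rightarrow> ('i \<Rightarrow> nat) set" where "multi q I = PiE I (\<lambda>_. {..<q})"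
definition cube :: "nat \<Rightarrow> 'i set \<Rightarrow> ('i \<Rightarrow> complex) set" where "cube q I = PiE I (\<lambda>_. cyclic_roots q)"

abbreviation level_set :: "nat \<Rightarrow> 'i set \<Rightarrow> nat \<Rightarrow> ('i \<Rightarrow> nat) set" where
  "level_set q I k \<equiv> {\<alpha>\<in>multi q I. level I \<alpha> = k}"

lemma finite_multi [simp]: "finite I \<Longrightarrow> finite (multi q I)" by (auto simp: multi_def intro!: finite_PiE)
lemma finite_cube [simp]: "finite I \<Longrightarrow> finite (cube q I)" by (auto simp: cube_def intro!: finite_PiE)

lemma card_cube: "q \<ge> 1 \<Longrightarrow> finite I \<Longrightarrow> card (cube q I) = q ^ card I"
  by (simp add: cube_def card_PiE card_cyclic_roots)

definition fourier_sum :: "nat \<Rightarrow> 'i set \<Rightarrow> (('i \<Rightarrow> nat) \<Rightarrow> complex) \<Rightarrow> ('i \<Rightarrow> complex) \<Rightarrow> complex" where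
  "fourier_sum q I c x = (\<Sum>\<alpha>\<in>multi q I. c \<alpha> * char_prod I \<alpha> x)"

lemma char_prod_insert:
  assumes "finite I" "i \<notin> I"
  shows "char_prod (insert i I) (\<alpha>(i := a)) (x(i := y)) = y ^ a * char_prod I \<alpha> x"
  using assms by (simp add: char_prod_def) (intro disjI2 prod.cong, auto)

lemma level_insert:
  assumes "finite I" "i \<notin> I"
  shows "level (insert i I) (\<alpha>(i := a)) = (if a = 0 then 0 else 1) + level I \<alpha>"
proof -
  have "{j \<in> insert i I. (\<alpha>(i := a)) j \<noteq> 0} = (if a = 0 then {} else {i}) \<union> {j \<in> I. \<alpha> j \<noteq> 0}"
    using assms by auto
  then show ?thesis using assms by (simp add: level_def)
qed

lemma sum_multi_insert:
  assumes "i \<notin> I"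
  shows "(\<Sum>\<alpha>\<in>multi q (insert i I). g \<alpha>) = (\<Sum>a<q. \<Sum>\<alpha>\<in>multi q I. g (\<alpha>(i := a)))"
  unfolding multi_def by (rule sum_PiE_insert[OF assms])

lemma sum_cube_insert:
  assumes "i \<notin> I"
  shows "(\<Sum>x\<in>cube q (insert i I). g x) = (\<Sum>y\<in>cyclic_roots q. \<Sum>x\<in>cube q I. g (x(i := y)))"
  unfolding cube_def by (rule sum_PiE_insert[OF assms])

lemma fourier_sum_insert:
  assumes "finite I" "i \<notin> I"
  shows "fourier_sum q (insert i I) b (x(i := y)) = fourier_sum q I (\<lambda>\<alpha>. \<Sum>a<q. b (\<alpha>(i := a)) * y ^ a) x"
  unfolding fourier_sum_def sum_multi_insert[OF assms(2)] char_prod_insert[OF assms]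
  by (subst sum.swap) (simp add: sum_distrib_left sum_distrib_right mult_ac)

lemma parseval_one:
  assumes "q \<ge> 1"
  shows "(\<Sum>x\<in>cyclic_roots q. cmod (\<Sum>a<q. c a * x ^ a) ^ 2) = real q * (\<Sum>a<q. cmod (c a) ^ 2)"
proof -
  have "complex_of_real (\<Sum>x\<in>cyclic_roots q. cmod (\<Sum>a<q. c a * x ^ a) ^ 2)
     = (\<Sum>x\<in>cyclic_roots q. (\<Sum>a<q. c a * x ^ a) * cnj (\<Sum>b<q. c b * x ^ b))"
    by (simp only: of_real_sum complex_norm_square)
  also have "\<dots> = (\<Sum>x\<in>cyclic_roots q. \<Sum>a<q. \<Sum>b<q. c a * cnj (c b) * (x ^ a * cnj (x ^ b)))"
    by (simp add: sum_product mult_ac)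
  also have "\<dots> = (\<Sum>a<q. \<Sum>b<q. c a * cnj (c b) * (\<Sum>x\<in>cyclic_roots q. x ^ a * cnj (x ^ b)))"
    by (subst sum.swap, intro sum.cong refl, subst sum.swap) (simp add: sum_distrib_left)
  also have "\<dots> = (\<Sum>a<q. \<Sum>b<q. if a = b then c a * cnj (c b) * of_nat q else 0)"
    by (intro sum.cong refl) (use characters_orthogonal[OF assms] in auto)
  also have "\<dots> = (\<Sum>a<q. c a * cnj (c a) * of_nat q)" by (simp add: sum.delta)
  also have "\<dots> = complex_of_real (real q * (\<Sum>a<q. cmod (c a) ^ 2))"
    by (simp only: of_real_mult of_real_sum complex_norm_square sum_distrib_left of_real_of_nat_eq mult_ac)
  finally show ?thesis using of_real_eq_iff by blast
qed

lemma mean_one: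
  assumes "q \<ge> 1"
  shows "(\<Sum>x\<in>cyclic_roots q. \<Sum>a<q. c a * x ^ a) = of_nat q * c 0"
proof -
  have "(\<Sum>x\<in>cyclic_roots q. \<Sum>a<q. c a * x ^ a) = (\<Sum>a<q. c a * (\<Sum>x\<in>cyclic_roots q. x ^ a * cnj (x ^ 0)))"
    by (subst sum.swap) (simp add: sum_distrib_left)
  also have "\<dots> = (\<Sum>a<q. if a = 0 then c a * of_nat q else 0)"
    by (intro sum.cong refl) (subst characters_orthogonal, use assms in auto)
  finally show ?thesis using assms by (simp add: sum.delta)
qed

text \<open>Split off one coordinate, and let \<open>h y\<close> be the weighted \<open>\<ell>\<^sub>2\<close> norm of the coefficients in the
remaining ones when the split coordinate is \<open>y\<close>. By Parseval in one coordinate and the triangle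
inequality for the weighted norm, the left-hand side is at most the left-hand side of the one-point
inequality for \<open>h\<close>; the induction hypothesis then bounds each \<open>h y\<close>. Since \<open>h\<close> is real and
nonnegative, complex coefficients need no separate treatment.\<close>

theorem hypercontractivity:
  fixes b :: "('i \<Rightarrow> nat) \<Rightarrow> complex"
  assumes q: "q \<ge> 2" and p: "1 \<le> p" "p \<le> 2"
    and r: "0 \<le> r" "r \<le> 1" "1 - r \<ge> lsi_const q * (2 / p - 1)" and I: "finite I"
  shows "(\<Sum>\<alpha>\<in>multi q I. r ^ level I \<alpha> * cmod (b \<alpha>) ^ 2) \<le>
    ((\<Sum>x\<in>cube q I. cmod (fourier_sum q I b x) powr p) / real q ^ card I) powr (2 / p)"
  using I
proof (induction I arbitrary: b rule: finite_induct)
  case empty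
  have "(cmod (b (\<lambda>x. undefined)) powr p) powr (2 / p) = cmod (b (\<lambda>x. undefined)) ^ 2"
    using p by (subst powr_powr) simp
  then show ?case by (simp add: level_def char_prod_def fourier_sum_def multi_def cube_def)
next
  case (insert i I)
  let ?A = "multi q I" and ?X = "cube q I" and ?\<Omega> = "cyclic_roots q"
  define Q where "Q = real q ^ card I"
  have Qp: "Q > 0" using q by (simp add: Q_def)
  have q1: "q \<ge> 1" using q by simp
  define \<beta> where "\<beta> y \<alpha> = (\<Sum>a<q. b (\<alpha>(i := a)) * y ^ a)" for y \<alpha>
  define h where "h y = sqrt (\<Sum>\<alpha>\<in>?A. r ^ level I \<alpha> * cmod (\<beta> y \<alpha>) ^ 2)" for y
  have h0: "h y \<ge> 0" for y by (simp add: h_def r sum_nonneg)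
  have h2: "h y ^ 2 = (\<Sum>\<alpha>\<in>?A. r ^ level I \<alpha> * cmod (\<beta> y \<alpha>) ^ 2)" for y by (simp add: h_def r sum_nonneg)
  define G where "G y = (\<Sum>x\<in>?X. cmod (fourier_sum q I (\<beta> y) x) powr p)" for y
  have G0: "G y \<ge> 0" for y unfolding G_def by (intro sum_nonneg) auto
  have IH: "h y powr p \<le> G y / Q" for y
  proof -
    have "h y ^ 2 \<le> (G y / Q) powr (2 / p)" unfolding h2 G_def Q_def by (rule insert.IH)
    then have "(h y ^ 2) powr (p / 2) \<le> ((G y / Q) powr (2 / p)) powr (p / 2)"
      using p by (intro powr_mono2) auto
    moreover have "(h y ^ 2) powr (p / 2) = h y powr p"
      using powr_powr[of "h y" 2 "p / 2"] h0[of y] by simp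
    moreover have "((G y / Q) powr (2 / p)) powr (p / 2) = G y / Q"
      using p G0[of y] Qp by (simp add: powr_powr)
    ultimately show ?thesis by simp
  qed
  have "(\<Sum>\<alpha>\<in>multi q (insert i I). r ^ level (insert i I) \<alpha> * cmod (b \<alpha>) ^ 2)
      = (\<Sum>a<q. \<Sum>\<alpha>\<in>?A. r ^ ((if a = 0 then 0 else 1) + level I \<alpha>) * cmod (b (\<alpha>(i := a))) ^ 2)"
    unfolding sum_multi_insert[OF insert.hyps(2)] level_insert[OF insert.hyps(1,2)] ..
  also have "\<dots> = (\<Sum>\<alpha>\<in>?A. r ^ level I \<alpha> * (r * (\<Sum>a<q. cmod (b (\<alpha>(i := a))) ^ 2) + (1 - r) * cmod (b (\<alpha>(i := 0))) ^ 2))"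
  proof (subst sum.swap, rule sum.cong[OF refl])
    fix \<alpha>
    have "(\<Sum>a<q. r ^ ((if a = 0 then 0 else 1) + level I \<alpha>) * cmod (b (\<alpha>(i := a))) ^ 2)
      = (\<Sum>a<q. r ^ level I \<alpha> * (r * cmod (b (\<alpha>(i := a))) ^ 2 + (if a = 0 then (1 - r) * cmod (b (\<alpha>(i := a))) ^ 2 else 0)))"
      by (intro sum.cong refl) (simp add: algebra_simps)
    also have "\<dots> = r ^ level I \<alpha> * (r * (\<Sum>a<q. cmod (b (\<alpha>(i := a))) ^ 2) + (1 - r) * cmod (b (\<alpha>(i := 0))) ^ 2)"
      using q1 by (simp add: sum_distrib_left[symmetric] sum.distrib sum.delta)
    finally show "(\<Sum>a<q. r ^ ((if a = 0 then 0 else 1) + level I \<alpha>) * cmod (b (\<alpha>(i := a))) ^ 2) = \<dots>" .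
  qed
  also have "\<dots> = r * (\<Sum>\<alpha>\<in>?A. r ^ level I \<alpha> * (\<Sum>a<q. cmod (b (\<alpha>(i := a))) ^ 2))
      + (1 - r) * (\<Sum>\<alpha>\<in>?A. r ^ level I \<alpha> * cmod (b (\<alpha>(i := 0))) ^ 2)"
  proof -
    have "(\<Sum>\<alpha>\<in>?A. w \<alpha> * (r * S \<alpha> + (1 - r) * T \<alpha>)) = r * (\<Sum>\<alpha>\<in>?A. w \<alpha> * S \<alpha>) + (1 - r) * (\<Sum>\<alpha>\<in>?A. w \<alpha> * T \<alpha>)"
      for w S T :: "('i \<Rightarrow> nat) \<Rightarrow> real"
      by (simp add: sum_distrib_left sum.distrib[symmetric] distrib_left mult_ac)
    then show ?thesis .
  qed
  also have "(\<Sum>\<alpha>\<in>?A. r ^ level I \<alpha> * (\<Sum>a<q. cmod (b (\<alpha>(i := a))) ^ 2)) = (\<Sum>y\<in>?\<Omega>. h y ^ 2) / real q"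
  proof -
    have "(\<Sum>y\<in>?\<Omega>. h y ^ 2) = (\<Sum>\<alpha>\<in>?A. r ^ level I \<alpha> * (\<Sum>y\<in>?\<Omega>. cmod (\<beta> y \<alpha>) ^ 2))"
      unfolding h2 by (subst sum.swap) (simp add: sum_distrib_left)
    also have "\<dots> = (\<Sum>\<alpha>\<in>?A. r ^ level I \<alpha> * (real q * (\<Sum>a<q. cmod (b (\<alpha>(i := a))) ^ 2)))"
      unfolding \<beta>_def parseval_one[OF q1] ..
    also have "\<dots> = real q * (\<Sum>\<alpha>\<in>?A. r ^ level I \<alpha> * (\<Sum>a<q. cmod (b (\<alpha>(i := a))) ^ 2))"
      by (simp add: sum_distrib_left mult_ac)
    finally show ?thesis using q1 by simp
  qed
  also have "(1 - r) * (\<Sum>\<alpha>\<in>?A. r ^ level I \<alpha> * cmod (b (\<alpha>(i := 0))) ^ 2) \<le> (1 - r) * ((\<Sum>y\<in>?\<Omega>. h y) / real q) ^ 2"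
  proof (rule mult_left_mono)
    define v where "v y \<alpha> = sqrt (r ^ level I \<alpha>) * cmod (\<beta> y \<alpha>)" for y \<alpha>
    have hv: "h y = L2_set (v y) ?A" for y
      by (simp add: h_def L2_set_def v_def power_mult_distrib r)
    have "real q * (sqrt (r ^ level I \<alpha>) * cmod (b (\<alpha>(i := 0)))) \<le> (\<Sum>y\<in>?\<Omega>. v y \<alpha>)" for \<alpha>
    proof -
      have "real q * cmod (b (\<alpha>(i := 0))) = cmod (\<Sum>y\<in>?\<Omega>. \<beta> y \<alpha>)"
        unfolding \<beta>_def mean_one[OF q1] by (simp add: norm_mult)
      also have "\<dots> \<le> (\<Sum>y\<in>?\<Omega>. cmod (\<beta> y \<alpha>))" by (rule norm_sum)
      finally have "sqrt (r ^ level I \<alpha>) * (real q * cmod (b (\<alpha>(i := 0)))) \<le> sqrt (r ^ level I \<alpha>) * (\<Sum>y\<in>?\<Omega>. cmod (\<beta> y \<alpha>))"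
        using r by (intro mult_left_mono) auto
      then show ?thesis by (simp add: v_def sum_distrib_left mult_ac)
    qed
    then have "L2_set (\<lambda>\<alpha>. real q * (sqrt (r ^ level I \<alpha>) * cmod (b (\<alpha>(i := 0))))) ?A \<le> L2_set (\<lambda>\<alpha>. \<Sum>y\<in>?\<Omega>. v y \<alpha>) ?A"
      using r by (intro L2_set_mono) auto
    also have "\<dots> \<le> (\<Sum>y\<in>?\<Omega>. L2_set (v y) ?A)"
    proof -
      have "finite S \<Longrightarrow> L2_set (\<lambda>\<alpha>. \<Sum>y\<in>S. v y \<alpha>) ?A \<le> (\<Sum>y\<in>S. L2_set (v y) ?A)" for S
        by (induction S rule: finite_induct) (auto simp: L2_set_def[of "\<lambda>_. 0"] intro: order_trans[OF L2_set_triangle_ineq])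
      then show ?thesis by simp
    qed
    also have "\<dots> = (\<Sum>y\<in>?\<Omega>. h y)" by (simp add: hv)
    finally have "real q * L2_set (\<lambda>\<alpha>. sqrt (r ^ level I \<alpha>) * cmod (b (\<alpha>(i := 0)))) ?A \<le> (\<Sum>y\<in>?\<Omega>. h y)"
      by (subst (asm) L2_set_right_distrib[symmetric]) auto
    then have "L2_set (\<lambda>\<alpha>. sqrt (r ^ level I \<alpha>) * cmod (b (\<alpha>(i := 0)))) ?A \<le> (\<Sum>y\<in>?\<Omega>. h y) / real q"
      using q1 by (simp add: field_simps)
    then have "(L2_set (\<lambda>\<alpha>. sqrt (r ^ level I \<alpha>) * cmod (b (\<alpha>(i := 0)))) ?A)^2 \<le> ((\<Sum>y\<in>?\<Omega>. h y) / real q)^2"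
      by (intro power_mono) auto
    then show "(\<Sum>\<alpha>\<in>?A. r ^ level I \<alpha> * cmod (b (\<alpha>(i := 0))) ^ 2) \<le> ((\<Sum>y\<in>?\<Omega>. h y) / real q) ^ 2"
      by (simp add: L2_set_def power_mult_distrib r sum_nonneg)
  qed (use r in simp)
  also have "r * ((\<Sum>y\<in>?\<Omega>. h y ^ 2) / real q) + (1 - r) * ((\<Sum>y\<in>?\<Omega>. h y) / real q) ^ 2 \<le> ((\<Sum>y\<in>?\<Omega>. h y powr p) / real q) powr (2 / p)"
    by (rule one_point_hypercontractive) (use card_cyclic_roots q1 q p r h0 in auto)
  also have "\<dots> \<le> ((\<Sum>y\<in>?\<Omega>. G y / Q) / real q) powr (2 / p)"
    using p IH by (intro powr_mono2 divide_right_mono sum_mono divide_nonneg_nonneg sum_nonneg) auto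
  also have "(\<Sum>y\<in>?\<Omega>. G y / Q) / real q =
      (\<Sum>x\<in>cube q (insert i I). cmod (fourier_sum q (insert i I) b x) powr p) / real q ^ card (insert i I)"
    unfolding G_def sum_cube_insert[OF insert.hyps(2)] fourier_sum_insert[OF insert.hyps(1,2)] \<beta>_def[abs_def] Q_def
    using insert.hyps by (simp add: sum_divide_distrib[symmetric])
  finally show ?case by simp
qed

section \<open>A Blei inequality for jointly injective projections\<close>

lemma weighted_am_gm:
  fixes g \<theta> :: "'j \<Rightarrow> real"
  assumes "finite J" "\<And>j. j \<in> J \<Longrightarrow> g j \<ge> 0" "\<And>j. j \<in> J \<Longrightarrow> \<theta> j > 0" "(\<Sum>j\<in>J. \<theta> j) = 1"
  shows "(\<Prod>j\<in>J. g j powr \<theta> j) \<le> (\<Sum>j\<in>J. \<theta> j * g j)"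
proof (cases "\<exists>j\<in>J. g j = 0")
  case True
  then have "(\<Prod>j\<in>J. g j powr \<theta> j) = 0" using assms(1) by (auto intro: prod_zero)
  also have "\<dots> \<le> (\<Sum>j\<in>J. \<theta> j * g j)" using assms by (intro sum_nonneg mult_nonneg_nonneg) (auto intro: less_imp_le)
  finally show ?thesis .
next
  case False
  then have g: "g j > 0" if "j \<in> J" for j using assms(2)[OF that] that by force
  have "J \<noteq> {}" using assms(4) by auto
  have "(\<Prod>j\<in>J. g j powr \<theta> j) = exp (\<Sum>j\<in>J. \<theta> j * ln (g j))"
    using assms(1) g by (simp add: exp_sum powr_def less_imp_neq[symmetric] cong: prod.cong)
  also have "\<dots> \<le> (\<Sum>j\<in>J. \<theta> j * exp (ln (g j)))"
    using convex_on_sum[OF assms(1) \<open>J \<noteq> {}\<close> exp_convex assms(4), of "\<lambda>j. ln (g j)"] assms(3)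
    by (simp add: less_imp_le)
  also have "\<dots> = (\<Sum>j\<in>J. \<theta> j * g j)" using g by simp
  finally show ?thesis .
qed

text \<open>Hoelder's inequality for several factors: after normalization of the sums it is the weighted
inequality between geometric and arithmetic mean at each point.\<close>

lemma Holder_sum_prod:
  fixes f :: "'j \<Rightarrow> 'x \<Rightarrow> real" and \<theta> :: "'j \<Rightarrow> real"
  assumes J: "finite J" and X: "finite X" and f: "\<And>j x. j \<in> J \<Longrightarrow> x \<in> X \<Longrightarrow> f j x \<ge> 0"
    and \<theta>: "\<And>j. j \<in> J \<Longrightarrow> \<theta> j > 0" "(\<Sum>j\<in>J. \<theta> j) = 1"
  shows "(\<Sum>x\<in>X. \<Prod>j\<in>J. f j x powr \<theta> j) \<le> (\<Prod>j\<in>J. (\<Sum>x\<in>X. f j x) powr \<theta> j)"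
proof (cases "\<exists>j\<in>J. (\<Sum>x\<in>X. f j x) = 0")
  case True
  then obtain j where j: "j \<in> J" "(\<Sum>x\<in>X. f j x) = 0" by auto
  then have "f j x = 0" if "x \<in> X" for x using sum_nonneg_eq_0_iff[OF X, of "f j"] f that by auto
  then have "(\<Prod>j\<in>J. f j x powr \<theta> j) = 0" if "x \<in> X" for x
    using j(1) that J by (intro prod_zero) auto
  then have "(\<Sum>x\<in>X. \<Prod>j\<in>J. f j x powr \<theta> j) = 0" by simp
  also have "\<dots> \<le> (\<Prod>j\<in>J. (\<Sum>x\<in>X. f j x) powr \<theta> j)" by (intro prod_nonneg) auto
  finally show ?thesis .
next
  case False
  define F where "F j = (\<Sum>x\<in>X. f j x)" for j
  have F: "F j > 0" if "j \<in> J" for j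
    using False that f[OF that] by (auto simp: F_def less_le intro!: sum_nonneg)
  define P where "P = (\<Prod>j\<in>J. F j powr \<theta> j)"
  have P: "P \<ge> 0" unfolding P_def by (intro prod_nonneg) auto
  have "(\<Sum>x\<in>X. \<Prod>j\<in>J. f j x powr \<theta> j) \<le> (\<Sum>x\<in>X. P * (\<Sum>j\<in>J. \<theta> j * (f j x / F j)))"
  proof (rule sum_mono)
    fix x assume x: "x \<in> X"
    have "(\<Prod>j\<in>J. f j x powr \<theta> j) = (\<Prod>j\<in>J. F j powr \<theta> j * (f j x / F j) powr \<theta> j)"
    proof (rule prod.cong[OF refl])
      fix j assume j: "j \<in> J"
      show "f j x powr \<theta> j = F j powr \<theta> j * (f j x / F j) powr \<theta> j"
        using F[OF j] f[OF j x] by (simp add: powr_divide)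
    qed
    also have "\<dots> = P * (\<Prod>j\<in>J. (f j x / F j) powr \<theta> j)" by (simp add: prod.distrib P_def)
    also have "\<dots> \<le> P * (\<Sum>j\<in>J. \<theta> j * (f j x / F j))"
      by (intro mult_left_mono[OF _ P] weighted_am_gm J \<theta>) (use f F x in \<open>auto simp: less_imp_le\<close>)
    finally show "(\<Prod>j\<in>J. f j x powr \<theta> j) \<le> P * (\<Sum>j\<in>J. \<theta> j * (f j x / F j))" .
  qed
  also have "\<dots> = P * (\<Sum>j\<in>J. \<Sum>x\<in>X. \<theta> j * (f j x / F j))"
    by (subst sum_distrib_left[symmetric], subst sum.swap) simp
  also have "(\<Sum>j\<in>J. \<Sum>x\<in>X. \<theta> j * (f j x / F j)) = (\<Sum>j\<in>J. \<theta> j)"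
  proof (rule sum.cong[OF refl])
    fix j assume j: "j \<in> J"
    have "(\<Sum>x\<in>X. \<theta> j * (f j x / F j)) = \<theta> j * (F j / F j)"
      unfolding F_def by (simp add: sum_distrib_left[symmetric] sum_divide_distrib[symmetric])
    then show "(\<Sum>x\<in>X. \<theta> j * (f j x / F j)) = \<theta> j" using F[OF j] by simp
  qed
  also have "P * \<dots> = P" using \<theta> by simp
  finally show ?thesis by (simp add: P_def F_def)
qed

text \<open>With \<open>w\<^sub>j\<close> the \<open>\<ell>\<^sub>2\<close> norm of \<open>a\<close> over a fibre of \<open>\<pi>\<^sub>j\<close>, the power of \<open>a\<close> on the left is the product of
the functions \<open>a\<^sup>2 w\<^sub>j powr (- 2 / (k\<^sub>j + 1))\<close> with exponents \<open>k\<^sub>j / (m + 1)\<close> and of the function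
\<open>\<Prod>\<^sub>j w\<^sub>j powr (2 k\<^sub>j / (k\<^sub>j + 1))\<close> with exponent \<open>1 / (m + 1)\<close>. Hoelder's inequality applies to these
factors: the sum of the last one is at most a product of sums, since the \<open>\<pi>\<^sub>j\<close> together are injective,
and the sum of each of the others collapses along the fibres of \<open>\<pi>\<^sub>j\<close>.\<close>

lemma Blei_projections:
  fixes a :: "'x \<Rightarrow> real" and \<pi> :: "'j \<Rightarrow> 'x \<Rightarrow> 'y" and k :: "'j \<Rightarrow> nat"
  assumes J: "finite J" "J \<noteq> {}" and X: "finite X"
    and inj: "\<And>x x'. x \<in> X \<Longrightarrow> x' \<in> X \<Longrightarrow> (\<And>j. j \<in> J \<Longrightarrow> \<pi> j x = \<pi> j x') \<Longrightarrow> x = x'"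
    and k: "\<And>j. j \<in> J \<Longrightarrow> k j \<ge> 1" and m: "m = (\<Sum>j\<in>J. k j)"
    and a: "\<And>x. x \<in> X \<Longrightarrow> a x \<ge> 0"
  shows "(\<Sum>x\<in>X. a x powr BH_exponent m) \<le>
    (\<Prod>j\<in>J. (\<Sum>y\<in>\<pi> j ` X. (sqrt (\<Sum>x\<in>{x\<in>X. \<pi> j x = y}. a x ^ 2)) powr BH_exponent (k j))
       powr ((real (k j) + 1) / (real m + 1)))"
proof -
  define Y where "Y = {x\<in>X. a x > 0}"
  have Y: "finite Y" "Y \<subseteq> X" using X by (auto simp: Y_def)
  define w where "w j y = sqrt (\<Sum>x\<in>{x\<in>X. \<pi> j x = y}. a x ^ 2)" for j y
  define W where "W j = (\<Sum>y\<in>\<pi> j ` X. w j y powr BH_exponent (k j))" for j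
  have w0: "w j y \<ge> 0" for j y by (simp add: w_def sum_nonneg)
  have wpos: "w j (\<pi> j x) > 0" if "x \<in> Y" for j x
  proof -
    have "a x ^ 2 \<le> (\<Sum>x'\<in>{x'\<in>X. \<pi> j x' = \<pi> j x}. a x' ^ 2)"
      using that X Y by (intro member_le_sum) auto
    moreover have "a x ^ 2 > 0" using that by (simp add: Y_def)
    ultimately show ?thesis unfolding w_def real_sqrt_gt_0_iff by linarith
  qed
  have W0: "W j \<ge> 0" for j unfolding W_def by (intro sum_nonneg) auto
  have mk: "real m = (\<Sum>j\<in>J. real (k j))" using m by simp
  have m1: "real m \<ge> 1"
  proof -
    obtain j0 where "j0 \<in> J" using J by auto
    then have "k j0 \<le> m" unfolding m by (intro member_le_sum) (use J in auto)
    then show ?thesis using k[OF \<open>j0 \<in> J\<close>] by simp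
  qed
  define f where "f oj x = (case oj of None \<Rightarrow> (\<Prod>j\<in>J. w j (\<pi> j x) powr BH_exponent (k j))
      | Some j \<Rightarrow> a x ^ 2 * w j (\<pi> j x) powr (- 2 / (real (k j) + 1)))" for oj x
  define \<theta> where "\<theta> oj = (case oj of None \<Rightarrow> 1 / (real m + 1) | Some j \<Rightarrow> real (k j) / (real m + 1))" for oj
  define J' where "J' = insert None (Some ` J)"
  have J': "finite J'" using J by (simp add: J'_def)
  have prodJ': "(\<Prod>oj\<in>J'. g oj) = g None * (\<Prod>j\<in>J. g (Some j))" for g :: "'j option \<Rightarrow> real"
    unfolding J'_def using J by (subst prod.insert) (auto simp: prod.reindex)
  have \<theta>1: "(\<Sum>oj\<in>J'. \<theta> oj) = 1"
    unfolding J'_def using J m1 by (subst sum.insert) (auto simp: sum.reindex \<theta>_def mk sum_divide_distrib[symmetric] add_divide_distrib[symmetric])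
  have "(\<Sum>x\<in>X. a x powr BH_exponent m) = (\<Sum>x\<in>Y. a x powr BH_exponent m)"
    using X a Y by (intro sum.mono_neutral_right) (auto simp: Y_def less_le)
  also have "\<dots> = (\<Sum>x\<in>Y. \<Prod>oj\<in>J'. f oj x powr \<theta> oj)"
  proof (rule sum.cong[OF refl])
    fix x assume x: "x \<in> Y"
    have ax: "a x > 0" using x by (simp add: Y_def)
    have "(\<Prod>oj\<in>J'. f oj x powr \<theta> oj) =
       (\<Prod>j\<in>J. w j (\<pi> j x) powr BH_exponent (k j)) powr (1 / (real m + 1)) *
       (\<Prod>j\<in>J. (a x ^ 2 * w j (\<pi> j x) powr (- 2 / (real (k j) + 1))) powr (real (k j) / (real m + 1)))"
      unfolding prodJ' by (simp add: f_def \<theta>_def)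
    also have "(\<Prod>j\<in>J. w j (\<pi> j x) powr BH_exponent (k j)) powr (1 / (real m + 1))
        = (\<Prod>j\<in>J. w j (\<pi> j x) powr (BH_exponent (k j) / (real m + 1)))"
      by (subst prod_powr_distrib) (auto simp: powr_powr)
    also have "\<dots> * (\<Prod>j\<in>J. (a x ^ 2 * w j (\<pi> j x) powr (- 2 / (real (k j) + 1))) powr (real (k j) / (real m + 1)))
        = (\<Prod>j\<in>J. a x powr (2 * real (k j) / (real m + 1)))"
      unfolding prod.distrib[symmetric]
    proof (rule prod.cong[OF refl])
      fix j assume j: "j \<in> J"
      have "(a x ^ 2 * w j (\<pi> j x) powr (- 2 / (real (k j) + 1))) powr (real (k j) / (real m + 1))
         = (a x ^ 2) powr (real (k j) / (real m + 1)) * w j (\<pi> j x) powr (- 2 / (real (k j) + 1) * (real (k j) / (real m + 1)))"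
        by (simp add: powr_mult powr_powr)
      also have "(a x ^ 2) powr (real (k j) / (real m + 1)) = a x powr (2 * real (k j) / (real m + 1))"
        using ax powr_powr[of "a x" 2 "real (k j) / (real m + 1)"] by simp
      also have "- 2 / (real (k j) + 1) * (real (k j) / (real m + 1)) = - (BH_exponent (k j) / (real m + 1))"
        by (simp add: BH_exponent_def)
      finally show "w j (\<pi> j x) powr (BH_exponent (k j) / (real m + 1)) * (a x ^ 2 * w j (\<pi> j x) powr (- 2 / (real (k j) + 1))) powr (real (k j) / (real m + 1)) = a x powr (2 * real (k j) / (real m + 1))"
        using wpos[OF x, of j] by (simp add: powr_minus)
    qed
    also have "\<dots> = a x powr (\<Sum>j\<in>J. 2 * real (k j) / (real m + 1))"
      using ax J by (subst powr_sum) auto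
    also have "(\<Sum>j\<in>J. 2 * real (k j) / (real m + 1)) = BH_exponent m"
      by (simp add: BH_exponent_def sum_divide_distrib[symmetric] sum_distrib_left[symmetric] mk)
    finally show "a x powr BH_exponent m = (\<Prod>oj\<in>J'. f oj x powr \<theta> oj)" by simp
  qed
  also have "\<dots> \<le> (\<Prod>oj\<in>J'. (\<Sum>x\<in>Y. f oj x) powr \<theta> oj)"
  proof (rule Holder_sum_prod[OF J' Y(1) _ _ \<theta>1])
    show "f oj x \<ge> 0" if "oj \<in> J'" "x \<in> Y" for oj x
      by (cases oj) (auto simp: f_def intro!: prod_nonneg)
    show "\<theta> oj > 0" if "oj \<in> J'" for oj
      using that k m1 by (force simp: \<theta>_def J'_def)
  qed
  also have "\<dots> = (\<Sum>x\<in>Y. f None x) powr (1 / (real m + 1)) * (\<Prod>j\<in>J. (\<Sum>x\<in>Y. f (Some j) x) powr (real (k j) / (real m + 1)))"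
    unfolding prodJ' by (simp add: \<theta>_def)
  also have "\<dots> \<le> (\<Prod>j\<in>J. W j) powr (1 / (real m + 1)) * (\<Prod>j\<in>J. W j powr (real (k j) / (real m + 1)))"
  proof (intro mult_mono powr_mono2 prod_mono conjI)
    show "(\<Sum>x\<in>Y. f None x) \<le> (\<Prod>j\<in>J. W j)"
    proof -
      define h where "h x = (\<lambda>j\<in>J. \<pi> j x)" for x
      have injh: "inj_on h X"
      proof (rule inj_onI)
        fix x x' assume "x \<in> X" "x' \<in> X" and e: "h x = h x'"
        moreover have "\<pi> j x = \<pi> j x'" if "j \<in> J" for j using fun_cong[OF e, of j] that by (simp add: h_def)
        ultimately show "x = x'" using inj by blast
      qed
      have "(\<Sum>x\<in>Y. f None x) \<le> (\<Sum>x\<in>X. f None x)"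
        using X Y by (intro sum_mono2) (auto simp: f_def intro!: prod_nonneg)
      also have "\<dots> = (\<Sum>x\<in>X. \<Prod>j\<in>J. w j (h x j) powr BH_exponent (k j))"
        by (simp add: f_def h_def)
      also have "\<dots> = (\<Sum>g\<in>h ` X. \<Prod>j\<in>J. w j (g j) powr BH_exponent (k j))"
        using injh by (simp add: sum.reindex)
      also have "\<dots> \<le> (\<Sum>g\<in>PiE J (\<lambda>j. \<pi> j ` X). \<Prod>j\<in>J. w j (g j) powr BH_exponent (k j))"
        using J X by (intro sum_mono2 finite_PiE) (auto simp: h_def intro!: prod_nonneg)
      also have "\<dots> = (\<Prod>j\<in>J. W j)"
        unfolding W_def using J X by (subst prod_sum_PiE) auto
      finally show ?thesis .
    qed
    fix j assume j: "j \<in> J"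
    show "(\<Sum>x\<in>Y. f (Some j) x) \<le> W j"
    proof -
      have "(\<Sum>x\<in>Y. f (Some j) x) \<le> (\<Sum>x\<in>X. f (Some j) x)"
        using X Y by (intro sum_mono2) (auto simp: f_def)
      also have "\<dots> = (\<Sum>y\<in>\<pi> j ` X. \<Sum>x\<in>{x\<in>X. \<pi> j x = y}. f (Some j) x)"
        using X by (rule sum.image_gen)
      also have "\<dots> = W j"
        unfolding W_def
      proof (rule sum.cong[OF refl])
        fix y
        have "(\<Sum>x\<in>{x\<in>X. \<pi> j x = y}. f (Some j) x) = (\<Sum>x\<in>{x\<in>X. \<pi> j x = y}. a x ^ 2) * w j y powr (- 2 / (real (k j) + 1))"
          by (simp add: f_def sum_distrib_right)
        also have "(\<Sum>x\<in>{x\<in>X. \<pi> j x = y}. a x ^ 2) = w j y powr 2"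
          using w0[of j y] by (simp add: w_def sum_nonneg)
        also have "w j y powr 2 * w j y powr (- 2 / (real (k j) + 1)) = w j y powr BH_exponent (k j)"
          unfolding powr_add[symmetric] by (rule arg_cong[where f = "(powr) (w j y)"]) (simp add: BH_exponent_def field_simps)
        finally show "(\<Sum>x\<in>{x\<in>X. \<pi> j x = y}. f (Some j) x) = w j y powr BH_exponent (k j)" .
      qed
      finally show ?thesis .
    qed
  qed (auto simp: f_def intro!: sum_nonneg prod_nonneg W0)
  also have "\<dots> = (\<Prod>j\<in>J. W j powr ((real (k j) + 1) / (real m + 1)))"
  proof -
    have "(\<Prod>j\<in>J. W j) powr (1 / (real m + 1)) = (\<Prod>j\<in>J. W j powr (1 / (real m + 1)))"
      using W0 by (intro prod_powr_distrib)
    then show ?thesis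
      by (simp add: prod.distrib[symmetric] powr_add[symmetric] add_divide_distrib[symmetric] add.commute)
  qed
  finally show ?thesis by (simp add: W_def w_def)
qed

section \<open>Coefficients of polynomials bounded on an interval\<close>

text \<open>The Joukowski map \<open>u \<mapsto> (u + 1 / u) / 2\<close> takes the unit circle to the interval, so \<open>u\<^sup>d p ((u + 1 / u) / 2)\<close>
is a polynomial bounded by \<open>M\<close> on the unit disc. A point \<open>w\<close> is the image of some \<open>u\<close> in the disc
with \<open>1 / \<bar>u\<bar> \<le> 1 + 2 \<bar>w\<bar>\<close>.\<close>

lemma poly_growth_off_interval:
  fixes p :: "complex poly"
  assumes deg: "degree p \<le> d" and M: "\<And>t::real. -1 \<le> t \<Longrightarrow> t \<le> 1 \<Longrightarrow> cmod (poly p (of_real t)) \<le> M"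
  shows "cmod (poly p w) \<le> M * (1 + 2 * cmod w) ^ d"
proof -
  define R where "R = (\<lambda>u::complex. \<Sum>j\<le>d. coeff p j * ((u^2 + 1) / 2) ^ j * u ^ (d - j))"
  have R: "R u = u ^ d * poly p ((u + 1 / u) / 2)" if "u \<noteq> 0" for u
  proof -
    have "poly p x = (\<Sum>j\<le>d. coeff p j * x ^ j)" for x
      unfolding poly_altdef using deg by (intro sum.mono_neutral_left) (auto simp: coeff_eq_0)
    moreover have "((u^2 + 1) / 2) ^ j * u ^ (d - j) = u ^ d * ((u + 1 / u) / 2) ^ j" if "j \<le> d" for j
    proof -
      have "(u^2 + 1) / 2 = u * ((u + 1 / u) / 2)" using \<open>u \<noteq> 0\<close> by (simp add: field_simps power2_eq_square)
      then have "((u^2 + 1) / 2) ^ j * u ^ (d - j) = (u ^ j * u ^ (d - j)) * ((u + 1 / u) / 2) ^ j"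
        by (simp only: power_mult_distrib mult_ac)
      also have "u ^ j * u ^ (d - j) = u ^ d" using that by (simp add: power_add[symmetric])
      finally show ?thesis .
    qed
    ultimately show ?thesis unfolding R_def by (simp add: sum_distrib_left mult_ac)
  qed
  have onc: "cmod (R u) \<le> M" if "cmod u = 1" for u
  proof -
    have "u \<noteq> 0" using that by auto
    have "1 / u = cnj u" using that \<open>u \<noteq> 0\<close> complex_norm_square[of u] by (simp add: field_simps)
    then have "(u + 1 / u) / 2 = of_real (Re u)" by (simp add: complex_add_cnj)
    then have "cmod (R u) = cmod (poly p (of_real (Re u)))" using R[OF \<open>u \<noteq> 0\<close>] that by (simp add: norm_mult norm_power)
    also have "\<dots> \<le> M" using abs_Re_le_cmod[of u] that by (intro M) auto
    finally show ?thesis .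
  qed
  have inside: "cmod (R u) \<le> M" if "cmod u \<le> 1" for u
  proof (rule maximum_modulus_frontier[of R "cball 0 1"])
    show "R holomorphic_on interior (cball 0 1)" unfolding R_def by (intro holomorphic_intros) auto
    show "continuous_on (closure (cball 0 1)) R" unfolding R_def by (intro continuous_intros) auto
  qed (use onc that in auto)
  define s where "s = csqrt (w^2 - 1)"
  have s: "(w + s) * (w - s) = 1" by (simp add: s_def algebra_simps power2_eq_square[symmetric])
  obtain u where u: "cmod u \<le> 1" "u \<noteq> 0" "w = (u + 1 / u) / 2"
  proof (cases "cmod (w + s) \<le> 1")
    case True
    have "w + s \<noteq> 0" using s by auto
    moreover have "w - s = 1 / (w + s)" using s calculation by (simp add: field_simps)
    then have "w = ((w + s) + 1 / (w + s)) / 2" by (simp only: flip: \<open>w - s = 1 / (w + s)\<close>) simp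
    ultimately show ?thesis using True that by blast
  next
    case False
    have n: "w - s \<noteq> 0" using s by auto
    moreover have e: "w + s = 1 / (w - s)" using s calculation by (simp add: field_simps)
    then have "w = ((w - s) + 1 / (w - s)) / 2" by (simp only: flip: e) simp
    moreover have "cmod (w - s) \<le> 1" using False unfolding e using n by (simp add: norm_divide field_simps)
    ultimately show ?thesis using that by blast
  qed
  define v where "v = 1 / cmod u"
  have v1: "v \<ge> 1" using u by (simp add: v_def)
  have "2 * w = 1 / u - (- u)" by (subst u(3)) (simp add: add.commute)
  then have "cmod (2 * w) \<ge> v - cmod u" using norm_triangle_ineq2[of "1 / u" "- u"] by (simp add: v_def norm_divide)
  then have vw: "v \<le> 1 + 2 * cmod w" using u(1) by (simp add: norm_mult)
  have "R u = u ^ d * poly p w" using R[OF u(2)] unfolding u(3)[symmetric] .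
  then have "poly p w = R u * (1 / u) ^ d" using u(2) by (simp add: power_one_over)
  then have "cmod (poly p w) = cmod (R u) * v ^ d" by (simp add: norm_mult norm_power norm_divide v_def)
  also have "\<dots> \<le> M * (1 + 2 * cmod w) ^ d"
  proof (rule mult_mono)
    show "M \<ge> 0" using order_trans[OF norm_ge_zero M[of 0]] by simp
  qed (use inside u v1 vw in \<open>auto intro: power_mono\<close>)
  finally show ?thesis .
qed

text \<open>Cauchy's estimate on the circle of radius \<open>r\<close>. For \<open>r = k / d\<close> the bound is at most
\<open>M (exp 2 d / k)\<^sup>k\<close>, the true order of the Chebyshev coefficients up to a factor \<open>C\<^sup>k\<close>.\<close>

lemma poly_coeff_bound:
  fixes p :: "complex poly"
  assumes deg: "degree p \<le> d" and M: "\<And>t::real. -1 \<le> t \<Longrightarrow> t \<le> 1 \<Longrightarrow> cmod (poly p (of_real t)) \<le> M" and r: "r > 0"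
  shows "cmod (coeff p k) \<le> M * (1 + 2 * r) ^ d / r ^ k"
proof -
  have hd: "(deriv ^^ n) (poly p) = poly ((pderiv ^^ n) p)" for n
  proof (induction n)
    case (Suc n)
    have "deriv (poly r) = poly (pderiv r)" for r :: "complex poly"
      by (intro ext DERIV_imp_deriv poly_DERIV)
    with Suc show ?case by simp
  qed simp
  have "cmod ((deriv ^^ k) (poly p) 0) \<le> fact k * (M * (1 + 2 * r) ^ d) / r ^ k"
  proof (rule Cauchy_inequality)
    show "norm (poly p x) \<le> M * (1 + 2 * r) ^ d" if "norm (0 - x) = r" for x
      using poly_growth_off_interval[OF deg M, of x] that by simp
  qed (use r in \<open>auto intro!: holomorphic_intros continuous_intros\<close>)
  moreover have "(deriv ^^ k) (poly p) 0 = fact k * coeff p k"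
    unfolding hd by (simp add: poly_0_coeff_0 coeff_higher_pderiv pochhammer_fact)
  ultimately have "fact k * cmod (coeff p k) \<le> fact k * (M * (1 + 2 * r) ^ d / r ^ k)" by (simp add: norm_mult)
  then show ?thesis by (subst (asm) mult_le_cancel_left_pos) auto
qed

section \<open>Parseval and the comparison of the first two moments\<close>

lemma parseval:
  assumes "finite I" "q \<ge> 1"
  shows "(\<Sum>x\<in>cube q I. cmod (fourier_sum q I b x) ^ 2) = real q ^ card I * (\<Sum>\<alpha>\<in>multi q I. cmod (b \<alpha>) ^ 2)"
  using assms(1)
proof (induction I arbitrary: b rule: finite_induct)
  case empty
  then show ?case by (simp add: cube_def multi_def fourier_sum_def char_prod_def)
next
  case (insert i I)
  have "(\<Sum>x\<in>cube q (insert i I). cmod (fourier_sum q (insert i I) b x) ^ 2)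
     = (\<Sum>y\<in>cyclic_roots q. \<Sum>x\<in>cube q I. cmod (fourier_sum q I (\<lambda>\<alpha>. \<Sum>a<q. b (\<alpha>(i := a)) * y ^ a) x) ^ 2)"
    unfolding sum_cube_insert[OF insert.hyps(2)] fourier_sum_insert[OF insert.hyps(1,2)] ..
  also have "\<dots> = real q ^ card I * (\<Sum>\<alpha>\<in>multi q I. \<Sum>y\<in>cyclic_roots q. cmod (\<Sum>a<q. b (\<alpha>(i := a)) * y ^ a) ^ 2)"
    unfolding insert.IH sum_distrib_left[symmetric] by (subst sum.swap) simp
  also have "\<dots> = real q ^ card I * (\<Sum>\<alpha>\<in>multi q I. real q * (\<Sum>a<q. cmod (b (\<alpha>(i := a))) ^ 2))"
    unfolding parseval_one[OF assms(2)] ..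
  also have "\<dots> = real q ^ card (insert i I) * (\<Sum>\<alpha>\<in>multi q (insert i I). cmod (b \<alpha>) ^ 2)"
    unfolding sum_multi_insert[OF insert.hyps(2)] using insert.hyps
    by (subst sum.swap[where A = "{..<q}"]) (simp add: sum_distrib_left mult_ac)
  finally show ?case .
qed

text \<open>Hypercontractivity with noise parameter \<open>sqrt (1 / 2)\<close> compares the second moment with a moment of
some order \<open>p\<close> strictly between \<open>1\<close> and \<open>2\<close>; interpolating the latter between the first and the
second moment removes it.\<close>

lemma L2_le_L1_homogeneous:
  assumes q: "q \<ge> 2" and I: "finite I"
    and hom: "\<And>\<alpha>. \<alpha> \<in> multi q I \<Longrightarrow> level I \<alpha> \<noteq> k \<Longrightarrow> b \<alpha> = 0"
  shows "sqrt (\<Sum>\<alpha>\<in>multi q I. cmod (b \<alpha>) ^ 2) \<le>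
     2 powr (lsi_const q * real k) * ((\<Sum>x\<in>cube q I. cmod (fourier_sum q I b x)) / real q ^ card I)"
proof -
  define C where "C = lsi_const q"
  have C: "C \<ge> 2" using lsi_const_ge_2[OF q] by (simp add: C_def)
  (* the order for which hypercontractivity admits r = 1/2 *)
  define p where "p = 4 * C / (2 * C + 1)"
  define s where "s = 1 / (2 * C)"
  have s: "s > 0" using C by (simp add: s_def)
  have p: "1 < p" "p < 2" "2 / p - 1 = s" using C by (auto simp: p_def s_def field_simps)
  define Q where "Q = real q ^ card I"
  have Q: "Q > 0" using q by (simp add: Q_def)
  define g where "g x = cmod (fourier_sum q I b x)" for x
  define N where "N = (\<Sum>\<alpha>\<in>multi q I. cmod (b \<alpha>) ^ 2)"
  define E1 where "E1 = (\<Sum>x\<in>cube q I. g x) / Q"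
  have E10: "E1 \<ge> 0" using Q by (simp add: E1_def g_def sum_nonneg)
  have N0: "N \<ge> 0" by (simp add: N_def sum_nonneg)
  have "(1/2) ^ k * N = (\<Sum>\<alpha>\<in>multi q I. (1/2) ^ level I \<alpha> * cmod (b \<alpha>) ^ 2)"
    unfolding N_def sum_distrib_left using hom by (intro sum.cong refl) auto
  also have "\<dots> \<le> ((\<Sum>x\<in>cube q I. g x powr p) / Q) powr (2 / p)"
    unfolding g_def Q_def
    by (rule hypercontractivity) (use q p I C in \<open>auto simp: C_def s_def\<close>)
  also have "\<dots> \<le> (E1 powr (2 - p) * N powr (p - 1)) powr (2 / p)"
  proof (rule powr_mono2)
    have "(\<Sum>x\<in>cube q I. g x powr p) / Q = (\<Sum>x\<in>cube q I. \<Prod>j\<in>{True,False}. (if j then g x / Q else g x ^ 2 / Q) powr (if j then 2 - p else p - 1))"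
      unfolding sum_divide_distrib
    proof (rule sum.cong[OF refl])
      fix x
      have "(g x / Q) powr (2 - p) * (g x ^ 2 / Q) powr (p - 1) = (g x powr (2 - p) * (g x ^ 2) powr (p - 1)) / (Q powr (2 - p) * Q powr (p - 1))"
        using Q by (simp add: powr_divide g_def)
      also have "Q powr (2 - p) * Q powr (p - 1) = Q" using Q by (simp add: powr_add[symmetric])
      also have "(g x ^ 2) powr (p - 1) = g x powr (2 * (p - 1))"
        using powr_powr[of "g x" 2 "p - 1"] by (simp add: g_def)
      also have "g x powr (2 - p) * g x powr (2 * (p - 1)) = g x powr p" by (simp add: powr_add[symmetric])
      finally show "g x powr p / Q = (\<Prod>j\<in>{True,False}. (if j then g x / Q else g x ^ 2 / Q) powr (if j then 2 - p else p - 1))"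
        by simp
    qed
    also have "\<dots> \<le> (\<Prod>j\<in>{True,False}. (\<Sum>x\<in>cube q I. if j then g x / Q else g x ^ 2 / Q) powr (if j then 2 - p else p - 1))"
      by (rule Holder_sum_prod) (use I p Q in \<open>auto simp: g_def\<close>)
    also have "\<dots> = E1 powr (2 - p) * N powr (p - 1)"
    proof -
      have "(\<Sum>x\<in>cube q I. g x ^ 2 / Q) = N"
        unfolding sum_divide_distrib[symmetric] g_def N_def using parseval[OF I, of q b] q Q by (simp add: Q_def)
      then show ?thesis by (simp add: E1_def sum_divide_distrib)
    qed
    finally show "(\<Sum>x\<in>cube q I. g x powr p) / Q \<le> E1 powr (2 - p) * N powr (p - 1)" .
  qed (use p Q in \<open>auto intro!: divide_nonneg_nonneg sum_nonneg\<close>)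
  also have "\<dots> = E1 powr (2 * s) * N powr (1 - s)"
  proof -
    have "(2 - p) * (2 / p) = 2 * s" "(p - 1) * (2 / p) = 1 - s" using p(1) unfolding p(3)[symmetric] by (auto simp: field_simps)
    then show ?thesis by (simp add: powr_mult powr_powr)
  qed
  finally have main: "(1/2) ^ k * N \<le> E1 powr (2 * s) * N powr (1 - s)" .
  have "sqrt N \<le> 2 powr (C * real k) * E1"
  proof (cases "N = 0")
    case True then show ?thesis using E10 by simp
  next
    case False
    then have Np: "N > 0" using N0 by simp
    have sp: "N = N powr s * N powr (1 - s)" using Np by (simp add: powr_add[symmetric])
    have "(1/2) ^ k * N powr s * N powr (1 - s) \<le> E1 powr (2 * s) * N powr (1 - s)"
      using main by (simp only: mult.assoc sp[symmetric])
    then have "(1/2) ^ k * N powr s \<le> E1 powr (2 * s)" using Np by simp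
    then have "N powr s \<le> 2 ^ k * E1 powr (2 * s)" by (simp add: field_simps)
    then have "(N powr s) powr C \<le> (2 ^ k * E1 powr (2 * s)) powr C" using C by (intro powr_mono2) auto
    moreover have "(N powr s) powr C = sqrt N" using C Np by (simp add: powr_powr s_def powr_half_sqrt)
    moreover have "(2 ^ k * E1 powr (2 * s)) powr C = 2 powr (C * real k) * E1"
    proof -
      have "(E1 powr (2 * s)) powr C = E1" using C E10 by (simp add: powr_powr s_def)
      moreover have "(2 ^ k) powr C = (2::real) powr (C * real k)" by (simp add: powr_realpow[symmetric] powr_powr mult.commute)
      ultimately show ?thesis by (simp add: powr_mult)
    qed
    ultimately show ?thesis by simp
  qed
  then show ?thesis by (simp add: N_def E1_def C_def g_def Q_def)
qed

section \<open>Perturbing the law of each coordinate\<close>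

definition sub_index :: "'i set \<Rightarrow> ('i \<Rightarrow> nat) \<Rightarrow> ('i \<Rightarrow> nat) \<Rightarrow> bool" where
  "sub_index I \<beta> \<alpha> \<longleftrightarrow> (\<forall>i\<in>I. \<beta> i = 0 \<or> \<beta> i = \<alpha> i)"

abbreviation extensions :: "nat \<Rightarrow> 'i set \<Rightarrow> ('i \<Rightarrow> nat) \<Rightarrow> ('i \<Rightarrow> nat) set" where
  "extensions q I \<beta> \<equiv> {\<alpha>\<in>multi q I. sub_index I \<beta> \<alpha>}"

abbreviation restrictions :: "nat \<Rightarrow> 'i set \<Rightarrow> ('i \<Rightarrow> nat) \<Rightarrow> ('i \<Rightarrow> nat) set" where
  "restrictions q I \<alpha> \<equiv> {\<beta>\<in>multi q I. sub_index I \<beta> \<alpha>}"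

text \<open>The coefficient of order \<open>\<beta>\<close> in the expansion of a Fourier sum at the point \<open>(1, \<dots>, 1)\<close>, after the
noise operator with parameter \<open>l\<close> has acted on the coordinates outside the support of \<open>\<beta>\<close>. Since
multiplying \<open>c \<alpha>\<close> by \<open>x\<^sup>\<alpha>\<close> translates the Fourier sum, no other base point is needed. For \<open>l = 0\<close> it is
the Fourier coefficient itself.\<close>

definition deriv_coeff :: "nat \<Rightarrow> 'i set \<Rightarrow> real \<Rightarrow> (('i \<Rightarrow> nat) \<Rightarrow> complex) \<Rightarrow> ('i \<Rightarrow> nat) \<Rightarrow> complex" where
  "deriv_coeff q I l c \<beta> =
     (\<Sum>\<alpha>\<in>extensions q I \<beta>. c \<alpha> * of_real (l ^ (level I \<alpha> - level I \<beta>)))"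

text \<open>The variables are indexed by a coordinate together with a nontrivial character of the cyclic group.\<close>

definition index_monomial :: "'i set \<Rightarrow> ('i \<Rightarrow> nat \<Rightarrow> 'c) \<Rightarrow> ('i \<Rightarrow> nat) \<Rightarrow> 'c :: comm_monoid_mult" where
  "index_monomial I z \<beta> = (\<Prod>i\<in>I. if \<beta> i = 0 then 1 else z i (\<beta> i))"

lemma level_sub_index:
  assumes "finite I" "sub_index I \<beta> \<alpha>"
  shows "card {i\<in>I. \<alpha> i \<noteq> 0 \<and> \<beta> i = 0} = level I \<alpha> - level I \<beta>" and "level I \<beta> \<le> level I \<alpha>"
proof -
  have "{i\<in>I. \<alpha> i \<noteq> 0 \<and> \<beta> i = 0} = supp I \<alpha> - (supp I \<beta>)" by auto
  moreover have s: "supp I \<beta> \<subseteq> (supp I \<alpha>)" using assms(2) by (auto simp: sub_index_def)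
  ultimately show "card {i\<in>I. \<alpha> i \<noteq> 0 \<and> \<beta> i = 0} = level I \<alpha> - level I \<beta>"
    using assms by (simp add: level_def card_Diff_subset)
  show "level I \<beta> \<le> level I \<alpha>" unfolding level_def by (rule card_mono) (use s assms in auto)
qed

lemma prod_if_power:
  fixes u :: "'c :: comm_monoid_mult"
  assumes "finite I"
  shows "(\<Prod>i\<in>I. if P i then u else 1) = u ^ card {i\<in>I. P i}"
  using assms by (simp add: prod.If_cases Int_def)

lemma perturbed_product_expand:
  fixes z :: "'i \<Rightarrow> nat \<Rightarrow> complex"
  assumes I: "finite I" and \<alpha>: "\<alpha> \<in> multi q I"
  shows "(\<Prod>i\<in>I. if \<alpha> i = 0 then 1 else l + e * z i (\<alpha> i)) =
    (\<Sum>\<beta>\<in>restrictions q I \<alpha>. l ^ (level I \<alpha> - level I \<beta>) * e ^ level I \<beta> * index_monomial I z \<beta>)"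
proof -
  define g where "g i b = (if \<alpha> i \<noteq> 0 \<and> b = 0 then l else 1) * (if b \<noteq> 0 then e else 1) * (if b = 0 then 1 else z i b)" for i b
  have "(\<Prod>i\<in>I. if \<alpha> i = 0 then 1 else l + e * z i (\<alpha> i)) = (\<Prod>i\<in>I. \<Sum>b\<in>{0, \<alpha> i}. g i b)"
    by (intro prod.cong refl) (auto simp: g_def)
  also have "\<dots> = (\<Sum>\<beta>\<in>PiE I (\<lambda>i. {0, \<alpha> i}). \<Prod>i\<in>I. g i (\<beta> i))"
    using I by (subst prod_sum_PiE) auto
  also have "PiE I (\<lambda>i. {0, \<alpha> i}) = restrictions q I \<alpha>"
  proof -
    have a: "\<alpha> i < q" if "i \<in> I" for i using \<alpha> that by (auto simp: multi_def PiE_iff)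
    show ?thesis
    proof (intro set_eqI iffI)
      fix \<beta> assume "\<beta> \<in> PiE I (\<lambda>i. {0, \<alpha> i})"
      then have *: "\<beta> i = 0 \<or> \<beta> i = \<alpha> i" "\<beta> \<in> extensional I" if "i \<in> I" for i using that by (auto simp: PiE_iff)
      have "\<beta> i < q" if "i \<in> I" for i using *(1)[OF that] a[OF that] by auto
      then show "\<beta> \<in> restrictions q I \<alpha>"
        using * \<open>\<beta> \<in> PiE I (\<lambda>i. {0, \<alpha> i})\<close> by (auto simp: multi_def sub_index_def PiE_iff)
    qed (auto simp: multi_def sub_index_def PiE_iff)
  qed
  also have "(\<Sum>\<beta>\<in>restrictions q I \<alpha>. \<Prod>i\<in>I. g i (\<beta> i)) = (\<Sum>\<beta>\<in>restrictions q I \<alpha>. l ^ (level I \<alpha> - level I \<beta>) * e ^ level I \<beta> * index_monomial I z \<beta>)"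
  proof (rule sum.cong[OF refl])
    fix \<beta> assume "\<beta> \<in> restrictions q I \<alpha>"
    then have s: "sub_index I \<beta> \<alpha>" by simp
    have "(\<Prod>i\<in>I. g i (\<beta> i)) = (\<Prod>i\<in>I. if \<alpha> i \<noteq> 0 \<and> \<beta> i = 0 then l else 1) * (\<Prod>i\<in>I. if \<beta> i \<noteq> 0 then e else 1) * index_monomial I z \<beta>"
      unfolding g_def prod.distrib index_monomial_def ..
    then show "(\<Prod>i\<in>I. g i (\<beta> i)) = l ^ (level I \<alpha> - level I \<beta>) * e ^ level I \<beta> * index_monomial I z \<beta>"
      unfolding prod_if_power[OF I] level_sub_index(1)[OF I s] level_def[of I \<beta>] .
  qed
  finally show ?thesis .
qed

lemma perturbed_sum_expand:
  fixes z :: "'i \<Rightarrow> nat \<Rightarrow> complex"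
  assumes I: "finite I"
  shows "(\<Sum>\<alpha>\<in>multi q I. c \<alpha> * (\<Prod>i\<in>I. if \<alpha> i = 0 then 1 else of_real l + of_real e * z i (\<alpha> i)))
     = (\<Sum>\<beta>\<in>multi q I. of_real e ^ level I \<beta> * index_monomial I z \<beta> * deriv_coeff q I l c \<beta>)"
proof -
  have "(\<Sum>\<alpha>\<in>multi q I. c \<alpha> * (\<Prod>i\<in>I. if \<alpha> i = 0 then 1 else of_real l + of_real e * z i (\<alpha> i)))
    = (\<Sum>\<alpha>\<in>multi q I. \<Sum>\<beta>\<in>multi q I. if sub_index I \<beta> \<alpha> then c \<alpha> * (of_real l ^ (level I \<alpha> - level I \<beta>) * of_real e ^ level I \<beta> * index_monomial I z \<beta>) else 0)"
    using I by (intro sum.cong refl) (simp add: perturbed_product_expand sum_distrib_left sum.inter_filter if_distrib[of "(*) _"] cong: if_cong)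
  also have "\<dots> = (\<Sum>\<beta>\<in>multi q I. \<Sum>\<alpha>\<in>multi q I. if sub_index I \<beta> \<alpha> then c \<alpha> * (of_real l ^ (level I \<alpha> - level I \<beta>) * of_real e ^ level I \<beta> * index_monomial I z \<beta>) else 0)"
    by (rule sum.swap)
  also have "\<dots> = (\<Sum>\<beta>\<in>multi q I. of_real e ^ level I \<beta> * index_monomial I z \<beta> * deriv_coeff q I l c \<beta>)"
    using I by (intro sum.cong refl) (simp add: deriv_coeff_def sum_distrib_left sum.inter_filter[symmetric] mult_ac)
  finally show ?thesis .
qed

text \<open>The directions in which the laws of the coordinates are perturbed: the bound keeps
\<open>1 + \<phi> i\<close> nonnegative, and the vanishing mean keeps its total mass and thereby the degree of the
perturbation in the parameter at most \<open>d\<close>, whatever the number of coordinates.\<close>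

definition admissible :: "nat \<Rightarrow> 'i set \<Rightarrow> ('i \<Rightarrow> complex \<Rightarrow> real) \<Rightarrow> bool" where
  "admissible q I \<phi> \<longleftrightarrow> (\<forall>i\<in>I. (\<forall>w\<in>cyclic_roots q. \<bar>\<phi> i w\<bar> \<le> 1) \<and> (\<Sum>w\<in>cyclic_roots q. \<phi> i w) = 0)"

definition moment :: "nat \<Rightarrow> (complex \<Rightarrow> complex) \<Rightarrow> nat \<Rightarrow> complex" where
  "moment q \<Phi> a = (\<Sum>w\<in>cyclic_roots q. \<Phi> w * w ^ a) / of_nat q"

abbreviation moments :: "nat \<Rightarrow> ('i \<Rightarrow> complex \<Rightarrow> real) \<Rightarrow> 'i \<Rightarrow> nat \<Rightarrow> complex" where
  "moments q \<phi> \<equiv> (\<lambda>i. moment q (\<lambda>w. of_real (\<phi> i w)))"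

lemma sum_char_zero:
  assumes "q \<ge> 1" "a < q"
  shows "(\<Sum>w\<in>cyclic_roots q. w ^ a) = (if a = 0 then of_nat q else 0)"
  using characters_orthogonal[OF assms(1,2), of 0] assms by simp

text \<open>The sum is the expectation of the Fourier sum when the coordinates are independent, each with law
\<open>l\<close> times the unit mass at \<open>1\<close> plus \<open>e\<close> times the density \<open>1 + \<phi> i\<close>.\<close>

lemma perturbed_sum_bound:
  assumes q: "q \<ge> 1" and I: "finite I" and adm: "admissible q I \<phi>"
    and l: "0 \<le> l" "0 \<le> e" "l + e = 1"
    and M: "\<And>x. x \<in> cube q I \<Longrightarrow> cmod (fourier_sum q I c x) \<le> M"
  shows "cmod (\<Sum>\<alpha>\<in>multi q I. c \<alpha> * (\<Prod>i\<in>I. if \<alpha> i = 0 then 1 else of_real l + of_real e * moments q \<phi> i (\<alpha> i))) \<le> M"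
proof -
  let ?\<Omega> = "cyclic_roots q"
  have one: "1 \<in> ?\<Omega>" using q by (simp add: cyclic_roots_eq)
  define \<mu> where "\<mu> i w = (if w = 1 then l else 0) + e * (1 + \<phi> i w) / real q" for i and w :: complex
  have \<mu>0: "\<mu> i w \<ge> 0" if "i \<in> I" "w \<in> ?\<Omega>" for i w
  proof -
    have "\<bar>\<phi> i w\<bar> \<le> 1" using adm that by (auto simp: admissible_def)
    then have "1 + \<phi> i w \<ge> 0" by linarith
    then show ?thesis using l by (simp add: \<mu>_def)
  qed
  have \<mu>1: "(\<Sum>w\<in>?\<Omega>. \<mu> i w) = 1" if "i \<in> I" for i
  proof -
    have "(\<Sum>w\<in>?\<Omega>. \<mu> i w) = l + e * (real q + (\<Sum>w\<in>?\<Omega>. \<phi> i w)) / real q"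
      using one q by (simp add: \<mu>_def sum.distrib sum_divide_distrib[symmetric] sum_distrib_left[symmetric] sum.delta card_cyclic_roots)
    then show ?thesis using adm that l q by (simp add: admissible_def)
  qed
  have \<mu>a: "(\<Sum>w\<in>?\<Omega>. of_real (\<mu> i w) * w ^ a) = (if a = 0 then 1 else of_real l + of_real e * moments q \<phi> i a)"
    if "i \<in> I" "a < q" for i a
  proof (cases "a = 0")
    case True
    then show ?thesis using \<mu>1[OF that(1)] by (simp flip: of_real_sum)
  next
    case False
    have "(\<Sum>w\<in>?\<Omega>. of_real (\<mu> i w) * w ^ a) = (\<Sum>w\<in>?\<Omega>. (if w = 1 then of_real l else 0) + (of_real e / of_nat q) * w ^ a + (of_real e / of_nat q) * (of_real (\<phi> i w) * w ^ a))"
      by (intro sum.cong refl) (auto simp: \<mu>_def add_divide_distrib algebra_simps)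
    also have "\<dots> = of_real l + (of_real e / of_nat q) * (\<Sum>w\<in>?\<Omega>. w ^ a) + (of_real e / of_nat q) * (\<Sum>w\<in>?\<Omega>. of_real (\<phi> i w) * w ^ a)"
      using one by (simp add: sum.distrib sum_distrib_left sum.delta)
    finally show ?thesis using False sum_char_zero[OF q that(2)] by (simp add: moment_def)
  qed
  have "(\<Sum>\<alpha>\<in>multi q I. c \<alpha> * (\<Prod>i\<in>I. if \<alpha> i = 0 then 1 else of_real l + of_real e * moments q \<phi> i (\<alpha> i)))
    = (\<Sum>\<alpha>\<in>multi q I. c \<alpha> * (\<Prod>i\<in>I. \<Sum>w\<in>?\<Omega>. of_real (\<mu> i w) * w ^ \<alpha> i))"
  proof (intro sum.cong refl arg_cong2[where f = "(*)"] prod.cong)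
    fix \<alpha> i assume "\<alpha> \<in> multi q I" "i \<in> I"
    then have "\<alpha> i < q" by (auto simp: multi_def PiE_iff)
    with \<mu>a[OF \<open>i \<in> I\<close> this]
    show "(if \<alpha> i = 0 then 1 else of_real l + of_real e * moments q \<phi> i (\<alpha> i)) = (\<Sum>w\<in>?\<Omega>. of_real (\<mu> i w) * w ^ \<alpha> i)"
      by simp
  qed
  also have "\<dots> = (\<Sum>\<alpha>\<in>multi q I. \<Sum>x\<in>cube q I. c \<alpha> * ((\<Prod>i\<in>I. of_real (\<mu> i (x i))) * char_prod I \<alpha> x))"
    using I unfolding cube_def char_prod_def sum_distrib_left[symmetric]
    by (subst prod_sum_PiE) (auto simp: prod.distrib)
  also have "\<dots> = (\<Sum>x\<in>cube q I. (\<Prod>i\<in>I. of_real (\<mu> i (x i))) * fourier_sum q I c x)"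
    by (subst sum.swap) (simp add: fourier_sum_def sum_distrib_left mult_ac)
  also have "cmod \<dots> \<le> (\<Sum>x\<in>cube q I. (\<Prod>i\<in>I. \<mu> i (x i)) * M)"
  proof (rule order_trans[OF norm_sum sum_mono])
    fix x assume x: "x \<in> cube q I"
    then have "x i \<in> ?\<Omega>" if "i \<in> I" for i using that by (auto simp: cube_def PiE_iff)
    then have p: "(\<Prod>i\<in>I. \<mu> i (x i)) \<ge> 0" using \<mu>0 by (intro prod_nonneg) auto
    have "cmod ((\<Prod>i\<in>I. of_real (\<mu> i (x i))) * fourier_sum q I c x) = (\<Prod>i\<in>I. \<mu> i (x i)) * cmod (fourier_sum q I c x)"
      using p by (simp add: norm_mult flip: of_real_prod)
    also have "\<dots> \<le> (\<Prod>i\<in>I. \<mu> i (x i)) * M" using p M[OF x] by (intro mult_left_mono) auto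
    finally show "cmod ((\<Prod>i\<in>I. of_real (\<mu> i (x i))) * fourier_sum q I c x) \<le> (\<Prod>i\<in>I. \<mu> i (x i)) * M" .
  qed
  also have "\<dots> = M"
  proof -
    have "(\<Sum>x\<in>cube q I. \<Prod>i\<in>I. \<mu> i (x i)) = (\<Prod>i\<in>I. \<Sum>w\<in>?\<Omega>. \<mu> i w)"
      unfolding cube_def using I by (subst prod_sum_PiE) auto
    also have "\<dots> = 1" using \<mu>1 by simp
    finally show ?thesis by (simp flip: sum_distrib_right)
  qed
  finally show ?thesis .
qed

lemma index_monomial_scale:
  fixes z :: "'i \<Rightarrow> nat \<Rightarrow> 'c :: comm_monoid_mult"
  assumes "finite I"
  shows "index_monomial I (\<lambda>i a. t * z i a) \<beta> = t ^ level I \<beta> * index_monomial I z \<beta>"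
proof -
  have "index_monomial I (\<lambda>i a. t * z i a) \<beta> = (\<Prod>i\<in>I. (if \<beta> i \<noteq> 0 then t else 1) * (if \<beta> i = 0 then 1 else z i (\<beta> i)))"
    unfolding index_monomial_def by (intro prod.cong refl) auto
  then show ?thesis by (simp add: prod.distrib prod_if_power[OF assms] index_monomial_def level_def)
qed

lemma deriv_coeff_eq_0:
  assumes "finite I" "\<And>\<alpha>. \<alpha> \<in> multi q I \<Longrightarrow> level I \<alpha> > d \<Longrightarrow> c \<alpha> = 0" "level I \<beta> > d"
  shows "deriv_coeff q I l c \<beta> = 0"
proof -
  have "c \<alpha> = 0" if "\<alpha> \<in> multi q I" "sub_index I \<beta> \<alpha>" for \<alpha>
    using assms(2)[OF that(1)] level_sub_index(2)[OF assms(1) that(2)] assms(3) by simp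
  then show ?thesis by (simp add: deriv_coeff_def)
qed

definition level_part where
  "level_part q I l c k z = (\<Sum>\<beta>\<in>level_set q I k. deriv_coeff q I l c \<beta> * index_monomial I z \<beta>)"

text \<open>Scaling the direction \<open>\<phi>\<close> by a real parameter \<open>t\<close> between \<open>-1\<close> and \<open>1\<close> turns the perturbed sum into
a bounded polynomial of degree at most \<open>d\<close> in \<open>t\<close>; its coefficient of order \<open>k\<close> is \<open>e\<^sup>k\<close> times the
level part.\<close>

lemma level_part_bound:
  assumes q: "q \<ge> 1" and I: "finite I" and adm: "admissible q I \<phi>"
    and l: "0 \<le> l" "0 < e" "l + e = 1" and d: "d \<ge> 1" and k: "k \<ge> 1"
    and deg: "\<And>\<alpha>. \<alpha> \<in> multi q I \<Longrightarrow> level I \<alpha> > d \<Longrightarrow> c \<alpha> = 0"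
    and M: "\<And>x. x \<in> cube q I \<Longrightarrow> cmod (fourier_sum q I c x) \<le> M"
  shows "cmod (level_part q I l c k (moments q \<phi>)) \<le> M * (exp 2 * real d / (real k * e)) ^ k"
proof -
  let ?z = "moments q \<phi>"
  define p where "p = (\<Sum>\<beta>\<in>multi q I. monom (of_real e ^ level I \<beta> * index_monomial I ?z \<beta> * deriv_coeff q I l c \<beta>) (level I \<beta>))"
  have deg_p: "degree p \<le> d"
    unfolding p_def
  proof (rule degree_sum_le)
    fix \<beta> assume "\<beta> \<in> multi q I"
    show "degree (monom (of_real e ^ level I \<beta> * index_monomial I ?z \<beta> * deriv_coeff q I l c \<beta>) (level I \<beta>)) \<le> d"
    proof (cases "level I \<beta> \<le> d")
      case True then show ?thesis using degree_monom_le order_trans by blast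
    next
      case False then show ?thesis using deriv_coeff_eq_0[OF I deg, where d = d and \<beta> = \<beta>] by simp
    qed
  qed (use I in auto)
  have bound_p: "cmod (poly p (of_real t)) \<le> M" if "-1 \<le> t" "t \<le> 1" for t
  proof -
    define \<psi> where "\<psi> i w = t * \<phi> i w" for i w
    have adm': "admissible q I \<psi>"
      unfolding admissible_def
    proof (intro ballI conjI)
      fix i w assume "i \<in> I" "w \<in> cyclic_roots q"
      then have "\<bar>\<phi> i w\<bar> \<le> 1" using adm by (auto simp: admissible_def)
      then show "\<bar>\<psi> i w\<bar> \<le> 1" using that by (simp add: \<psi>_def abs_mult mult_le_one)
    next
      fix i assume "i \<in> I" then show "(\<Sum>w\<in>cyclic_roots q. \<psi> i w) = 0"
        using adm by (simp add: \<psi>_def admissible_def flip: sum_distrib_left)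
    qed
    have m: "moments q \<psi> = (\<lambda>i a. of_real t * ?z i a)"
      by (intro ext) (simp add: moment_def \<psi>_def sum_distrib_left mult_ac)
    have "poly p (of_real t) = (\<Sum>\<beta>\<in>multi q I. of_real e ^ level I \<beta> * index_monomial I (moments q \<psi>) \<beta> * deriv_coeff q I l c \<beta>)"
      unfolding m index_monomial_scale[OF I] p_def
      by (simp add: poly_sum poly_monom mult_ac)
    also have "\<dots> = (\<Sum>\<alpha>\<in>multi q I. c \<alpha> * (\<Prod>i\<in>I. if \<alpha> i = 0 then 1 else of_real l + of_real e * moments q \<psi> i (\<alpha> i)))"
      by (rule perturbed_sum_expand[OF I, symmetric])
    finally have "poly p (of_real t) = \<dots>" .
    then show ?thesis using perturbed_sum_bound[OF q I adm' l(1) less_imp_le[OF l(2)] l(3) M] by simp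
  qed
  have "coeff p k = of_real e ^ k * level_part q I l c k ?z"
  proof -
    have "coeff p k = (\<Sum>\<beta>\<in>multi q I. if level I \<beta> = k then of_real e ^ level I \<beta> * index_monomial I ?z \<beta> * deriv_coeff q I l c \<beta> else 0)"
      by (simp add: p_def coeff_sum)
    also have "\<dots> = (\<Sum>\<beta>\<in>level_set q I k. of_real e ^ level I \<beta> * index_monomial I ?z \<beta> * deriv_coeff q I l c \<beta>)"
      by (rule sum.inter_filter[symmetric]) (use I in simp)
    also have "\<dots> = of_real e ^ k * level_part q I l c k ?z"
      unfolding level_part_def sum_distrib_left by (intro sum.cong refl) auto
    finally show ?thesis .
  qed
  then have "e ^ k * cmod (level_part q I l c k ?z) = cmod (coeff p k)" using l by (simp add: norm_mult norm_power)
  also have "\<dots> \<le> M * (1 + 2 * (real k / real d)) ^ d / (real k / real d) ^ k"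
    by (rule poly_coeff_bound[OF deg_p bound_p]) (use k d in auto)
  also have "\<dots> \<le> M * exp (2 * real k) / (real k / real d) ^ k"
  proof (intro divide_right_mono mult_left_mono)
    have "(1 + 2 * (real k / real d)) ^ d \<le> exp (2 * (real k / real d)) ^ d" by (intro power_mono exp_ge_add_one_self) auto
    also have "\<dots> = exp (2 * real k)" using d by (simp flip: exp_of_nat_mult)
    finally show "(1 + 2 * (real k / real d)) ^ d \<le> exp (2 * real k)" .
    show "M \<ge> 0" using order_trans[OF norm_ge_zero bound_p[of 0]] by simp
  qed auto
  also have "\<dots> = e ^ k * (M * (exp 2 * real d / (real k * e)) ^ k)"
    using l k d by (simp add: field_simps power_mult_distrib exp_of_nat_mult[symmetric])
  finally show ?thesis using l by simp
qed

section \<open>The gradient of the homogeneous part of a perturbation\<close>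

lemma coeff_prod_linear:
  fixes a b :: "'i \<Rightarrow> complex"
  assumes "finite S"
  shows "coeff (\<Prod>i\<in>S. [:a i, b i:]) 0 = (\<Prod>i\<in>S. a i)"
    and "coeff (\<Prod>i\<in>S. [:a i, b i:]) (Suc 0) = (\<Sum>i\<in>S. b i * (\<Prod>j\<in>S - {i}. a j))"
proof -
  have *: "coeff (\<Prod>i\<in>S. [:a i, b i:]) 0 = (\<Prod>i\<in>S. a i) \<and> coeff (\<Prod>i\<in>S. [:a i, b i:]) (Suc 0) = (\<Sum>i\<in>S. b i * (\<Prod>j\<in>S - {i}. a j))"
    using assms
  proof (induction S rule: finite_induct)
    case (insert s S)
    have "(\<Sum>i\<in>insert s S. b i * (\<Prod>j\<in>insert s S - {i}. a j)) = b s * (\<Prod>j\<in>S. a j) + (\<Sum>i\<in>S. b i * (a s * (\<Prod>j\<in>S - {i}. a j)))"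
    proof -
      have "insert s S - {s} = S" using insert by auto
      moreover have "(\<Prod>j\<in>insert s S - {i}. a j) = a s * (\<Prod>j\<in>S - {i}. a j)" if "i \<in> S" for i
      proof -
        have "insert s S - {i} = insert s (S - {i})" using that insert by auto
        then show ?thesis using insert by simp
      qed
      ultimately show ?thesis using insert by simp
    qed
    with insert show ?case by (simp add: sum_distrib_left mult_ac)
  qed simp
  show "coeff (\<Prod>i\<in>S. [:a i, b i:]) 0 = (\<Prod>i\<in>S. a i)" using * by simp
  show "coeff (\<Prod>i\<in>S. [:a i, b i:]) (Suc 0) = (\<Sum>i\<in>S. b i * (\<Prod>j\<in>S - {i}. a j))" using * by simp
qed

lemma index_monomial_support:
  assumes "finite I"
  shows "index_monomial I z \<beta> = (\<Prod>i\<in>supp I \<beta>. z i (\<beta> i))"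
proof -
  have "(\<Prod>i\<in>supp I \<beta>. z i (\<beta> i)) = (\<Prod>i\<in>I. if \<beta> i \<noteq> 0 then z i (\<beta> i) else 1)"
    by (rule prod.inter_filter[OF assms])
  then show ?thesis unfolding index_monomial_def by (simp add: if_distrib cong: if_cong) (intro prod.cong refl, auto)
qed

lemma char_prod_support:
  assumes "finite I"
  shows "char_prod I \<beta> x = (\<Prod>i\<in>supp I \<beta>. x i ^ \<beta> i)"
  unfolding char_prod_def by (rule prod.mono_neutral_right) (use assms in auto)

text \<open>The derivative of the homogeneous form \<open>level_part\<close> at the point with entries proportional to
\<open>x\<^sub>i\<^sup>a\<close>, in the direction of the moments of \<open>\<phi>\<close>. Both point and direction are moments of
admissible functions: the character \<open>w \<mapsto> w\<^sup>a\<close> has average \<open>x\<^sub>i\<^sup>a\<close> against the density \<open>q\<close> at \<open>x\<^sub>i\<close>,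
minus \<open>1\<close>. So the form is bounded on the segment through them, and the derivative is the linear
coefficient of a bounded polynomial of degree \<open>k\<close>.\<close>

lemma gradient_bound:
  assumes q: "q \<ge> 2" and I: "finite I" and adm: "admissible q I \<phi>"
    and l: "0 \<le> l" "0 < e" "l + e = 1" and d: "d \<ge> 1" and k: "k \<ge> 1"
    and deg: "\<And>\<alpha>. \<alpha> \<in> multi q I \<Longrightarrow> level I \<alpha> > d \<Longrightarrow> c \<alpha> = 0"
    and M: "\<And>x. x \<in> cube q I \<Longrightarrow> cmod (fourier_sum q I c x) \<le> M" and x: "x \<in> cube q I"
  shows "cmod (\<Sum>\<beta>\<in>level_set q I k. deriv_coeff q I l c \<beta> * char_prod I \<beta> x *
           (\<Sum>i\<in>supp I \<beta>. moments q \<phi> i (\<beta> i) * cnj (x i ^ \<beta> i)))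
     \<le> (6 * (real q - 1)) ^ k * (M * (exp 2 * real d / (real k * e)) ^ k)"
proof -
  let ?L = "level_set q I k" and ?D = "deriv_coeff q I l c" and ?z = "moments q \<phi>" and ?\<Omega> = "cyclic_roots q"
  have q1: "q \<ge> 1" using q by simp
  have x\<Omega>: "x i \<in> ?\<Omega>" if "i \<in> I" for i using x that by (auto simp: cube_def PiE_iff)
  have xn: "x i * cnj (x i) = 1" if "i \<in> I" for i
    using norm_cyclic_roots[OF q1 x\<Omega>[OF that]] by (simp flip: complex_norm_square)
  define Mk where "Mk = M * (exp 2 * real d / (real k * e)) ^ k"
  define \<kappa> where "\<kappa> = 1 / (real q - 1)"
  have \<kappa>: "0 < \<kappa>" "\<kappa> * (real q - 1) = 1" using q by (auto simp: \<kappa>_def)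
  define p where "p = (\<Sum>\<beta>\<in>?L. smult (?D \<beta>) (index_monomial I (\<lambda>i a. [:of_real \<kappa> * x i ^ a, ?z i a:]) \<beta>))"
  have deg_p: "degree p \<le> k"
    unfolding p_def
  proof (rule degree_sum_le)
    fix \<beta> assume b: "\<beta> \<in> ?L"
    have "degree (index_monomial I (\<lambda>i a. [:of_real \<kappa> * x i ^ a, ?z i a:]) \<beta>) \<le> (\<Sum>i\<in>supp I \<beta>. degree [:of_real \<kappa> * x i ^ \<beta> i, ?z i (\<beta> i):])"
      unfolding index_monomial_support[OF I] by (rule order_trans[OF degree_prod_sum_le]) (use I in \<open>auto simp: o_def\<close>)
    also have "\<dots> \<le> (\<Sum>i\<in>supp I \<beta>. 1)" by (intro sum_mono) auto
    also have "\<dots> = k" using b by (simp add: level_def)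
    finally show "degree (smult (?D \<beta>) (index_monomial I (\<lambda>i a. [:of_real \<kappa> * x i ^ a, ?z i a:]) \<beta>)) \<le> k"
      using degree_smult_le order_trans by blast
  qed (use I in auto)
  have bound_p: "cmod (poly p (of_real t)) \<le> 2 ^ k * Mk" if t: "-1 \<le> t" "t \<le> 1" for t
  proof -
    (* \<kappa> times the density at x i stays below 1 in absolute value, and halving keeps the sum admissible *)
    define \<psi> where "\<psi> i w = (\<kappa> * ((if w = x i then real q else 0) - 1) + t * \<phi> i w) / 2" for i w
    have adm': "admissible q I \<psi>"
      unfolding admissible_def
    proof (intro ballI conjI)
      fix i w assume iw: "i \<in> I" "w \<in> ?\<Omega>"
      have "\<bar>\<phi> i w\<bar> \<le> 1" using adm iw by (auto simp: admissible_def)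
      then have "\<bar>t * \<phi> i w\<bar> \<le> 1" using t by (simp add: abs_mult mult_le_one)
      moreover have "\<bar>\<kappa> * ((if w = x i then real q else 0) - 1)\<bar> \<le> 1"
        using \<kappa> q by (auto simp: \<kappa>_def)
      moreover have "\<bar>(u + v) / 2\<bar> \<le> 1" if "\<bar>v\<bar> \<le> 1" "\<bar>u\<bar> \<le> 1" for u v :: real using that by (simp add: abs_le_iff)
      ultimately show "\<bar>\<psi> i w\<bar> \<le> 1" unfolding \<psi>_def by blast
    next
      fix i assume i: "i \<in> I"
      have "(\<Sum>w\<in>?\<Omega>. \<psi> i w) = (\<kappa> * ((\<Sum>w\<in>?\<Omega>. if w = x i then real q else 0) - real q) + t * (\<Sum>w\<in>?\<Omega>. \<phi> i w)) / 2"
        unfolding \<psi>_def sum_divide_distrib[symmetric] sum.distrib sum_distrib_left[symmetric] sum_subtractf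
        using card_cyclic_roots[OF q1] by simp
      then show "(\<Sum>w\<in>?\<Omega>. \<psi> i w) = 0" using adm i x\<Omega>[OF i] by (simp add: admissible_def)
    qed
    have mom: "2 * moments q \<psi> i a = of_real \<kappa> * x i ^ a + of_real t * ?z i a" if "i \<in> I" "0 < a" "a < q" for i a
    proof -
      have "(\<Sum>w\<in>?\<Omega>. of_real (\<psi> i w) * w ^ a) = (\<Sum>w\<in>?\<Omega>. (of_real \<kappa> / 2) * (if w = x i then of_nat q * w ^ a else 0) - (of_real \<kappa> / 2) * w ^ a + (of_real t / 2) * (of_real (\<phi> i w) * w ^ a))"
        by (intro sum.cong refl) (auto simp: \<psi>_def algebra_simps add_divide_distrib diff_divide_distrib)
      also have "\<dots> = (of_real \<kappa> / 2) * (of_nat q * x i ^ a) - (of_real \<kappa> / 2) * (\<Sum>w\<in>?\<Omega>. w ^ a) + (of_real t / 2) * (\<Sum>w\<in>?\<Omega>. of_real (\<phi> i w) * w ^ a)"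
        using x\<Omega>[OF that(1)] by (simp only: sum.distrib sum_subtractf sum_distrib_left[symmetric] sum.delta finite_cyclic_roots if_True)
      finally show ?thesis using that q by (simp add: moment_def sum_char_zero[OF q1] field_simps)
    qed
    have "poly p (of_real t) = (\<Sum>\<beta>\<in>?L. ?D \<beta> * (2 ^ k * index_monomial I (moments q \<psi>) \<beta>))"
      unfolding p_def poly_sum poly_smult
    proof (intro sum.cong refl arg_cong2[where f = "(*)"])
      fix \<beta> assume b: "\<beta> \<in> ?L"
      have "poly (index_monomial I (\<lambda>i a. [:of_real \<kappa> * x i ^ a, ?z i a:]) \<beta>) (of_real t) = index_monomial I (\<lambda>i a. 2 * moments q \<psi> i a) \<beta>"
        unfolding index_monomial_support[OF I] poly_prod
      proof (rule prod.cong[OF refl])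
        fix i assume "i \<in> supp I \<beta>"
        then have "i \<in> I" "0 < \<beta> i" "\<beta> i < q" using b by (auto simp: multi_def PiE_iff)
        from mom[OF this] show "poly [:of_real \<kappa> * x i ^ \<beta> i, ?z i (\<beta> i):] (of_real t) = 2 * moments q \<psi> i (\<beta> i)" by simp
      qed
      also have "\<dots> = 2 ^ k * index_monomial I (moments q \<psi>) \<beta>" using b by (subst index_monomial_scale[OF I]) simp
      finally show "poly (index_monomial I (\<lambda>i a. [:of_real \<kappa> * x i ^ a, ?z i a:]) \<beta>) (of_real t) = 2 ^ k * index_monomial I (moments q \<psi>) \<beta>" .
    qed
    also have "\<dots> = 2 ^ k * level_part q I l c k (moments q \<psi>)"
      by (simp add: level_part_def sum_distrib_left mult_ac)
    finally have "cmod (poly p (of_real t)) = 2 ^ k * cmod (level_part q I l c k (moments q \<psi>))" by (simp add: norm_mult norm_power)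
    also have "\<dots> \<le> 2 ^ k * Mk"
      unfolding Mk_def by (intro mult_left_mono level_part_bound[OF q1 I adm' l d k deg M]) auto
    finally show ?thesis .
  qed
  define G where "G = (\<Sum>\<beta>\<in>?L. ?D \<beta> * char_prod I \<beta> x * (\<Sum>i\<in>supp I \<beta>. ?z i (\<beta> i) * cnj (x i ^ \<beta> i)))"
  have "coeff p 1 = of_real (\<kappa> ^ (k - 1)) * G"
    unfolding p_def coeff_sum G_def sum_distrib_left[of "of_real (\<kappa> ^ (k - 1))"]
  proof (rule sum.cong[OF refl])
    fix \<beta> assume b: "\<beta> \<in> ?L"
    let ?S = "supp I \<beta>"
    have S: "finite ?S" "card ?S = k" using I b by (auto simp: level_def)
    have "coeff (index_monomial I (\<lambda>i a. [:of_real \<kappa> * x i ^ a, ?z i a:]) \<beta>) 1 = (\<Sum>i\<in>?S. ?z i (\<beta> i) * (\<Prod>j\<in>?S - {i}. of_real \<kappa> * x j ^ \<beta> j))"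
      unfolding index_monomial_support[OF I] using coeff_prod_linear(2)[OF S(1)] by simp
    also have "\<dots> = (\<Sum>i\<in>?S. of_real (\<kappa> ^ (k - 1)) * (char_prod I \<beta> x * (?z i (\<beta> i) * cnj (x i ^ \<beta> i))))"
    proof (rule sum.cong[OF refl])
      fix i assume i: "i \<in> ?S"
      have "(\<Prod>j\<in>?S - {i}. of_real \<kappa> * x j ^ \<beta> j) = of_real (\<kappa> ^ (k - 1)) * (\<Prod>j\<in>?S - {i}. x j ^ \<beta> j)"
        using S i by (simp add: prod.distrib)
      moreover have "char_prod I \<beta> x = x i ^ \<beta> i * (\<Prod>j\<in>?S - {i}. x j ^ \<beta> j)"
        unfolding char_prod_support[OF I] using S(1) i by (rule prod.remove)
      moreover have "x i ^ \<beta> i * cnj (x i ^ \<beta> i) = 1" using xn[of i] i by (simp flip: power_mult_distrib)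
      ultimately show "?z i (\<beta> i) * (\<Prod>j\<in>?S - {i}. of_real \<kappa> * x j ^ \<beta> j) = of_real (\<kappa> ^ (k - 1)) * (char_prod I \<beta> x * (?z i (\<beta> i) * cnj (x i ^ \<beta> i)))"
        by (simp add: mult_ac)
    qed
    finally show "coeff (smult (?D \<beta>) (index_monomial I (\<lambda>i a. [:of_real \<kappa> * x i ^ a, ?z i a:]) \<beta>)) 1 = of_real (\<kappa> ^ (k - 1)) * (?D \<beta> * char_prod I \<beta> x * (\<Sum>i\<in>?S. ?z i (\<beta> i) * cnj (x i ^ \<beta> i)))"
      by (simp add: sum_distrib_left mult_ac)
  qed
  then have "\<kappa> ^ (k - 1) * cmod G = cmod (coeff p 1)" using \<kappa> by (simp add: norm_mult norm_power)
  also have "\<dots> \<le> 2 ^ k * Mk * (1 + 2 * 1) ^ k / 1 ^ 1"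
    by (rule poly_coeff_bound[OF deg_p bound_p]) auto
  finally have "\<kappa> ^ (k - 1) * cmod G \<le> 6 ^ k * Mk" by (simp add: mult_ac flip: power_mult_distrib)
  then have "(real q - 1) ^ (k - 1) * (\<kappa> ^ (k - 1) * cmod G) \<le> (real q - 1) ^ (k - 1) * (6 ^ k * Mk)"
    using q by (intro mult_left_mono) auto
  also have "(real q - 1) ^ (k - 1) * (\<kappa> ^ (k - 1) * cmod G) = cmod G"
    using \<kappa>(2) by (simp add: mult.commute[of \<kappa>] flip: mult.assoc power_mult_distrib)
  also have "(real q - 1) ^ (k - 1) * (6 ^ k * Mk) \<le> (real q - 1) ^ k * (6 ^ k * Mk)"
  proof (rule mult_right_mono)
    show "(real q - 1) ^ (k - 1) \<le> (real q - 1) ^ k" using q by (intro power_increasing) auto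
    have "M \<ge> 0" using order_trans[OF norm_ge_zero M[OF x]] .
    then show "6 ^ k * Mk \<ge> 0" using l by (simp add: Mk_def)
  qed
  finally show ?thesis unfolding G_def Mk_def by (simp only: power_mult_distrib mult_ac)
qed

lemma complex_moments_decompose:
  "moment q \<Phi> a = moment q (\<lambda>w. of_real (Re (\<Phi> w))) a + \<i> * moment q (\<lambda>w. of_real (Im (\<Phi> w))) a"
proof -
  have "(\<Sum>w\<in>cyclic_roots q. \<Phi> w * w ^ a) = (\<Sum>w\<in>cyclic_roots q. of_real (Re (\<Phi> w)) * w ^ a) + \<i> * (\<Sum>w\<in>cyclic_roots q. of_real (Im (\<Phi> w)) * w ^ a)"
    unfolding sum_distrib_left sum.distrib[symmetric]
    by (intro sum.cong refl) (subst complex_eq[of "\<Phi> _"], simp add: algebra_simps)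
  then show ?thesis by (simp add: moment_def add_divide_distrib)
qed

lemma moment_trig:
  assumes "q \<ge> 1" "b < q"
  shows "moment q (\<lambda>w. \<Sum>a\<in>{1..<q}. Z a * cnj (w ^ a)) b = (if b = 0 then 0 else Z b)"
proof -
  have "(\<Sum>w\<in>cyclic_roots q. (\<Sum>a\<in>{1..<q}. Z a * cnj (w ^ a)) * w ^ b) = (\<Sum>a\<in>{1..<q}. Z a * (\<Sum>w\<in>cyclic_roots q. w ^ b * cnj (w ^ a)))"
    unfolding sum_distrib_right by (subst sum.swap) (simp add: sum_distrib_left mult_ac)
  also have "\<dots> = (\<Sum>a\<in>{1..<q}. if b = a then of_nat q * Z a else 0)"
    by (intro sum.cong refl) (subst characters_orthogonal, use assms in auto)
  also have "\<dots> = (if b = 0 then 0 else of_nat q * Z b)" using assms by (simp add: sum.delta')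
  finally show ?thesis using assms by (simp add: moment_def)
qed

text \<open>The gradient bound for real admissible functions carries over to complex ones with a factor \<open>2\<close>,
because it is linear in the direction. A complex direction with prescribed moments \<open>Z i a\<close> exists as
soon as \<open>\<Sum>\<^sub>a \<bar>Z i a\<bar> \<le> 1\<close>, and the phases of \<open>Z i a\<close> can be chosen to make all partial derivatives
add up.\<close>

lemma gradient_sum_bound:
  assumes q: "q \<ge> 2" and I: "finite I"
    and l: "0 \<le> l" "0 < e" "l + e = 1" and d: "d \<ge> 1" and k: "k \<ge> 1"
    and deg: "\<And>\<alpha>. \<alpha> \<in> multi q I \<Longrightarrow> level I \<alpha> > d \<Longrightarrow> c \<alpha> = 0"
    and M: "\<And>x. x \<in> cube q I \<Longrightarrow> cmod (fourier_sum q I c x) \<le> M" and x: "x \<in> cube q I"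
  shows "(\<Sum>i\<in>I. \<Sum>a\<in>{1..<q}. cmod (fourier_sum q I (\<lambda>\<beta>. if level I \<beta> = k \<and> \<beta> i = a then deriv_coeff q I l c \<beta> else 0) x))
     \<le> 2 * (real q - 1) * ((6 * (real q - 1)) ^ k * (M * (exp 2 * real d / (real k * e)) ^ k))"
proof -
  let ?D = "deriv_coeff q I l c" and ?\<Omega> = "cyclic_roots q"
  define L where "L = level_set q I k"
  have finL: "finite L" using I by (simp add: L_def)
  have q1: "q \<ge> 1" using q by simp
  have x\<Omega>: "x i \<in> ?\<Omega>" if "i \<in> I" for i using x that by (auto simp: cube_def PiE_iff)
  have xn: "cmod (x i) = 1" if "i \<in> I" for i
    using norm_cyclic_roots[OF q1 x\<Omega>[OF that]] .
  define B where "B = (6 * (real q - 1)) ^ k * (M * (exp 2 * real d / (real k * e)) ^ k)"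
  define \<kappa> where "\<kappa> = 1 / (real q - 1)"
  have \<kappa>: "0 < \<kappa>" "\<kappa> * (real q - 1) = 1" using q by (auto simp: \<kappa>_def)
  define g where "g i a = fourier_sum q I (\<lambda>\<beta>. if level I \<beta> = k \<and> \<beta> i = a then ?D \<beta> else 0) x" for i a
  define lin where "lin Z = (\<Sum>\<beta>\<in>L. ?D \<beta> * char_prod I \<beta> x * (\<Sum>i\<in>supp I \<beta>. Z i (\<beta> i) * cnj (x i ^ \<beta> i)))" for Z
  have g_eq: "g i a = (\<Sum>\<beta>\<in>L. if \<beta> i = a then ?D \<beta> * char_prod I \<beta> x else 0)" for i a
  proof -
    have "g i a = (\<Sum>\<beta>\<in>multi q I. if level I \<beta> = k then (if \<beta> i = a then ?D \<beta> * char_prod I \<beta> x else 0) else 0)"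
      unfolding g_def fourier_sum_def by (intro sum.cong refl) auto
    also have "\<dots> = (\<Sum>\<beta>\<in>L. if \<beta> i = a then ?D \<beta> * char_prod I \<beta> x else 0)"
      unfolding L_def by (rule sum.inter_filter[symmetric]) (use I in simp)
    finally show ?thesis .
  qed
  have lin_eq: "lin Z = (\<Sum>i\<in>I. \<Sum>a\<in>{1..<q}. Z i a * cnj (x i ^ a) * g i a)" for Z
  proof -
    have "(\<Sum>i\<in>I. \<Sum>a\<in>{1..<q}. Z i a * cnj (x i ^ a) * g i a)
       = (\<Sum>i\<in>I. \<Sum>\<beta>\<in>L. \<Sum>a\<in>{1..<q}. if a = \<beta> i then Z i a * cnj (x i ^ a) * (?D \<beta> * char_prod I \<beta> x) else 0)"
      unfolding g_eq sum_distrib_left by (intro sum.cong refl, subst sum.swap, intro sum.cong refl) auto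
    also have "\<dots> = (\<Sum>\<beta>\<in>L. \<Sum>i\<in>I. \<Sum>a\<in>{1..<q}. if a = \<beta> i then Z i a * cnj (x i ^ a) * (?D \<beta> * char_prod I \<beta> x) else 0)"
      by (rule sum.swap)
    also have "\<dots> = lin Z"
      unfolding lin_def
    proof (rule sum.cong[OF refl])
      fix \<beta> assume b: "\<beta> \<in> L"
      have "(\<Sum>i\<in>I. \<Sum>a\<in>{1..<q}. if a = \<beta> i then Z i a * cnj (x i ^ a) * (?D \<beta> * char_prod I \<beta> x) else 0)
         = (\<Sum>i\<in>I. if \<beta> i \<noteq> 0 then ?D \<beta> * char_prod I \<beta> x * (Z i (\<beta> i) * cnj (x i ^ \<beta> i)) else 0)"
      proof (rule sum.cong[OF refl])
        fix i assume "i \<in> I"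
        then have "\<beta> i < q" using b by (auto simp: L_def multi_def PiE_iff)
        then show "(\<Sum>a\<in>{1..<q}. if a = \<beta> i then Z i a * cnj (x i ^ a) * (?D \<beta> * char_prod I \<beta> x) else 0)
          = (if \<beta> i \<noteq> 0 then ?D \<beta> * char_prod I \<beta> x * (Z i (\<beta> i) * cnj (x i ^ \<beta> i)) else 0)"
          by (simp add: sum.delta mult_ac)
      qed
      also have "\<dots> = (\<Sum>i\<in>supp I \<beta>. ?D \<beta> * char_prod I \<beta> x * (Z i (\<beta> i) * cnj (x i ^ \<beta> i)))"
        by (rule sum.inter_filter[OF I, symmetric])
      finally show "(\<Sum>i\<in>I. \<Sum>a\<in>{1..<q}. if a = \<beta> i then Z i a * cnj (x i ^ a) * (?D \<beta> * char_prod I \<beta> x) else 0)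
         = ?D \<beta> * char_prod I \<beta> x * (\<Sum>i\<in>supp I \<beta>. Z i (\<beta> i) * cnj (x i ^ \<beta> i))"
        by (simp add: sum_distrib_left)
    qed
    finally show ?thesis ..
  qed
  have lin_bound: "cmod (lin (moments q \<phi>)) \<le> B" if "admissible q I \<phi>" for \<phi>
    unfolding lin_def L_def B_def by (rule gradient_bound[OF q I that l d k deg M x])
  (* the phases make every term of lin Z nonnegative *)
  define Z where "Z i a = of_real \<kappa> * (x i ^ a * cnj (sgn (g i a)))" for i a
  define \<Phi> where "\<Phi> i w = (\<Sum>a\<in>{1..<q}. Z i a * cnj (w ^ a))" for i w
  have \<Phi>n: "cmod (\<Phi> i w) \<le> 1" if "i \<in> I" "w \<in> ?\<Omega>" for i w
  proof -
    have "cmod (\<Phi> i w) \<le> (\<Sum>a\<in>{1..<q}. cmod (Z i a * cnj (w ^ a)))" unfolding \<Phi>_def by (rule norm_sum)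
    also have "\<dots> \<le> (\<Sum>a\<in>{1..<q}. \<kappa>)"
      using norm_cyclic_roots[OF q1 that(2)] xn[OF that(1)] \<kappa>(1)
      by (intro sum_mono) (simp add: Z_def norm_mult norm_power norm_sgn)
    also have "\<dots> = 1" using \<kappa>(2) q by (simp add: of_nat_diff mult.commute)
    finally show ?thesis .
  qed
  have \<Phi>s: "(\<Sum>w\<in>?\<Omega>. \<Phi> i w) = 0" for i
    using moment_trig[OF q1, of 0 "Z i"] q by (simp add: moment_def \<Phi>_def)
  have admRe: "admissible q I (\<lambda>i w. Re (\<Phi> i w))" and admIm: "admissible q I (\<lambda>i w. Im (\<Phi> i w))"
    using \<Phi>n \<Phi>s
    by (auto simp: admissible_def simp flip: Re_sum Im_sum
        intro: order_trans[OF abs_Re_le_cmod] order_trans[OF abs_Im_le_cmod])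
  have "lin (\<lambda>i. moment q (\<Phi> i)) = lin Z"
  proof -
    have "moment q (\<Phi> i) a = Z i a" if "a \<in> {1..<q}" for i a
      using moment_trig[OF q1, of a "Z i"] that unfolding \<Phi>_def by auto
    then show ?thesis unfolding lin_eq by simp
  qed
  moreover have "lin (\<lambda>i. moment q (\<Phi> i)) = lin (moments q (\<lambda>i w. Re (\<Phi> i w))) + \<i> * lin (moments q (\<lambda>i w. Im (\<Phi> i w)))"
    unfolding lin_eq sum_distrib_left sum.distrib[symmetric]
    by (intro sum.cong refl, subst complex_moments_decompose) (simp add: algebra_simps)
  ultimately have "lin Z = lin (moments q (\<lambda>i w. Re (\<Phi> i w))) + \<i> * lin (moments q (\<lambda>i w. Im (\<Phi> i w)))"
    by simp
  then have "cmod (lin Z) \<le> cmod (lin (moments q (\<lambda>i w. Re (\<Phi> i w)))) + cmod (\<i> * lin (moments q (\<lambda>i w. Im (\<Phi> i w))))"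
    by (simp only: norm_triangle_ineq)
  also have "\<dots> \<le> 2 * B" using lin_bound[OF admRe] lin_bound[OF admIm] by (simp add: norm_mult)
  finally have 1: "cmod (lin Z) \<le> 2 * B" .
  have "lin Z = of_real (\<kappa> * (\<Sum>i\<in>I. \<Sum>a\<in>{1..<q}. cmod (g i a)))"
    unfolding lin_eq of_real_mult of_real_sum sum_distrib_left
  proof (intro sum.cong refl)
    fix i a assume i: "i \<in> I"
    have "x i ^ a * cnj (x i ^ a) = 1" using xn[OF i] by (simp flip: complex_norm_square add: norm_power del: complex_cnj_power)
    moreover have "cnj (sgn (g i a)) * g i a = of_real (cmod (g i a))"
    proof (cases "g i a = 0")
      case False
      have "cnj (sgn (g i a)) * g i a = (g i a * cnj (g i a)) / of_real (cmod (g i a))"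
        by (simp add: sgn_eq mult.commute)
      also have "g i a * cnj (g i a) = of_real (cmod (g i a) ^ 2)" by (rule complex_norm_square[symmetric])
      finally show ?thesis using False by (simp add: power2_eq_square)
    qed simp
    moreover have "Z i a * cnj (x i ^ a) * g i a = of_real \<kappa> * ((x i ^ a * cnj (x i ^ a)) * (cnj (sgn (g i a)) * g i a))"
      by (simp only: Z_def mult_ac)
    ultimately show "Z i a * cnj (x i ^ a) * g i a = of_real \<kappa> * of_real (cmod (g i a))" by simp
  qed
  then have "cmod (lin Z) = \<kappa> * (\<Sum>i\<in>I. \<Sum>a\<in>{1..<q}. cmod (g i a))"
    using \<kappa>(1) by (simp only: norm_of_real) (simp add: sum_nonneg)
  then have "(real q - 1) * (\<kappa> * (\<Sum>i\<in>I. \<Sum>a\<in>{1..<q}. cmod (g i a))) \<le> (real q - 1) * (2 * B)"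
    using 1 q by (intro mult_left_mono) auto
  moreover have "(real q - 1) * (\<kappa> * S) = S" for S
  proof -
    have "(real q - 1) * (\<kappa> * S) = (\<kappa> * (real q - 1)) * S" by (simp only: mult_ac)
    then show ?thesis using \<kappa>(2) by simp
  qed
  ultimately have "(\<Sum>i\<in>I. \<Sum>a\<in>{1..<q}. cmod (g i a)) \<le> (real q - 1) * (2 * B)" by (simp only:)
  then show ?thesis by (simp only: g_def B_def mult_ac)
qed

section \<open>A Bohnenblust-Hille inequality for the derivatives\<close>

text \<open>The factors are the comparison of the first two moments on level \<open>k\<close>, two for the sum of the partial
derivatives, and the extraction of a coefficient, each for \<open>k = 1\<close>.\<close>

definition BH_base :: "nat \<Rightarrow> real" where
  "BH_base q = 2 powr lsi_const q * (2 * (real q - 1)) * (6 * (real q - 1)) * exp 2"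

lemma BH_base_ge_1: assumes "q \<ge> 2" shows "BH_base q \<ge> 1"
proof -
  have "2 powr lsi_const q \<ge> (1::real)" using lsi_const_ge_2[OF assms] by (intro ge_one_powr_ge_zero) auto
  then have "1 * 1 * 1 * 1 \<le> 2 powr lsi_const q * (2 * (real q - 1)) * (6 * (real q - 1)) * exp 2"
    using assms by (intro mult_mono) auto
  then show ?thesis by (simp add: BH_base_def)
qed

lemma support_enumeration:
  assumes "finite I"
  obtains S where "bij_betw S {..<level I \<beta>} (supp I \<beta>)"
  using ex_bij_betw_nat_finite[of "supp I \<beta>"] assms by (auto simp: level_def lessThan_atLeast0)

text \<open>The classical argument for multilinear forms. Choosing for every index of level \<open>k\<close> its \<open>j\<close>-th nonzero
entry gives \<open>k\<close> projections that are jointly injective, so the Blei inequality applies with blocks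
of size one. It leaves \<open>W\<close>, a sum over single entries of \<open>\<ell>\<^sub>2\<close> norms; these are averages of partial derivatives
up to \<open>C\<^sup>k\<close>, by the comparison of the first two moments, and the sum of the latter is bounded pointwise.\<close>

theorem deriv_coeff_BH:
  assumes q: "q \<ge> 2" and I: "finite I"
    and l: "0 \<le> l" "0 < e" "l + e = 1" and d: "d \<ge> 1" and k: "k \<ge> 1"
    and deg: "\<And>\<alpha>. \<alpha> \<in> multi q I \<Longrightarrow> level I \<alpha> > d \<Longrightarrow> c \<alpha> = 0"
    and M: "\<And>x. x \<in> cube q I \<Longrightarrow> cmod (fourier_sum q I c x) \<le> M"
  shows "(\<Sum>\<beta>\<in>level_set q I k. cmod (deriv_coeff q I l c \<beta>) powr BH_exponent k)
     \<le> (M * (BH_base q * real d / (real k * e)) ^ k) powr BH_exponent k"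
proof -
  define D where "D = deriv_coeff q I l c"
  define L where "L = level_set q I k"
  have finL: "finite L" using I by (simp add: L_def)
  have q1: "q \<ge> 1" using q by simp
  define C where "C = lsi_const q"
  define B where "B = (6 * (real q - 1)) ^ k * (M * (exp 2 * real d / (real k * e)) ^ k)"
  have "cube q I \<noteq> {}" using card_cube[OF q1 I] q by (metis card.empty power_not_zero not_numeral_le_zero)
  then obtain x0 where "x0 \<in> cube q I" by auto
  then have M0: "M \<ge> 0" using M norm_ge_zero order_trans by blast
  have B0: "B \<ge> 0" using M0 q l by (simp add: B_def)
  define P where "P = I \<times> {1..<q}"
  have finP: "finite P" using I by (simp add: P_def)
  define s where "s ia = sqrt (\<Sum>\<beta>\<in>{\<beta>\<in>L. \<beta> (fst ia) = snd ia}. cmod (D \<beta>) ^ 2)" for ia :: "'a \<times> nat"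
  define W where "W = (\<Sum>ia\<in>P. s ia)"
  have s0: "s ia \<ge> 0" for ia by (simp add: s_def sum_nonneg)
  have W0: "W \<ge> 0" unfolding W_def by (intro sum_nonneg s0)
  have s_bound: "s (i, a) \<le> 2 powr (C * real k) * ((\<Sum>x\<in>cube q I. cmod (fourier_sum q I (\<lambda>\<beta>. if level I \<beta> = k \<and> \<beta> i = a then D \<beta> else 0) x)) / real q ^ card I)" for i a
  proof -
    have "s (i, a) = sqrt (\<Sum>\<beta>\<in>multi q I. cmod (if level I \<beta> = k \<and> \<beta> i = a then D \<beta> else 0) ^ 2)"
      unfolding s_def L_def using I
      by (intro arg_cong[where f = sqrt] sum.mono_neutral_cong_left) auto
    also have "\<dots> \<le> 2 powr (C * real k) * ((\<Sum>x\<in>cube q I. cmod (fourier_sum q I (\<lambda>\<beta>. if level I \<beta> = k \<and> \<beta> i = a then D \<beta> else 0) x)) / real q ^ card I)"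
      unfolding C_def by (rule L2_le_L1_homogeneous[OF q I]) auto
    finally show ?thesis .
  qed
  have "W \<le> (\<Sum>i\<in>I. \<Sum>a\<in>{1..<q}. 2 powr (C * real k) * ((\<Sum>x\<in>cube q I. cmod (fourier_sum q I (\<lambda>\<beta>. if level I \<beta> = k \<and> \<beta> i = a then D \<beta> else 0) x)) / real q ^ card I))"
    unfolding W_def P_def sum.cartesian_product[symmetric, of "\<lambda>i a. s (i, a)", simplified]
    by (intro sum_mono s_bound)
  also have "\<dots> = 2 powr (C * real k) * ((\<Sum>x\<in>cube q I. \<Sum>i\<in>I. \<Sum>a\<in>{1..<q}. cmod (fourier_sum q I (\<lambda>\<beta>. if level I \<beta> = k \<and> \<beta> i = a then D \<beta> else 0) x)) / real q ^ card I)"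
    unfolding sum_distrib_left[symmetric] sum_divide_distrib[symmetric]
    by (subst sum.swap, subst sum.swap) (simp add: sum.swap[of _ "cube q I"])
  also have "\<dots> \<le> 2 powr (C * real k) * ((\<Sum>x\<in>cube q I. 2 * (real q - 1) * B) / real q ^ card I)"
    unfolding B_def D_def
    by (intro mult_left_mono divide_right_mono sum_mono gradient_sum_bound[OF q I l d k deg M]) auto
  also have "\<dots> = 2 powr (C * real k) * (2 * (real q - 1) * B)"
    using card_cube[OF q1 I] q by simp
  also have "\<dots> \<le> 2 powr (C * real k) * ((2 * (real q - 1)) ^ k * B)"
    using q k B0 by (intro mult_left_mono mult_right_mono) (auto intro: self_le_power)
  also have "\<dots> = M * (BH_base q * real d / (real k * e)) ^ k"
  proof -
    have "2 powr (C * real k) = (2 powr C) ^ k" by (simp add: powr_powr[symmetric] powr_realpow)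
    then show ?thesis by (simp add: B_def BH_base_def C_def power_mult_distrib power_divide mult_ac)
  qed
  finally have W_bound: "W \<le> M * (BH_base q * real d / (real k * e)) ^ k" .
  have "\<forall>\<beta>. \<exists>S. bij_betw S {..<level I \<beta>} (supp I \<beta>)" using support_enumeration[OF I] by metis
  then obtain S where S: "\<And>\<beta>. bij_betw (S \<beta>) {..<level I \<beta>} (supp I \<beta>)" by metis
  define \<pi> where "\<pi> j \<beta> = (S \<beta> j, \<beta> (S \<beta> j))" for j \<beta>
  have SI: "S \<beta> j \<in> I \<and> \<beta> (S \<beta> j) \<noteq> 0" if "\<beta> \<in> L" "j < k" for \<beta> j
    using bij_betwE[OF S[of \<beta>]] that by (auto simp: L_def)
  have "(\<Sum>\<beta>\<in>L. cmod (D \<beta>) powr BH_exponent k) \<le>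
    (\<Prod>j\<in>{..<k}. (\<Sum>y\<in>\<pi> j ` L. (sqrt (\<Sum>\<beta>\<in>{\<beta>\<in>L. \<pi> j \<beta> = y}. cmod (D \<beta>) ^ 2)) powr BH_exponent 1)
       powr ((real 1 + 1) / (real k + 1)))"
  proof (rule Blei_projections)
    fix \<beta> \<beta>' assume b: "\<beta> \<in> L" "\<beta>' \<in> L" and e: "\<And>j. j \<in> {..<k} \<Longrightarrow> \<pi> j \<beta> = \<pi> j \<beta>'"
    have lk: "level I \<beta> = k" "level I \<beta>' = k" using b by (auto simp: L_def)
    have supp: "supp I \<gamma> = S \<gamma> ` {..<k}" if "level I \<gamma> = k" for \<gamma>
      using S[of \<gamma>] that by (auto simp: bij_betw_def)
    have SS: "S \<beta> j = S \<beta>' j" "\<beta> (S \<beta> j) = \<beta>' (S \<beta> j)" if "j < k" for j using e[of j] that by (auto simp: \<pi>_def)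
    have supp_eq: "supp I \<beta> = {i\<in>I. \<beta>' i \<noteq> 0}"
      unfolding supp[OF lk(1)] supp[OF lk(2)] using SS by auto
    show "\<beta> = \<beta>'"
    proof (rule PiE_ext)
      show "\<beta> \<in> PiE I (\<lambda>_. {..<q})" "\<beta>' \<in> PiE I (\<lambda>_. {..<q})" using b by (auto simp: L_def multi_def)
      fix i assume i: "i \<in> I"
      show "\<beta> i = \<beta>' i"
      proof (cases "\<beta> i = 0")
        case True then show ?thesis using supp_eq i by (force simp: set_eq_iff)
      next
        case False
        then have "i \<in> S \<beta> ` {..<k}" using supp[OF lk(1)] i by auto
        then show ?thesis using SS by auto
      qed
    qed
  qed (use k finL in \<open>auto simp: lessThan_empty_iff\<close>)
  also have "\<dots> \<le> (\<Prod>j\<in>{..<k}. W powr (2 / (real k + 1)))"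
  proof (intro prod_mono conjI)
    fix j assume "j \<in> {..<k}"
    then have j: "j < k" by simp
    have "(\<Sum>y\<in>\<pi> j ` L. (sqrt (\<Sum>\<beta>\<in>{\<beta>\<in>L. \<pi> j \<beta> = y}. cmod (D \<beta>) ^ 2)) powr BH_exponent 1)
       = (\<Sum>y\<in>\<pi> j ` L. sqrt (\<Sum>\<beta>\<in>{\<beta>\<in>L. \<pi> j \<beta> = y}. cmod (D \<beta>) ^ 2))"
      by (simp add: BH_exponent_def sum_nonneg)
    also have "\<dots> \<le> (\<Sum>y\<in>\<pi> j ` L. s y)"
      unfolding s_def using finL
      by (intro sum_mono real_sqrt_le_mono sum_mono2) (auto simp: \<pi>_def)
    also have "\<dots> \<le> W"
      unfolding W_def
    proof (rule sum_mono2[OF finP])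
      show "\<pi> j ` L \<subseteq> P"
      proof
        fix y assume "y \<in> \<pi> j ` L"
        then obtain \<beta> where b: "\<beta> \<in> L" "y = \<pi> j \<beta>" by auto
        have "S \<beta> j \<in> I" "\<beta> (S \<beta> j) \<noteq> 0" using SI[OF b(1) j] by auto
        moreover have "\<beta> (S \<beta> j) < q" using b(1) \<open>S \<beta> j \<in> I\<close> by (auto simp: L_def multi_def PiE_iff)
        ultimately show "y \<in> P" by (auto simp: P_def b(2) \<pi>_def)
      qed
    qed (rule s0)
    finally show "(\<Sum>y\<in>\<pi> j ` L. (sqrt (\<Sum>\<beta>\<in>{\<beta>\<in>L. \<pi> j \<beta> = y}. cmod (D \<beta>) ^ 2)) powr BH_exponent 1) powr ((real 1 + 1) / (real k + 1))
       \<le> W powr (2 / (real k + 1))"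
      by (simp add: powr_mono2 sum_nonneg)
  qed auto
  also have "\<dots> = W powr BH_exponent k"
    using k W0 by (cases "W = 0") (auto simp: BH_exponent_def powr_powr mult.commute simp flip: powr_realpow)
  also have "\<dots> \<le> (M * (BH_base q * real d / (real k * e)) ^ k) powr BH_exponent k"
    using W0 W_bound by (intro powr_mono2) (auto simp: BH_exponent_def)
  finally show ?thesis by (simp add: D_def L_def)
qed

section \<open>Coefficients of a fixed level\<close>

lemma cube_mult:
  assumes "q \<ge> 1" "x \<in> cube q I" "y \<in> cube q I"
  shows "(\<lambda>i\<in>I. x i * y i) \<in> cube q I"
  using assms by (auto simp: cube_def PiE_iff cyclic_roots_eq power_mult_distrib)

lemma fourier_sum_translate:
  "fourier_sum q I (\<lambda>\<alpha>. c \<alpha> * char_prod I \<alpha> x) y = fourier_sum q I c (\<lambda>i\<in>I. x i * y i)"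
proof -
  have "char_prod I \<alpha> (\<lambda>i\<in>I. x i * y i) = char_prod I \<alpha> x * char_prod I \<alpha> y" for \<alpha>
    by (simp add: char_prod_def power_mult_distrib prod.distrib)
  then show ?thesis by (simp add: fourier_sum_def mult_ac)
qed

lemma BH_exponent_bounds: "k \<ge> 1 \<Longrightarrow> 1 \<le> BH_exponent k" "BH_exponent k \<le> 2" "k \<ge> 1 \<Longrightarrow> 2 / BH_exponent k - 1 = 1 / real k"
  by (auto simp: BH_exponent_def field_simps)

text \<open>For fixed \<open>\<beta>\<close> the derivative at the point \<open>x\<close> is itself a Fourier sum in \<open>x\<close>, with coefficients
\<open>c \<alpha>\<close> times a power of \<open>l\<close>. Hypercontractivity bounds its \<open>\<ell>\<^sub>2\<close> norm on level \<open>m\<close> by a moment of order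
\<open>2 k / (k + 1)\<close>, and these moments can be summed over \<open>\<beta>\<close> inside the average over \<open>x\<close>.\<close>

lemma mixed_norm_bound:
  assumes q: "q \<ge> 2" and I: "finite I"
    and l: "0 < l" "0 < e" "l + e = 1" and d: "d \<ge> 1" and k: "k \<ge> 1"
    and r: "0 < r" "r \<le> 1" "1 - r \<ge> lsi_const q / real k"
    and deg: "\<And>\<alpha>. \<alpha> \<in> multi q I \<Longrightarrow> level I \<alpha> > d \<Longrightarrow> c \<alpha> = 0"
    and M: "\<And>x. x \<in> cube q I \<Longrightarrow> cmod (fourier_sum q I c x) \<le> M"
  shows "(\<Sum>\<beta>\<in>level_set q I k.
           sqrt (\<Sum>\<alpha>\<in>{\<alpha>\<in>multi q I. level I \<alpha> = m \<and> sub_index I \<beta> \<alpha>}. cmod (c \<alpha>) ^ 2) powr BH_exponent k)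
     \<le> (M * (1 / (sqrt r * l)) ^ m * (BH_base q * real d / (real k * e)) ^ k) powr BH_exponent k"
proof -
  define p where "p = BH_exponent k"
  have p: "1 \<le> p" "p \<le> 2" "2 / p - 1 = 1 / real k" using BH_exponent_bounds[of k] k by (auto simp: p_def)
  have q1: "q \<ge> 1" using q by simp
  define Lk where "Lk = level_set q I k"
  define w where "w \<beta> = sqrt (\<Sum>\<alpha>\<in>{\<alpha>\<in>multi q I. level I \<alpha> = m \<and> sub_index I \<beta> \<alpha>}. cmod (c \<alpha>) ^ 2)" for \<beta>
  define B where "B = M * (BH_base q * real d / (real k * e)) ^ k"
  define cx where "cx x \<alpha> = c \<alpha> * char_prod I \<alpha> x" for x \<alpha>
  define Q where "Q = real q ^ card I"
  have Q: "Q > 0" using q by (simp add: Q_def)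
  define g where "g = sqrt r * l"
  have g: "0 < g" using r l by (simp add: g_def)
  have w0: "w \<beta> \<ge> 0" for \<beta> by (simp add: w_def sum_nonneg)
  have one: "(g ^ m * w \<beta>) powr p \<le> (\<Sum>x\<in>cube q I. cmod (deriv_coeff q I l (cx x) \<beta>) powr p) / Q" if \<beta>: "\<beta> \<in> Lk" for \<beta>
  proof -
    define b where "b \<alpha> = (if sub_index I \<beta> \<alpha> then c \<alpha> * of_real (l ^ (level I \<alpha> - level I \<beta>)) else 0)" for \<alpha>
    have fs: "deriv_coeff q I l (cx x) \<beta> = fourier_sum q I b x" for x
    proof -
      have "fourier_sum q I b x = (\<Sum>\<alpha>\<in>multi q I. if sub_index I \<beta> \<alpha> then cx x \<alpha> * of_real (l ^ (level I \<alpha> - level I \<beta>)) else 0)"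
        unfolding fourier_sum_def b_def cx_def by (intro sum.cong refl) auto
      also have "\<dots> = deriv_coeff q I l (cx x) \<beta>"
        unfolding deriv_coeff_def by (rule sum.inter_filter[symmetric]) (use I in simp)
      finally show ?thesis ..
    qed
    have "(g ^ m * w \<beta>) ^ 2 = (\<Sum>\<alpha>\<in>{\<alpha>\<in>multi q I. level I \<alpha> = m \<and> sub_index I \<beta> \<alpha>}. r ^ m * (l ^ m) ^ 2 * cmod (c \<alpha>) ^ 2)"
    proof -
      have "(g ^ m) ^ 2 = r ^ m * (l ^ m) ^ 2"
      proof -
        have sw: "(z ^ m) ^ 2 = (z ^ 2) ^ m" for z :: real by (metis power_mult mult.commute)
        have "g ^ 2 = r * l ^ 2" using r by (simp add: g_def power_mult_distrib)
        then show ?thesis by (simp add: sw power_mult_distrib)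
      qed
      then show ?thesis by (simp add: power_mult_distrib w_def sum_nonneg sum_distrib_left)
    qed
    also have "\<dots> \<le> (\<Sum>\<alpha>\<in>{\<alpha>\<in>multi q I. level I \<alpha> = m \<and> sub_index I \<beta> \<alpha>}. r ^ level I \<alpha> * cmod (b \<alpha>) ^ 2)"
    proof (rule sum_mono)
      fix \<alpha> assume a: "\<alpha> \<in> {\<alpha>\<in>multi q I. level I \<alpha> = m \<and> sub_index I \<beta> \<alpha>}"
      have "l ^ m \<le> l ^ (m - level I \<beta>)" using l by (intro power_decreasing) auto
      then have "(l ^ m) ^ 2 \<le> (l ^ (m - level I \<beta>)) ^ 2" using l by (intro power_mono) auto
      then have "r ^ m * ((l ^ m) ^ 2 * cmod (c \<alpha>) ^ 2) \<le> r ^ m * ((l ^ (m - level I \<beta>)) ^ 2 * cmod (c \<alpha>) ^ 2)"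
        using r by (intro mult_left_mono mult_right_mono) auto
      then show "r ^ m * (l ^ m) ^ 2 * cmod (c \<alpha>) ^ 2 \<le> r ^ level I \<alpha> * cmod (b \<alpha>) ^ 2"
        using a l by (simp add: b_def norm_mult norm_power power_mult_distrib mult_ac)
    qed
    also have "\<dots> \<le> (\<Sum>\<alpha>\<in>multi q I. r ^ level I \<alpha> * cmod (b \<alpha>) ^ 2)"
      using I r by (intro sum_mono2) auto
    also have "\<dots> \<le> ((\<Sum>x\<in>cube q I. cmod (fourier_sum q I b x) powr p) / Q) powr (2 / p)"
      unfolding Q_def
      by (rule hypercontractivity) (use q p I r in auto)
    finally have "((g ^ m * w \<beta>) ^ 2) powr (p / 2) \<le> (((\<Sum>x\<in>cube q I. cmod (fourier_sum q I b x) powr p) / Q) powr (2 / p)) powr (p / 2)"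
      using p by (intro powr_mono2) auto
    moreover have "((g ^ m * w \<beta>) ^ 2) powr (p / 2) = (g ^ m * w \<beta>) powr p"
      using powr_powr[of "g ^ m * w \<beta>" 2 "p / 2"] g w0[of \<beta>] by simp
    moreover have "(((\<Sum>x\<in>cube q I. cmod (fourier_sum q I b x) powr p) / Q) powr (2 / p)) powr (p / 2) = (\<Sum>x\<in>cube q I. cmod (fourier_sum q I b x) powr p) / Q"
      using p Q by (simp add: powr_powr sum_nonneg)
    ultimately show ?thesis by (simp add: fs)
  qed
  have "(\<Sum>\<beta>\<in>Lk. (g ^ m * w \<beta>) powr p) \<le> (\<Sum>\<beta>\<in>Lk. (\<Sum>x\<in>cube q I. cmod (deriv_coeff q I l (cx x) \<beta>) powr p) / Q)"
    by (intro sum_mono one)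
  also have "\<dots> = (\<Sum>x\<in>cube q I. \<Sum>\<beta>\<in>Lk. cmod (deriv_coeff q I l (cx x) \<beta>) powr p) / Q"
    by (subst sum.swap) (simp add: sum_divide_distrib)
  also have "\<dots> \<le> (\<Sum>x\<in>cube q I. B powr p) / Q"
  proof (intro divide_right_mono sum_mono)
    fix x assume x: "x \<in> cube q I"
    show "(\<Sum>\<beta>\<in>Lk. cmod (deriv_coeff q I l (cx x) \<beta>) powr p) \<le> B powr p"
      unfolding Lk_def B_def p_def
    proof (rule deriv_coeff_BH[OF q I less_imp_le[OF l(1)] l(2,3) d k])
      show "cx x \<alpha> = 0" if "\<alpha> \<in> multi q I" "d < level I \<alpha>" for \<alpha> using deg[OF that] by (simp add: cx_def)
      show "cmod (fourier_sum q I (cx x) y) \<le> M" if "y \<in> cube q I" for y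
        unfolding cx_def fourier_sum_translate by (rule M[OF cube_mult[OF q1 x that]])
    qed
  qed (use Q in auto)
  also have "\<dots> = B powr p" using card_cube[OF q1 I] Q by (simp add: Q_def)
  finally have 1: "(\<Sum>\<beta>\<in>Lk. (g ^ m * w \<beta>) powr p) \<le> B powr p" .
  have "(\<Sum>\<beta>\<in>Lk. w \<beta> powr p) = ((1 / g) ^ m) powr p * (\<Sum>\<beta>\<in>Lk. (g ^ m * w \<beta>) powr p)"
    unfolding sum_distrib_left
  proof (rule sum.cong[OF refl])
    fix \<beta>
    have "w \<beta> = (1 / g) ^ m * (g ^ m * w \<beta>)" using g by (simp add: power_divide)
    then show "w \<beta> powr p = ((1 / g) ^ m) powr p * (g ^ m * w \<beta>) powr p" by (metis powr_mult)
  qed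
  also have "\<dots> \<le> ((1 / g) ^ m) powr p * B powr p" using 1 by (intro mult_left_mono) auto
  also have "\<dots> = (M * (1 / g) ^ m * (BH_base q * real d / (real k * e)) ^ k) powr p"
    by (simp add: powr_mult[symmetric] B_def mult_ac)
  finally show ?thesis by (simp add: Lk_def w_def p_def g_def)
qed

text \<open>All blocks have size \<open>\<kappa>\<close> except the last one, which absorbs the remainder and has size less than \<open>2 \<kappa>\<close>. A
shorter last block would not do, since hypercontractivity needs blocks of a minimal size.\<close>

lemma block_sizes:
  fixes \<kappa> m :: nat
  assumes "1 \<le> \<kappa>" "\<kappa> \<le> m"
  obtains n :: nat and k :: "nat \<Rightarrow> nat" where "n \<ge> 1" "\<And>j. \<kappa> \<le> k j" "(\<Sum>j<n. k j) = m"
    "(\<Sum>j<n. k j ^ 2) \<le> \<kappa> * m + 2 * \<kappa>^2" "\<And>j. j < n \<Longrightarrow> j * \<kappa> + k j \<le> m"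
    "\<And>t. t < m \<Longrightarrow> \<exists>j<n. j * \<kappa> \<le> t \<and> t < j * \<kappa> + k j"
proof -
  define n where "n = m div \<kappa>"
  define k where "k j = (if j = n - 1 then m - (n - 1) * \<kappa> else \<kappa>)" for j
  have n1: "n \<ge> 1" unfolding n_def using div_le_mono[OF assms(2), of \<kappa>] assms(1) by simp
  then obtain n' where n': "n = Suc n'" by (cases n) auto
  define s where "s = m - n' * \<kappa>"
  have nm: "n * \<kappa> \<le> m" by (simp add: n_def)
  have mlt: "m < n * \<kappa> + \<kappa>" using div_mult_mod_eq[of m \<kappa>] mod_less_divisor[of \<kappa> m] assms(1) unfolding n_def by linarith
  have ms: "m = n' * \<kappa> + s" "\<kappa> \<le> s" "s < 2 * \<kappa>" using nm mlt unfolding s_def n' by auto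
  have k: "k j = (if j = n' then s else \<kappa>)" for j unfolding k_def s_def n' by simp
  have k\<kappa>: "\<kappa> \<le> k j" for j using ms by (simp add: k)
  have sumk: "(\<Sum>j<n. f (k j)) = n' * f \<kappa> + f s" for f :: "nat \<Rightarrow> nat" unfolding n' k by simp
  have ksum: "(\<Sum>j<n. k j) = m" using sumk[of "\<lambda>x. x"] ms by simp
  have "s * s \<le> \<kappa> * s + 2 * \<kappa> ^ 2"
  proof -
    have "s * (s - \<kappa>) \<le> (2 * \<kappa>) * \<kappa>" using ms by (intro mult_mono) auto
    moreover have "s * s = s * (s - \<kappa>) + s * \<kappa>" using ms by (simp flip: distrib_left)
    ultimately show ?thesis by (simp add: power2_eq_square mult_ac)
  qed
  moreover have "(\<Sum>j<n. k j ^ 2) = n' * \<kappa>^2 + s * s" using sumk[of "\<lambda>x. x ^ 2"] by (simp add: power2_eq_square)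
  moreover have "\<kappa> * m = n' * \<kappa>^2 + \<kappa> * s" unfolding ms(1) by (simp add: algebra_simps power2_eq_square)
  ultimately have ksq: "(\<Sum>j<n. k j ^ 2) \<le> \<kappa> * m + 2 * \<kappa>^2" by linarith
  have kend: "j * \<kappa> + k j \<le> m" if "j < n" for j
  proof (cases "j = n'")
    case True then show ?thesis using ms by (simp add: k)
  next
    case False
    then have "Suc j \<le> n'" using that n' by simp
    then have "Suc j * \<kappa> \<le> n' * \<kappa>" by (rule mult_le_mono1)
    then show ?thesis using False ms by (simp add: k)
  qed
  have kcov: "\<exists>j<n. j * \<kappa> \<le> t \<and> t < j * \<kappa> + k j" if "t < m" for t
  proof (cases "t \<ge> n' * \<kappa>")
    case True then show ?thesis using that ms by (intro exI[of _ n']) (auto simp: k n')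
  next
    case False
    then have "t div \<kappa> < n'" using assms(1) by (simp add: div_less_iff_less_mult)
    moreover have "t div \<kappa> * \<kappa> \<le> t" by simp
    moreover have "t < t div \<kappa> * \<kappa> + \<kappa>" using div_mult_mod_eq[of t \<kappa>] mod_less_divisor[of \<kappa> t] assms(1) by linarith
    ultimately show ?thesis by (intro exI[of _ "t div \<kappa>"]) (auto simp: k n')
  qed
  show ?thesis by (rule that[OF n1 k\<kappa> ksum ksq kend kcov])
qed

text \<open>The support of every index is enumerated and cut into consecutive blocks; the restrictions of the index to
the blocks determine it. A block of size \<open>k\<^sub>j\<close> enters with weight \<open>k\<^sub>j / m\<close>, so the factor
\<open>Z\<close> to the power \<open>k\<^sub>j\<close> appears with total exponent \<open>(\<Sum>\<^sub>j k\<^sub>j\<^sup>2) / m\<close>.\<close>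

theorem level_coefficients_bound:
  assumes q: "q \<ge> 2" and I: "finite I"
    and l: "0 < l" "0 < e" "l + e = 1" and d: "d \<ge> 1" and k: "1 \<le> \<kappa>" "\<kappa> \<le> m"
    and r: "0 < r" "r \<le> 1" "1 - r \<ge> lsi_const q / real \<kappa>"
    and deg: "\<And>\<alpha>. \<alpha> \<in> multi q I \<Longrightarrow> level I \<alpha> > d \<Longrightarrow> c \<alpha> = 0"
    and M: "\<And>x. x \<in> cube q I \<Longrightarrow> cmod (fourier_sum q I c x) \<le> M"
    and Z: "BH_base q * real d / (real \<kappa> * e) \<le> Z" "1 \<le> Z"
  shows "(\<Sum>\<alpha>\<in>level_set q I m. cmod (c \<alpha>) powr BH_exponent m)
     \<le> (M * (1 / (sqrt r * l)) ^ m * Z powr (real \<kappa> + 2 * real \<kappa> ^ 2 / real m)) powr BH_exponent m"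
proof -
  obtain n and k :: "nat \<Rightarrow> nat" where bs: "n \<ge> 1" "\<And>j. \<kappa> \<le> k j" "(\<Sum>j<n. k j) = m"
    "(\<Sum>j<n. k j ^ 2) \<le> \<kappa> * m + 2 * \<kappa>^2" "\<And>j. j < n \<Longrightarrow> j * \<kappa> + k j \<le> m"
    "\<And>t. t < m \<Longrightarrow> \<exists>j<n. j * \<kappa> \<le> t \<and> t < j * \<kappa> + k j"
    using block_sizes[OF k] by blast
  have q1: "q \<ge> 1" using q by simp
  have m1: "m \<ge> 1" using k by simp
  define L where "L = level_set q I m"
  have finL: "finite L" using I by (simp add: L_def)
  have "cube q I \<noteq> {}" using card_cube[OF q1 I] q by (metis card.empty power_not_zero not_numeral_le_zero)
  then obtain x0 where "x0 \<in> cube q I" by auto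
  then have M0: "M \<ge> 0" using M norm_ge_zero order_trans by blast
  define A where "A = M * (1 / (sqrt r * l)) ^ m"
  have A0: "A \<ge> 0" using M0 r l by (simp add: A_def)
  have "\<forall>\<beta>. \<exists>S. bij_betw S {..<level I \<beta>} (supp I \<beta>)" using support_enumeration[OF I] by metis
  then obtain S where S: "\<And>\<beta>. bij_betw (S \<beta>) {..<level I \<beta>} (supp I \<beta>)" by metis
  define bl where "bl j \<alpha> = S \<alpha> ` {j * \<kappa>..<j * \<kappa> + k j}" for j \<alpha>
  define \<pi> where "\<pi> j \<alpha> = (\<lambda>i\<in>I. if i \<in> bl j \<alpha> then \<alpha> i else 0)" for j and \<alpha> :: "'a \<Rightarrow> nat"
  have bl_sub: "bl j \<alpha> \<subseteq> (supp I \<alpha>)" and bl_card: "card (bl j \<alpha>) = k j" if "\<alpha> \<in> L" "j < n" for j \<alpha>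
  proof -
    have sub: "{j * \<kappa>..<j * \<kappa> + k j} \<subseteq> {..<level I \<alpha>}" using bs(5)[OF that(2)] that(1) by (auto simp: L_def)
    show "bl j \<alpha> \<subseteq> (supp I \<alpha>)" unfolding bl_def using sub S[of \<alpha>] by (auto simp: bij_betw_def)
    have "inj_on (S \<alpha>) {j * \<kappa>..<j * \<kappa> + k j}" using sub S[of \<alpha>] by (auto simp: bij_betw_def intro: inj_on_subset)
    then show "card (bl j \<alpha>) = k j" by (simp add: bl_def card_image)
  qed
  have \<pi>L: "\<pi> j \<alpha> \<in> multi q I" "level I (\<pi> j \<alpha>) = k j" "sub_index I (\<pi> j \<alpha>) \<alpha>" if a: "\<alpha> \<in> L" "j < n" for j \<alpha>
  proof -
    show "\<pi> j \<alpha> \<in> multi q I" using a q by (auto simp: \<pi>_def L_def multi_def PiE_iff)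
    have "{i\<in>I. \<pi> j \<alpha> i \<noteq> 0} = bl j \<alpha>" using bl_sub[OF a] by (auto simp: \<pi>_def)
    then show "level I (\<pi> j \<alpha>) = k j" using bl_card[OF a] by (simp add: level_def)
    show "sub_index I (\<pi> j \<alpha>) \<alpha>" by (auto simp: sub_index_def \<pi>_def)
  qed
  have "(\<Sum>\<alpha>\<in>L. cmod (c \<alpha>) powr BH_exponent m) \<le>
    (\<Prod>j\<in>{..<n}. (\<Sum>y\<in>\<pi> j ` L. (sqrt (\<Sum>\<alpha>\<in>{\<alpha>\<in>L. \<pi> j \<alpha> = y}. cmod (c \<alpha>) ^ 2)) powr BH_exponent (k j))
       powr ((real (k j) + 1) / (real m + 1)))"
  proof (rule Blei_projections)
    fix \<alpha> \<alpha>' assume a: "\<alpha> \<in> L" "\<alpha>' \<in> L" and e: "\<And>j. j \<in> {..<n} \<Longrightarrow> \<pi> j \<alpha> = \<pi> j \<alpha>'"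
    have val: "\<alpha>' i = \<alpha> i" if a: "\<alpha> \<in> L" "\<alpha>' \<in> L" and e: "\<And>j. j < n \<Longrightarrow> \<pi> j \<alpha> = \<pi> j \<alpha>'" and i: "i \<in> I" "\<alpha> i \<noteq> 0" for \<alpha> \<alpha>' i
    proof -
      have "i \<in> S \<alpha> ` {..<m}" using S[of \<alpha>] i a(1) by (auto simp: bij_betw_def L_def)
      then obtain t where t: "t < m" "i = S \<alpha> t" by auto
      obtain j where j: "j < n" "j * \<kappa> \<le> t" "t < j * \<kappa> + k j" using bs(6)[OF t(1)] by auto
      have "i \<in> bl j \<alpha>" using t j by (auto simp: bl_def)
      then have "\<pi> j \<alpha> i = \<alpha> i" using i by (simp add: \<pi>_def)
      then have "\<pi> j \<alpha>' i \<noteq> 0 \<and> \<pi> j \<alpha>' i = \<alpha> i" using e[OF j(1)] i by simp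
      then show ?thesis using i(1) by (auto simp: \<pi>_def split: if_splits)
    qed
    show "\<alpha> = \<alpha>'"
    proof (rule PiE_ext)
      show "\<alpha> \<in> PiE I (\<lambda>_. {..<q})" "\<alpha>' \<in> PiE I (\<lambda>_. {..<q})" using a by (auto simp: L_def multi_def)
      fix i assume i: "i \<in> I"
      show "\<alpha> i = \<alpha>' i"
        using val[OF a _ i] val[OF a(2,1) _ i] e by (metis lessThan_iff)
    qed
  qed (use finL bs k in \<open>auto intro: order_trans\<close>)
  also have "\<dots> \<le> (\<Prod>j\<in>{..<n}. (A * Z ^ k j) powr (2 * real (k j) / (real m + 1)))"
  proof (intro prod_mono conjI)
    fix j assume "j \<in> {..<n}"
    then have j: "j < n" by simp
    have kj: "1 \<le> k j" "\<kappa> \<le> k j" using bs(2)[of j] \<open>1 \<le> \<kappa>\<close> by auto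
    let ?Lj = "level_set q I (k j)"
    define w where "w \<beta> = sqrt (\<Sum>\<alpha>\<in>{\<alpha>\<in>multi q I. level I \<alpha> = m \<and> sub_index I \<beta> \<alpha>}. cmod (c \<alpha>) ^ 2)" for \<beta>
    have p0: "BH_exponent (k j) \<ge> 0" by (simp add: BH_exponent_def)
    have "(\<Sum>y\<in>\<pi> j ` L. (sqrt (\<Sum>\<alpha>\<in>{\<alpha>\<in>L. \<pi> j \<alpha> = y}. cmod (c \<alpha>) ^ 2)) powr BH_exponent (k j))
      \<le> (\<Sum>y\<in>\<pi> j ` L. w y powr BH_exponent (k j))"
    proof (rule sum_mono)
      fix y
      have "{\<alpha>\<in>L. \<pi> j \<alpha> = y} \<subseteq> {\<alpha>\<in>multi q I. level I \<alpha> = m \<and> sub_index I y \<alpha>}"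
        using \<pi>L(3)[OF _ j] by (auto simp: L_def)
      then show "(sqrt (\<Sum>\<alpha>\<in>{\<alpha>\<in>L. \<pi> j \<alpha> = y}. cmod (c \<alpha>) ^ 2)) powr BH_exponent (k j) \<le> w y powr BH_exponent (k j)"
        unfolding w_def using I p0
        by (intro powr_mono2 real_sqrt_le_mono sum_mono2) (auto simp: sum_nonneg)
    qed
    also have "\<dots> \<le> (\<Sum>y\<in>?Lj. w y powr BH_exponent (k j))"
      using I \<pi>L(1,2)[OF _ j] by (intro sum_mono2) auto
    also have "\<dots> \<le> (A * (BH_base q * real d / (real (k j) * e)) ^ k j) powr BH_exponent (k j)"
      unfolding w_def A_def
    proof (rule mixed_norm_bound[OF q I l d kj(1) r(1,2) _ deg M])
      have "lsi_const q / real (k j) \<le> lsi_const q / real \<kappa>"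
        using kj lsi_const_ge_2[OF q] \<open>1 \<le> \<kappa>\<close> by (intro divide_left_mono) auto
      then show "lsi_const q / real (k j) \<le> 1 - r" using r by simp
    qed
    also have "\<dots> \<le> (A * Z ^ k j) powr BH_exponent (k j)"
    proof (intro powr_mono2 p0 mult_left_mono A0 power_mono mult_nonneg_nonneg)
      have "BH_base q * real d / (real (k j) * e) \<le> BH_base q * real d / (real \<kappa> * e)"
        using kj l BH_base_ge_1[OF q] \<open>1 \<le> \<kappa>\<close> by (intro divide_left_mono mult_right_mono mult_nonneg_nonneg mult_pos_pos) auto
      then show "BH_base q * real d / (real (k j) * e) \<le> Z" using Z by simp
    qed (use l BH_base_ge_1[OF q] in auto)
    finally have "(\<Sum>y\<in>\<pi> j ` L. (sqrt (\<Sum>\<alpha>\<in>{\<alpha>\<in>L. \<pi> j \<alpha> = y}. cmod (c \<alpha>) ^ 2)) powr BH_exponent (k j)) powr ((real (k j) + 1) / (real m + 1))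
       \<le> ((A * Z ^ k j) powr BH_exponent (k j)) powr ((real (k j) + 1) / (real m + 1))"
      by (intro powr_mono2) (auto intro: sum_nonneg)
    also have "\<dots> = (A * Z ^ k j) powr (2 * real (k j) / (real m + 1))"
      by (simp add: powr_powr BH_exponent_def)
    finally show "(\<Sum>y\<in>\<pi> j ` L. (sqrt (\<Sum>\<alpha>\<in>{\<alpha>\<in>L. \<pi> j \<alpha> = y}. cmod (c \<alpha>) ^ 2)) powr BH_exponent (k j)) powr ((real (k j) + 1) / (real m + 1))
      \<le> (A * Z ^ k j) powr (2 * real (k j) / (real m + 1))" .
  qed auto
  also have "\<dots> = (\<Prod>j\<in>{..<n}. A powr (2 * real (k j) / (real m + 1))) * (\<Prod>j\<in>{..<n}. Z powr (2 * real (k j) ^ 2 / (real m + 1)))"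
    unfolding prod.distrib[symmetric]
  proof (rule prod.cong[OF refl])
    fix j
    have "(Z ^ k j) powr (2 * real (k j) / (real m + 1)) = Z powr (2 * real (k j) ^ 2 / (real m + 1))"
      using Z by (simp add: powr_realpow[symmetric] powr_powr power2_eq_square mult_ac)
    then show "(A * Z ^ k j) powr (2 * real (k j) / (real m + 1)) = A powr (2 * real (k j) / (real m + 1)) * Z powr (2 * real (k j) ^ 2 / (real m + 1))"
      by (simp add: powr_mult)
  qed
  also have "(\<Prod>j\<in>{..<n}. A powr (2 * real (k j) / (real m + 1))) = A powr BH_exponent m"
  proof (cases "A = 0")
    case True
    have "0 \<in> {..<n}" "1 \<le> k 0" using bs(1) bs(2)[of 0] \<open>1 \<le> \<kappa>\<close> by auto
    then show ?thesis using True by (auto intro!: prod_zero bexI[of _ 0])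
  next
    case False
    have "(\<Sum>j<n. 2 * real (k j) / (real m + 1)) = BH_exponent m"
      using bs(3) by (simp add: BH_exponent_def sum_divide_distrib[symmetric] sum_distrib_left[symmetric] flip: of_nat_sum)
    then show ?thesis using False by (simp add: powr_sum[symmetric])
  qed
  also have "(\<Prod>j\<in>{..<n}. Z powr (2 * real (k j) ^ 2 / (real m + 1))) = Z powr ((\<Sum>j<n. 2 * real (k j) ^ 2 / (real m + 1)))"
    using Z by (subst powr_sum) auto
  also have "(\<Sum>j<n. 2 * real (k j) ^ 2 / (real m + 1)) = 2 * real (\<Sum>j<n. k j ^ 2) / (real m + 1)"
    by (simp add: sum_divide_distrib[symmetric] sum_distrib_left[symmetric])
  also have "A powr BH_exponent m * Z powr (2 * real (\<Sum>j<n. k j ^ 2) / (real m + 1)) \<le> A powr BH_exponent m * Z powr (2 * (real \<kappa> * real m + 2 * real \<kappa> ^ 2) / (real m + 1))"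
  proof (intro mult_left_mono powr_mono divide_right_mono)
    show "real (\<Sum>j<n. k j ^ 2) \<le> real \<kappa> * real m + 2 * real \<kappa> ^ 2"
      using bs(4) by (metis (mono_tags) of_nat_add of_nat_le_iff of_nat_mult of_nat_numeral of_nat_power)
  qed (use Z in auto)
  also have "2 * (real \<kappa> * real m + 2 * real \<kappa> ^ 2) / (real m + 1) = (real \<kappa> + 2 * real \<kappa> ^ 2 / real m) * BH_exponent m"
  proof -
    have "real \<kappa> + 2 * real \<kappa> ^ 2 / real m = (real \<kappa> * real m + 2 * real \<kappa> ^ 2) / real m"
      using m1 by (simp add: add_divide_distrib)
    then show ?thesis using m1 by (simp only: BH_exponent_def) simp
  qed
  also have "Z powr \<dots> = (Z powr (real \<kappa> + 2 * real \<kappa> ^ 2 / real m)) powr BH_exponent m" by (simp add: powr_powr)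
  finally show ?thesis by (simp add: L_def A_def powr_mult)
qed

section \<open>From fixed levels to the Bohnenblust-Hille constant\<close>

lemma cyclic_cube_eq: "cyclic_cube q N = cube q {..<N}" by (simp add: cyclic_cube_def cube_def)
lemma fourier_indices_eq: "fourier_indices q N = multi q {..<N}" by (simp add: fourier_indices_def multi_def)

lemma level_le_total_degree: "level {..<N} \<alpha> \<le> total_degree N \<alpha>"
proof -
  have "level {..<N} \<alpha> = (\<Sum>i<N. if \<alpha> i \<noteq> 0 then 1 else 0)" by (simp add: level_def sum.If_cases Int_def)
  also have "\<dots> \<le> total_degree N \<alpha>" unfolding total_degree_def by (intro sum_mono) auto
  finally show ?thesis .
qed

lemma fourier_inversion:
  assumes q: "q \<ge> 1" and x: "x \<in> cyclic_cube q N"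
  shows "fourier_sum q {..<N} (fourier_coeff q N f) x = f x"
proof -
  let ?I = "{..<N}"
  have xy: "(\<Sum>\<alpha>\<in>multi q ?I. cnj (monomial N \<alpha> y) * char_prod ?I \<alpha> x) = (if x = y then of_nat q ^ N else 0)"
    if y: "y \<in> cube q ?I" for y
  proof -
    have "(\<Sum>\<alpha>\<in>multi q ?I. cnj (monomial N \<alpha> y) * char_prod ?I \<alpha> x) = (\<Sum>\<alpha>\<in>multi q ?I. \<Prod>i<N. x i ^ \<alpha> i * cnj (y i ^ \<alpha> i))"
      by (simp add: monomial_def char_prod_def prod.distrib mult.commute)
    also have "\<dots> = (\<Prod>i<N. \<Sum>a<q. x i ^ a * cnj (y i ^ a))"
      unfolding multi_def by (subst prod_sum_PiE) auto
    also have "\<dots> = (\<Prod>i<N. if x i = y i then of_nat q else 0)"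
      by (intro prod.cong refl characters_complete q) (use x y in \<open>auto simp: cyclic_cube_eq cube_def PiE_iff\<close>)
    also have "\<dots> = (if x = y then of_nat q ^ N else 0)"
    proof (cases "x = y")
      case False
      then obtain i where "i \<in> ?I" "x i \<noteq> y i"
        using x y PiE_ext[of x ?I "\<lambda>_. cyclic_roots q" y] by (auto simp: cyclic_cube_eq cube_def)
      then show ?thesis using False by (auto intro!: prod_zero)
    qed simp
    finally show ?thesis .
  qed
  have "fourier_sum q ?I (fourier_coeff q N f) x
     = (\<Sum>\<alpha>\<in>multi q ?I. \<Sum>y\<in>cube q ?I. f y / of_nat q ^ N * (cnj (monomial N \<alpha> y) * char_prod ?I \<alpha> x))"
    by (simp add: fourier_sum_def fourier_coeff_def cyclic_cube_eq sum_divide_distrib sum_distrib_left sum_distrib_right mult_ac)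
  also have "\<dots> = (\<Sum>y\<in>cube q ?I. f y / of_nat q ^ N * (\<Sum>\<alpha>\<in>multi q ?I. cnj (monomial N \<alpha> y) * char_prod ?I \<alpha> x))"
    by (subst sum.swap) (simp add: sum_distrib_left)
  also have "\<dots> = (\<Sum>y\<in>cube q ?I. if x = y then f y else 0)"
    by (intro sum.cong refl) (use xy q in auto)
  also have "\<dots> = f x" using x by (simp add: cyclic_cube_eq sum.delta')
  finally show ?thesis .
qed

lemma norm_le_sup_norm: "x \<in> cyclic_cube q N \<Longrightarrow> cmod (f x) \<le> sup_norm q N f"
  unfolding sup_norm_def by (intro Max_ge) (auto simp: cyclic_cube_eq)

lemma cyclic_cube_nonempty: "q \<ge> 1 \<Longrightarrow> cyclic_cube q N \<noteq> {}"
  using card_cube[of q "{..<N}"] by (auto simp: cyclic_cube_eq)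

lemma sup_norm_nonneg: "q \<ge> 1 \<Longrightarrow> sup_norm q N f \<ge> 0"
  using cyclic_cube_nonempty[of q N] norm_le_sup_norm[of _ q N f] norm_ge_zero order_trans by blast

lemma norm_fourier_coeff_le:
  assumes q: "q \<ge> 1"
  shows "cmod (fourier_coeff q N f \<alpha>) \<le> sup_norm q N f"
proof -
  have "cmod (\<Sum>x\<in>cyclic_cube q N. f x * cnj (monomial N \<alpha> x)) \<le> (\<Sum>x\<in>cyclic_cube q N. sup_norm q N f)"
  proof (rule order_trans[OF norm_sum sum_mono])
    fix x assume x: "x \<in> cyclic_cube q N"
    have "cmod (monomial N \<alpha> x) = 1"
      unfolding monomial_def prod_norm[symmetric] norm_power
      by (intro prod.neutral) (use x norm_cyclic_roots[OF q] in \<open>auto simp: cyclic_cube_def PiE_iff\<close>)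
    then show "cmod (f x * cnj (monomial N \<alpha> x)) \<le> sup_norm q N f" using norm_le_sup_norm[OF x] by (simp add: norm_mult)
  qed
  also have "\<dots> = real q ^ N * sup_norm q N f" using card_cube[OF q, of "{..<N}"] by (simp add: cyclic_cube_eq)
  finally show ?thesis using q by (simp add: fourier_coeff_def norm_divide norm_power field_simps)
qed

lemma sum_powr_mono_exponent:
  fixes a :: "'x \<Rightarrow> real"
  assumes "finite A" "\<And>x. x \<in> A \<Longrightarrow> a x \<ge> 0" "B \<ge> 0" "0 < s" "s \<le> t"
    and "(\<Sum>x\<in>A. a x powr s) \<le> B powr s"
  shows "(\<Sum>x\<in>A. a x powr t) \<le> B powr t"
proof -
  have aB: "a x \<le> B" if "x \<in> A" for x
  proof -
    have "a x powr s \<le> (\<Sum>x\<in>A. a x powr s)" using assms(1) that by (intro member_le_sum) auto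
    then have "a x powr s \<le> B powr s" using assms(6) by simp
    then show ?thesis using assms(2)[OF that] assms(3,4) powr_less_mono2[of s B "a x"] by linarith
  qed
  have "(\<Sum>x\<in>A. a x powr t) \<le> (\<Sum>x\<in>A. a x powr s * B powr (t - s))"
  proof (rule sum_mono)
    fix x assume x: "x \<in> A"
    have "a x powr t = a x powr s * a x powr (t - s)" by (simp add: powr_add[symmetric])
    also have "\<dots> \<le> a x powr s * B powr (t - s)"
      using aB[OF x] assms(2)[OF x] assms(5) by (intro mult_left_mono powr_mono2) auto
    finally show "a x powr t \<le> a x powr s * B powr (t - s)" .
  qed
  also have "\<dots> \<le> B powr s * B powr (t - s)" unfolding sum_distrib_right[symmetric]
    using assms(6) by (intro mult_right_mono) auto
  also have "\<dots> = B powr t" by (simp add: powr_add[symmetric])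
  finally show ?thesis .
qed

lemma BH_exponent_mono: "m \<le> d \<Longrightarrow> BH_exponent m \<le> BH_exponent d"
  by (simp add: BH_exponent_def divide_simps) (simp add: algebra_simps)

text \<open>The exponents \<open>2 m / (m + 1)\<close> increase with \<open>m\<close>, so a bound with the exponent of level \<open>m\<close> implies one with
the exponent of \<open>d\<close>. Level zero consists of the mean of \<open>f\<close> only.\<close>

lemma coeff_norm_from_levels:
  assumes q: "q \<ge> 1" and d: "d \<ge> 1" and R: "R \<ge> 1"
    and lev: "\<And>m. 1 \<le> m \<Longrightarrow> m \<le> d \<Longrightarrow>
      (\<Sum>\<alpha>\<in>level_set q {..<N} m. cmod (fourier_coeff q N f \<alpha>) powr BH_exponent m)
         \<le> (sup_norm q N f * R) powr BH_exponent m"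
  shows "coeff_norm d q N f \<le> ((real d + 1) * R) * sup_norm q N f"
proof -
  let ?I = "{..<N}" and ?c = "fourier_coeff q N f"
  define M where "M = sup_norm q N f"
  have M0: "M \<ge> 0" using sup_norm_nonneg[OF q] by (simp add: M_def)
  define p where "p = BH_exponent d"
  have p: "p \<ge> 1" using BH_exponent_bounds(1)[OF d] by (simp add: p_def)
  define B where "B = M * R"
  have B0: "B \<ge> 0" using M0 R by (simp add: B_def)
  define Lm where "Lm m = level_set q ?I m" for m
  have finL: "finite (Lm m)" for m by (simp add: Lm_def)
  have each: "(\<Sum>\<alpha>\<in>Lm m. cmod (?c \<alpha>) powr p) \<le> B powr p" if "m \<le> d" for m
  proof (cases "m = 0")
    case True
    have "card (Lm 0) \<le> 1"
    proof -
      have "Lm 0 \<subseteq> {\<lambda>i\<in>?I. 0}"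
      proof
        fix \<alpha> assume a: "\<alpha> \<in> Lm 0"
        then have "\<alpha> i = 0" if "i \<in> ?I" for i using that by (auto simp: Lm_def level_def)
        moreover have "\<alpha> \<in> extensional ?I" using a by (auto simp: Lm_def multi_def PiE_def)
        ultimately show "\<alpha> \<in> {\<lambda>i\<in>?I. 0}" by (auto simp: fun_eq_iff extensional_def)
      qed
      from card_mono[OF _ this] show ?thesis by simp
    qed
    have "(\<Sum>\<alpha>\<in>Lm 0. cmod (?c \<alpha>) powr p) \<le> real (card (Lm 0)) * B powr p"
    proof (rule sum_bounded_above)
      fix \<alpha>
      have "cmod (?c \<alpha>) \<le> M" unfolding M_def by (rule norm_fourier_coeff_le[OF q])
      also have "M \<le> B" using M0 R mult_left_mono[of 1 R M] by (simp add: B_def)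
      finally show "cmod (?c \<alpha>) powr p \<le> B powr p" using p by (intro powr_mono2) auto
    qed
    also have "\<dots> \<le> 1 * B powr p" using \<open>card (Lm 0) \<le> 1\<close> by (intro mult_right_mono) auto
    finally show ?thesis using True by simp
  next
    case False
    then have m: "1 \<le> m" by simp
    show ?thesis
    proof (rule sum_powr_mono_exponent[OF finL _ B0])
      show "0 < BH_exponent m" using BH_exponent_bounds(1)[OF m] by simp
      show "BH_exponent m \<le> p" unfolding p_def by (rule BH_exponent_mono) fact
      show "(\<Sum>\<alpha>\<in>Lm m. cmod (?c \<alpha>) powr BH_exponent m) \<le> B powr BH_exponent m"
        using lev[OF m that] by (simp add: Lm_def B_def M_def)
    qed auto
  qed
  have "(\<Sum>\<alpha> | \<alpha> \<in> fourier_indices q N \<and> total_degree N \<alpha> \<le> d. cmod (?c \<alpha>) powr p)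
     \<le> (\<Sum>\<alpha>\<in>(\<Union>m\<in>{..d}. Lm m). cmod (?c \<alpha>) powr p)"
    using level_le_total_degree[of N] finL
    by (intro sum_mono2) (auto simp: fourier_indices_eq Lm_def intro: order_trans)
  also have "\<dots> = (\<Sum>m\<le>d. \<Sum>\<alpha>\<in>Lm m. cmod (?c \<alpha>) powr p)"
    using finL by (intro sum.UNION_disjoint) (auto simp: Lm_def)
  also have "\<dots> \<le> (\<Sum>m\<le>d. B powr p)" by (intro sum_mono each) auto
  also have "\<dots> = (real d + 1) * B powr p" by simp
  finally have "coeff_norm d q N f \<le> ((real d + 1) * B powr p) powr (1 / p)"
    unfolding coeff_norm_def p_def[symmetric] using p by (intro powr_mono2) (auto intro: sum_nonneg)
  also have "\<dots> = (real d + 1) powr (1 / p) * B" using p B0 by (simp add: powr_mult powr_powr)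
  also have "\<dots> \<le> (real d + 1) powr 1 * B" using p B0 by (intro mult_right_mono powr_mono) auto
  finally show ?thesis by (simp add: B_def M_def mult_ac)
qed

lemma deriv_coeff_zero:
  assumes I: "finite I" and \<beta>: "\<beta> \<in> multi q I"
  shows "deriv_coeff q I 0 c \<beta> = c \<beta>"
proof -
  have "deriv_coeff q I 0 c \<beta> = (\<Sum>\<alpha>\<in>{\<beta>}. c \<alpha> * of_real (0 ^ (level I \<alpha> - level I \<beta>)))"
    unfolding deriv_coeff_def
  proof (rule sum.mono_neutral_right)
    show "{\<beta>} \<subseteq> (extensions q I \<beta>)" using \<beta> by (auto simp: sub_index_def)
    show "\<forall>\<alpha>\<in>extensions q I \<beta> - {\<beta>}. c \<alpha> * of_real (0 ^ (level I \<alpha> - level I \<beta>)) = 0"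
    proof
      fix \<alpha> assume a: "\<alpha> \<in> extensions q I \<beta> - {\<beta>}"
      then obtain i where i: "i \<in> I" "\<alpha> i \<noteq> \<beta> i" using \<beta> PiE_ext[of \<alpha> I "\<lambda>_. {..<q}" \<beta>] by (auto simp: multi_def)
      then have "i \<in> {i\<in>I. \<alpha> i \<noteq> 0 \<and> \<beta> i = 0}" using a by (auto simp: sub_index_def)
      then have "card {i\<in>I. \<alpha> i \<noteq> 0 \<and> \<beta> i = 0} > 0" using I by (auto simp: card_gt_0_iff)
      then have "level I \<alpha> - level I \<beta> > 0" using level_sub_index(1)[OF I, of \<beta> \<alpha>] a by simp
      then show "c \<alpha> * of_real (0 ^ (level I \<alpha> - level I \<beta>)) = 0" by simp
    qed
  qed (use I in simp)
  then show ?thesis by simp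
qed

text \<open>Here \<open>e = k / d\<close>, so that the noise parameter \<open>l = 1 - e\<close> costs at most \<open>exp (2 k)\<close> on any level. The three
lower bounds for \<open>R\<close> belong to three ranges of levels. Below \<open>r0\<close> the
Bohnenblust-Hille inequality for the derivatives with \<open>l = 0\<close> suffices. Between \<open>r0\<close> and \<open>t\<close>
blocks of the constant size \<open>r0\<close> are used, with noise parameter \<open>sqrt (1 / 2)\<close>. From \<open>t\<close> on the blocks have
size \<open>k\<close>; the level is then so large that the oversized last block hardly matters.\<close>

theorem BH_bound_nonasymptotic:
  assumes q: "q \<ge> 2" and d: "d \<ge> 1" and k: "1 \<le> k" "2 * k \<le> d" and t: "1 \<le> t" "t \<ge> real k"
    and r0: "1 \<le> r0" "lsi_const q / real r0 \<le> 1 / 2" "r0 \<le> k"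
    and Z: "BH_base q * real d ^ 2 / real k ^ 2 \<le> Z" "1 \<le> Z"
    and R: "(BH_base q * real d) ^ r0 \<le> R"
      "exp (t + 2 * real k) * (BH_base q * real d ^ 2) ^ (3 * r0) \<le> R"
      "exp (real d * (lsi_const q / (2 * real k) + (lsi_const q / real k)^2) + 2 * real k) * Z powr (real k + 2 * real k ^ 2 / t) \<le> R"
    and deg: "degree_at_most d q N f"
  shows "coeff_norm d q N f \<le> ((real d + 1) * R) * sup_norm q N f"
proof -
  let ?I = "{..<N}" and ?c = "fourier_coeff q N f" and ?M = "sup_norm q N f"
  have q1: "q \<ge> 1" using q by simp
  have B1: "BH_base q \<ge> 1" by (rule BH_base_ge_1[OF q])
  have Bd: "BH_base q * real d \<ge> 1" using B1 d mult_mono[of 1 "BH_base q" 1 "real d"] by simp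
  have Bd2: "BH_base q * real d ^ 2 \<ge> 1" using B1 d mult_mono[of 1 "BH_base q" 1 "real d ^ 2"] by simp
  have R1: "R \<ge> 1" using R(1) one_le_power[OF Bd, of r0] by simp
  have deg': "?c \<alpha> = 0" if "\<alpha> \<in> multi q ?I" "level ?I \<alpha> > d" for \<alpha>
    using deg that level_le_total_degree[of N \<alpha>] by (auto simp: degree_at_most_def fourier_indices_eq)
  have M: "cmod (fourier_sum q ?I ?c x) \<le> ?M" if "x \<in> cube q ?I" for x
    using fourier_inversion[OF q1, of x N f] norm_le_sup_norm[of x q N f] that by (simp add: cyclic_cube_eq)
  have M0: "?M \<ge> 0" by (rule sup_norm_nonneg[OF q1])
  define e where "e = real k / real d"
  define l where "l = 1 - e"
  have e: "0 < e" "e \<le> 1 / 2" using k d by (auto simp: e_def field_simps)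
  have l: "0 < l" "l + e = 1" using e by (auto simp: l_def)
  have l_pow: "(1 / l) ^ m \<le> exp (2 * real k)" if "m \<le> d" for m
  proof -
    have "- e - 2 * e^2 \<le> ln (1 - e)" by (rule ln_one_minus_pos_lower_bound) (use e in auto)
    moreover have "e^2 \<le> e * (1/2)" unfolding power2_eq_square using e by (intro mult_left_mono) auto
    ultimately have "ln (1 / l) \<le> 2 * e" using l e by (simp add: l_def ln_div)
    then have "exp (ln (1 / l)) \<le> exp (2 * e)" by (simp only: exp_le_cancel_iff)
    moreover have "exp (ln (1 / l)) = 1 / l" by (rule exp_ln) (use l in auto)
    ultimately have "1 / l \<le> exp (2 * e)" by (simp only:)
    then have "(1 / l) ^ m \<le> exp (2 * e) ^ m" using l by (intro power_mono) auto
    also have "\<dots> = exp (2 * e * real m)" by (simp add: exp_of_nat_mult[symmetric] mult_ac)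
    also have "\<dots> \<le> exp (2 * real k)" using that e k d mult_left_mono[of "real m" "real d" "2 * e"] by (simp add: e_def)
    finally show ?thesis .
  qed
  have lsi: "lsi_const q \<ge> 2" by (rule lsi_const_ge_2[OF q])
  show ?thesis
  proof (rule coeff_norm_from_levels[OF q1 d R1])
    fix m assume m: "1 \<le> m" "m \<le> d"
    let ?Lm = "level_set q ?I m"
    have mono: "(?M * x) powr BH_exponent m \<le> (?M * R) powr BH_exponent m" if "0 \<le> x" "x \<le> R" for x
      using that M0 BH_exponent_bounds(1)[OF m(1)] by (intro powr_mono2 mult_left_mono) auto
    consider "m < r0" | "r0 \<le> m" "real m < t" | "t \<le> real m" by linarith
    then show "(\<Sum>\<alpha>\<in>?Lm. cmod (?c \<alpha>) powr BH_exponent m) \<le> (?M * R) powr BH_exponent m"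
    proof cases
      case 1
      have "(\<Sum>\<alpha>\<in>?Lm. cmod (?c \<alpha>) powr BH_exponent m) = (\<Sum>\<alpha>\<in>?Lm. cmod (deriv_coeff q ?I 0 ?c \<alpha>) powr BH_exponent m)"
        by (intro sum.cong refl) (simp add: deriv_coeff_zero)
      also have "\<dots> \<le> (?M * (BH_base q * real d / (real m * 1)) ^ m) powr BH_exponent m"
        by (rule deriv_coeff_BH[OF q _ _ _ _ d m(1) deg' M]) auto
      also have "\<dots> \<le> (?M * R) powr BH_exponent m"
      proof (rule mono)
        have "(BH_base q * real d / (real m * 1)) ^ m \<le> (BH_base q * real d) ^ m"
          using m Bd by (intro power_mono) (auto simp: divide_le_eq mult_le_cancel_left1)
        also have "\<dots> \<le> (BH_base q * real d) ^ r0" using 1 Bd by (intro power_increasing) auto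
        finally show "(BH_base q * real d / (real m * 1)) ^ m \<le> R" using R by simp
      qed (use B1 in auto)
      finally show ?thesis .
    next
      case 2
      define Z2 where "Z2 = BH_base q * real d ^ 2"
      have "(\<Sum>\<alpha>\<in>?Lm. cmod (?c \<alpha>) powr BH_exponent m) \<le> (?M * (1 / (sqrt (1/2) * l)) ^ m * Z2 powr (real r0 + 2 * real r0 ^ 2 / real m)) powr BH_exponent m"
      proof (rule level_coefficients_bound[OF q _ l(1) e(1) l(2) d r0(1) 2(1) _ _ _ deg' M])
        have "BH_base q * real d / (real r0 * e) = BH_base q * real d ^ 2 / (real r0 * real k)"
          using d by (simp add: e_def power2_eq_square)
        also have "\<dots> \<le> BH_base q * real d ^ 2 / 1"
          using B1 r0 k mult_mono[of 1 "real r0" 1 "real k"] by (intro divide_left_mono) auto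
        finally show "BH_base q * real d / (real r0 * e) \<le> Z2" by (simp add: Z2_def)
      qed (use r0 Bd2 in \<open>auto simp: Z2_def\<close>)
      also have "\<dots> \<le> (?M * R) powr BH_exponent m"
        unfolding mult.assoc[of ?M]
      proof (rule mono)
        have "(1 / (sqrt (1/2) * l)) ^ m = sqrt 2 ^ m * (1 / l) ^ m"
          by (simp add: real_sqrt_divide power_mult_distrib power_divide)
        also have "\<dots> \<le> exp t * exp (2 * real k)"
        proof (intro mult_mono l_pow m)
          have "sqrt 2 \<le> exp (1::real)" using exp_ge_add_one_self[of 1] real_sqrt_le_mono[of 2 4] by simp
          then have "sqrt 2 ^ m \<le> exp 1 ^ m" by (intro power_mono) auto
          also have "\<dots> = exp (real m)" by (simp flip: exp_of_nat_mult)
          also have "\<dots> \<le> exp t" using 2 by simp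
          finally show "sqrt 2 ^ m \<le> exp t" .
        qed (use l in auto)
        finally have a: "(1 / (sqrt (1/2) * l)) ^ m \<le> exp (t + 2 * real k)" by (simp add: exp_add)
        have "real r0 ^ 2 / real m \<le> real r0" using 2 m mult_left_mono[of "real r0" "real m" "real r0"] by (simp add: power2_eq_square divide_le_eq)
        then have "Z2 powr (real r0 + 2 * real r0 ^ 2 / real m) \<le> Z2 powr real (3 * r0)"
          using Bd2 by (intro powr_mono) (auto simp: Z2_def)
        also have "\<dots> = Z2 ^ (3 * r0)" using Bd2 by (intro powr_realpow) (simp add: Z2_def)
        finally have "(1 / (sqrt (1/2) * l)) ^ m * Z2 powr (real r0 + 2 * real r0 ^ 2 / real m) \<le> exp (t + 2 * real k) * Z2 ^ (3 * r0)"
          using a by (intro mult_mono) auto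
        then show "(1 / (sqrt (1/2) * l)) ^ m * Z2 powr (real r0 + 2 * real r0 ^ 2 / real m) \<le> R"
          using R(2) by (simp add: Z2_def)
      qed (use l in auto)
      finally show ?thesis .
    next
      case 3
      define u where "u = lsi_const q / real k"
      have "u \<le> lsi_const q / real r0" unfolding u_def using r0 lsi by (intro divide_left_mono) auto
      then have u: "0 < u" "u \<le> 1 / 2" using r0 lsi k by (auto simp: u_def)
      have km: "k \<le> m" using 3 t by simp
      have "(\<Sum>\<alpha>\<in>?Lm. cmod (?c \<alpha>) powr BH_exponent m) \<le> (?M * (1 / (sqrt (1 - u) * l)) ^ m * Z powr (real k + 2 * real k ^ 2 / real m)) powr BH_exponent m"
      proof (rule level_coefficients_bound[OF q _ l(1) e(1) l(2) d k(1) km _ _ _ deg' M])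
        have "BH_base q * real d / (real k * e) = BH_base q * real d ^ 2 / real k ^ 2"
          using d by (simp add: e_def power2_eq_square)
        then show "BH_base q * real d / (real k * e) \<le> Z" using Z by simp
        show "0 < 1 - u" "1 - u \<le> 1" using u by auto
        show "lsi_const q / real k \<le> 1 - (1 - u)" by (simp add: u_def)
      qed (simp_all add: Z)
      also have "\<dots> \<le> (?M * R) powr BH_exponent m"
        unfolding mult.assoc[of ?M]
      proof (rule mono)
        have "(1 / (sqrt (1 - u) * l)) ^ m = (1 / sqrt (1 - u)) ^ m * (1 / l) ^ m"
          by (simp add: power_mult_distrib power_divide)
        also have "\<dots> \<le> exp (real d * (u / 2 + u^2)) * exp (2 * real k)"
        proof (intro mult_mono l_pow m)
          have "- u - 2 * u^2 \<le> ln (1 - u)" by (rule ln_one_minus_pos_lower_bound) (use u in auto)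
          then have "ln (1 / sqrt (1 - u)) \<le> u / 2 + u^2" using u by (simp add: ln_div ln_sqrt)
          then have "exp (ln (1 / sqrt (1 - u))) \<le> exp (u / 2 + u^2)" by (simp only: exp_le_cancel_iff)
          moreover have "exp (ln (1 / sqrt (1 - u))) = 1 / sqrt (1 - u)" by (rule exp_ln) (use u in auto)
          ultimately have "1 / sqrt (1 - u) \<le> exp (u / 2 + u^2)" by (simp only:)
          then have "(1 / sqrt (1 - u)) ^ m \<le> exp (u / 2 + u^2) ^ m" using u by (intro power_mono) auto
          also have "\<dots> = exp (real m * (u / 2 + u^2))" by (simp add: exp_of_nat_mult[symmetric])
          also have "\<dots> \<le> exp (real d * (u / 2 + u^2))" using m u by (simp add: mult_right_mono)
          finally show "(1 / sqrt (1 - u)) ^ m \<le> exp (real d * (u / 2 + u^2))" .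
        qed (use l in auto)
        finally have a: "(1 / (sqrt (1 - u) * l)) ^ m \<le> exp (real d * (u / 2 + u^2) + 2 * real k)" by (simp add: exp_add)
        have "2 * real k ^ 2 / real m \<le> 2 * real k ^ 2 / t" using 3 t by (intro divide_left_mono) auto
        then have "Z powr (real k + 2 * real k ^ 2 / real m) \<le> Z powr (real k + 2 * real k ^ 2 / t)"
          using Z by (intro powr_mono) auto
        then have "(1 / (sqrt (1 - u) * l)) ^ m * Z powr (real k + 2 * real k ^ 2 / real m) \<le> exp (real d * (u / 2 + u^2) + 2 * real k) * Z powr (real k + 2 * real k ^ 2 / t)"
          using a by (intro mult_mono) auto
        also have "\<dots> \<le> R"
        proof -
          have "lsi_const q / (2 * real k) = u / 2" by (simp add: u_def)
          then show ?thesis using R(3) by (simp only: flip: u_def)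
        qed
        finally show "(1 / (sqrt (1 - u) * l)) ^ m * Z powr (real k + 2 * real k ^ 2 / real m) \<le> R" .
      qed (use l u in auto)
      finally show ?thesis .
    qed
  qed
qed

lemma BH_deg_le:
  assumes "\<And>N f. N \<ge> 1 \<Longrightarrow> degree_at_most d q N f \<Longrightarrow> coeff_norm d q N f \<le> C * sup_norm q N f"
  shows "BH_deg d q \<le> ereal C"
  unfolding BH_deg_def by (rule Inf_lower) (use assms in auto)

text \<open>The constant function \<open>1\<close> of one variable.\<close>

lemma BH_deg_ge_1:
  assumes q: "q \<ge> 2" and d: "d \<ge> 1"
  shows "BH_deg d q \<ge> 1"
  unfolding BH_deg_def
proof (rule Inf_greatest, clarify)
  fix C :: real
  assume C: "\<forall>N\<ge>1. \<forall>f. degree_at_most d q N f \<longrightarrow> coeff_norm d q N f \<le> C * sup_norm q N f"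
  have q1: "q \<ge> 1" using q by simp
  let ?f = "\<lambda>_. 1 :: complex" and ?I = "{..<1::nat}"
  define p where "p = BH_exponent d"
  have p: "p \<ge> 1" using BH_exponent_bounds(1)[OF d] by (simp add: p_def)
  define z where "z = (\<lambda>i\<in>?I. 0 :: nat)"
  have zI: "z \<in> fourier_indices q 1" using q by (auto simp: z_def fourier_indices_def)
  have fc: "fourier_coeff q 1 ?f \<alpha> = (if \<alpha> 0 = 0 then 1 else 0)" if "\<alpha> \<in> fourier_indices q 1" for \<alpha>
  proof -
    have "(\<Sum>x\<in>cyclic_cube q 1. cnj (monomial 1 \<alpha> x)) = cnj (\<Sum>x\<in>cyclic_cube q 1. \<Prod>i\<in>?I. x i ^ \<alpha> i)"
      by (simp add: monomial_def)
    also have "(\<Sum>x\<in>cyclic_cube q 1. \<Prod>i\<in>?I. x i ^ \<alpha> i) = (\<Prod>i\<in>?I. \<Sum>w\<in>cyclic_roots q. w ^ \<alpha> i)"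
      unfolding cyclic_cube_def by (subst prod_sum_PiE) auto
    also have "\<dots> = (if \<alpha> 0 = 0 then of_nat q else 0)"
      using sum_char_zero[OF q1, of "\<alpha> 0"] that by (auto simp: fourier_indices_def PiE_iff)
    finally show ?thesis using q by (simp add: fourier_coeff_def)
  qed
  have "degree_at_most d q 1 ?f"
    unfolding degree_at_most_def using fc by (auto simp: total_degree_def)
  then have "coeff_norm d q 1 ?f \<le> C * sup_norm q 1 ?f" using C by blast
  also have "sup_norm q 1 ?f = 1"
    using cyclic_cube_nonempty[OF q1, of 1] by (simp add: sup_norm_def image_constant_conv)
  finally have "coeff_norm d q 1 ?f \<le> C" by simp
  moreover have "coeff_norm d q 1 ?f \<ge> 1"
  proof -
    have "cmod (fourier_coeff q 1 ?f z) powr p \<le> (\<Sum>\<alpha> | \<alpha> \<in> fourier_indices q 1 \<and> total_degree 1 \<alpha> \<le> d. cmod (fourier_coeff q 1 ?f \<alpha>) powr p)"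
    proof (rule member_le_sum)
      have "total_degree 1 z = 0" by (simp add: total_degree_def z_def)
      then show "z \<in> {\<alpha> \<in> fourier_indices q 1. total_degree 1 \<alpha> \<le> d}" using zI by simp
    qed (auto simp: fourier_indices_eq)
    then have "1 powr (1 / p) \<le> (\<Sum>\<alpha> | \<alpha> \<in> fourier_indices q 1 \<and> total_degree 1 \<alpha> \<le> d. cmod (fourier_coeff q 1 ?f \<alpha>) powr p) powr (1 / p)"
      using p fc[OF zI] by (intro powr_mono2) (auto simp: z_def)
    then show ?thesis by (simp add: coeff_norm_def p_def)
  qed
  ultimately have "1 \<le> C" by simp
  then show "1 \<le> ereal C" by (simp add: one_ereal_def)
qed

section \<open>Asymptotics\<close>

definition err :: "nat \<Rightarrow> real" where
  "err d = sqrt (real d / ln (real d)) * ln (ln (real d))"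

lemma small_terms:
  "(\<lambda>d. ln (real d + 1)) \<in> o(err)" "(\<lambda>d. ln (real d)) \<in> o(err)" "(\<lambda>d. 1) \<in> o(err)"
  "(\<lambda>d. sqrt (real d / ln (real d))) \<in> o(err)" "(\<lambda>d. ln (ln (real d))) \<in> o(err)"
  "(\<lambda>d. sqrt (real d / ln (real d)) * (ln (ln (real d)) / ln (real d))) \<in> o(err)"
  "(\<lambda>d. sqrt (real d / ln (real d)) / ln (real d)) \<in> o(err)"
  "(\<lambda>d. ln (ln (real d)) / ln (real d)) \<in> o(err)" "(\<lambda>d. 1 / ln (real d)) \<in> o(err)"
  unfolding err_def by real_asymp+

lemma err_pos: "eventually (\<lambda>d. err d > 0) sequentially"
  unfolding err_def by real_asymp

lemma smallo_cmult_left: fixes f g :: "nat \<Rightarrow> real" assumes "f \<in> o(g)" shows "(\<lambda>d. c * f d) \<in> o(g)"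
  using assms by (cases "c = 0") auto

lemma eventually_le_err:
  assumes "r \<in> o(err)" shows "eventually (\<lambda>d. r d \<le> err d) sequentially"
  using landau_o.smallD[OF assms zero_less_one] err_pos by eventually_elim auto

lemma sqrt_mult_ln:
  assumes "ln (real d) > 0"
  shows "sqrt (real d * ln (real d)) = sqrt (real d / ln (real d)) * ln (real d)"
proof -
  have "real d * ln (real d) = (real d / ln (real d)) * (ln (real d))^2" using assms by (simp add: power2_eq_square)
  then show ?thesis using assms by (simp only: real_sqrt_mult) simp
qed

text \<open>The product \<open>X ln d\<close> is \<open>s sqrt (d ln d)\<close> and makes up the second half of the main term, and \<open>X ln (ln d)\<close> is
\<open>s\<close> times the error function. After expansion, every other term is of smaller order than the error function
and is absorbed by increasing its factor from \<open>s\<close> to \<open>s + 1\<close>.\<close>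

lemma asymptotic_large_levels:
  fixes s b :: real
  defines "X \<equiv> (\<lambda>d::nat. s * sqrt (real d / ln (real d)))"
  shows "eventually (\<lambda>d. ln (real d + 1) + s * sqrt (real d * ln (real d)) + 4 * s^2 * ln (real d) + 2 * (X d + 1)
     + (X d + 1) * (1 + 2 / ln (real d)) * (ln (real d) + ln (ln (real d)) + b)
     \<le> 2 * s * sqrt (real d * ln (real d)) + (s + 1) * err d) sequentially"
proof -
  define S where "S = (\<lambda>d::nat. sqrt (real d / ln (real d)))"
  define L where "L = (\<lambda>d::nat. ln (real d))"
  define r where "r = (\<lambda>d. ln (real d + 1) + ((4 * s^2 + 1) * L d + (((4 * s + s * b) * S d) + ((4 + b) * 1 + (1 * ln (L d) +
     ((2 * s) * (S d * (ln (L d) / L d)) + ((2 * s * b) * (S d / L d) + (2 * (ln (L d) / L d) + (2 * b) * (1 / L d)))))))))"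
  have "r \<in> o(err)"
    unfolding r_def S_def L_def by (intro sum_in_smallo smallo_cmult_left small_terms)
  moreover have "eventually (\<lambda>d. L d > 0) sequentially" unfolding L_def by real_asymp
  ultimately have "eventually (\<lambda>d. r d \<le> err d \<and> L d > 0) sequentially"
    using eventually_le_err by (intro eventually_conj) auto
  then show ?thesis
  proof eventually_elim
    case (elim d)
    have e: "err d = S d * ln (L d)" by (simp add: err_def S_def L_def)
    have Lp: "L d > 0" using elim by simp
    have "ln (real d + 1) + s * (S d * L d) + 4 * s^2 * L d + 2 * (s * S d + 1)
     + (s * S d + 1) * (1 + 2 / L d) * (L d + ln (L d) + b) = 2 * s * (S d * L d) + s * err d + r d"
      unfolding r_def e using Lp by (simp add: field_simps)
    then show ?case using elim sqrt_mult_ln[of d] unfolding X_def S_def L_def by (simp add: algebra_simps)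
  qed
qed

lemma asymptotic_small_levels:
  fixes s b :: real and n :: nat
  assumes s: "s > 0"
  defines "X \<equiv> (\<lambda>d::nat. s * sqrt (real d / ln (real d)))"
  shows "eventually (\<lambda>d. ln (real d + 1) + real n * (b + ln (real d))
     \<le> 2 * s * sqrt (real d * ln (real d)) + (s + 1) * err d) sequentially"
    and "eventually (\<lambda>d. ln (real d + 1) + (X d + 1) * ln (real d) + 2 * (X d + 1) + real n * (b + 2 * ln (real d))
     \<le> 2 * s * sqrt (real d * ln (real d)) + (s + 1) * err d) sequentially"
proof -
  have Lp: "eventually (\<lambda>d. ln (real d) > 0) sequentially" by real_asymp
  have "(\<lambda>d. ln (real d + 1) + ((real n * b) * 1 + real n * ln (real d))) \<in> o(err)"
    by (intro sum_in_smallo smallo_cmult_left small_terms)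
  from eventually_le_err[OF this] err_pos Lp
  show "eventually (\<lambda>d. ln (real d + 1) + real n * (b + ln (real d))
     \<le> 2 * s * sqrt (real d * ln (real d)) + (s + 1) * err d) sequentially"
  proof eventually_elim
    case (elim d)
    have "0 \<le> 2 * s * sqrt (real d * ln (real d)) + s * err d" using s elim by (intro add_nonneg_nonneg) auto
    then show ?case using elim by (simp add: algebra_simps)
  qed
  have "(\<lambda>d. ln (real d + 1) + ((1 + 2 * real n) * ln (real d) + ((2 * s) * sqrt (real d / ln (real d)) + (2 + real n * b) * 1))) \<in> o(err)"
    by (intro sum_in_smallo smallo_cmult_left small_terms)
  from eventually_le_err[OF this] err_pos Lp
  show "eventually (\<lambda>d. ln (real d + 1) + (X d + 1) * ln (real d) + 2 * (X d + 1) + real n * (b + 2 * ln (real d))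
     \<le> 2 * s * sqrt (real d * ln (real d)) + (s + 1) * err d) sequentially"
  proof eventually_elim
    case (elim d)
    have "0 \<le> s * sqrt (real d * ln (real d)) + s * err d" using s elim by (intro add_nonneg_nonneg) auto
    moreover have e: "(X d + 1) * ln (real d) = s * sqrt (real d * ln (real d)) + ln (real d)"
      using sqrt_mult_ln elim by (simp add: X_def distrib_right)
    ultimately show ?case using elim unfolding e unfolding X_def by (simp add: algebra_simps)
  qed
qed

text \<open>With \<open>s\<^sup>2 = 2 \<gamma>\<close> the block size is \<open>X = s sqrt (d / ln d)\<close> rounded up, the threshold is \<open>t = k ln d\<close>, and \<open>R\<close>
is the target divided by \<open>d + 1\<close>.\<close>

theorem eventually_BH_deg_le:
  assumes q: "q \<ge> 2"
  defines "s \<equiv> sqrt (lsi_const q / 2)"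
  shows "\<forall>\<^sub>F d in sequentially.
    BH_deg d q \<le> ereal (exp (BH_c q * sqrt (real d * ln (real d)) + (s + 1) * err d))"
proof -
  define C where "C = lsi_const q"
  have C: "C \<ge> 2" using lsi_const_ge_2[OF q] by (simp add: C_def)
  have s: "s > 0" "s^2 = C / 2" using C by (auto simp: s_def C_def)
  have c_eq: "BH_c q = 2 * s" by (simp add: BH_c_def s_def lsi_const_def)
  define B where "B = BH_base q"
  have B: "B \<ge> 1" using BH_base_ge_1[OF q] by (simp add: B_def)
  (* makes C / r0 at most 1/2, as hypercontractivity with r = 1/2 requires *)
  define r0 where "r0 = nat \<lceil>2 * C\<rceil>"
  have r0: "real r0 \<ge> 2 * C" unfolding r0_def by (rule real_nat_ceiling_ge)
  have r01: "r0 \<ge> 1" using r0 C by linarith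
  define X where "X = (\<lambda>d::nat. s * sqrt (real d / ln (real d)))"
  define k where "k = (\<lambda>d. nat \<lceil>X d\<rceil>)"
  define b where "b = ln (B / s^2)"
  have "filterlim X at_top sequentially"
    unfolding X_def using s(1) by real_asymp
  then have ev_X: "eventually (\<lambda>d. X d \<ge> real r0 + 1) sequentially"
    by (simp add: filterlim_at_top)
  have "(\<lambda>d::nat. sqrt (real d / ln (real d))) \<in> o(\<lambda>d. real d)" "(\<lambda>d::nat. 1) \<in> o(\<lambda>d. real d)"
    by real_asymp+
  then have "(\<lambda>d. X d + 1) \<in> o(\<lambda>d. real d)"
    unfolding X_def by (intro sum_in_smallo smallo_cmult_left)
  then have "eventually (\<lambda>d. norm (X d + 1) \<le> 1 / 2 * norm (real d)) sequentially"
    by (rule landau_o.smallD) simp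
  then have ev_k: "eventually (\<lambda>d. 2 * (X d + 1) \<le> real d) sequentially"
  proof eventually_elim
    case (elim d)
    then show ?case using abs_ge_self[of "X d + 1"] by simp
  qed
  have "0 < B / s^2" using s B by simp
  then have "filterlim (\<lambda>d. B / s^2 * (real d * ln (real d))) at_top sequentially"
    by real_asymp
  then have ev_Z: "eventually (\<lambda>d. B * (real d * ln (real d) / s^2) \<ge> 1) sequentially"
    by (simp add: filterlim_at_top)
  have ev_L: "eventually (\<lambda>d. ln (real d) \<ge> 1) sequentially" by real_asymp
  have ev_d: "eventually (\<lambda>d. d \<ge> 1) sequentially" by (rule eventually_ge_at_top)
  show ?thesis
    using asymptotic_large_levels[of s b] asymptotic_small_levels(1)[OF s(1), where n = r0 and b = "ln B"]
      asymptotic_small_levels(2)[OF s(1), where n = "3 * r0" and b = "ln B"] ev_X ev_k ev_Z ev_L ev_d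
  proof eventually_elim
    case (elim d)
    define L where "L = ln (real d)"
    have L: "L \<ge> 1" using elim by (simp add: L_def)
    have d: "real d > 0" using elim by simp
    have X: "X d = s * sqrt (real d / L)" by (simp add: X_def L_def)
    have Xpos: "X d > 0" using elim r01 by simp
    have kX: "X d \<le> real (k d)" "real (k d) \<le> X d + 1"
      using Xpos by (auto simp: k_def)
    have kr: "real (k d) \<ge> real r0 + 1" using kX elim by simp
    have k1: "1 \<le> k d" "r0 \<le> k d" using kr by auto
    have k2: "2 * k d \<le> d"
    proof -
      have "real (2 * k d) \<le> real d" using kX elim(5) by simp
      then show ?thesis by (simp only: of_nat_le_iff)
    qed
    have X2: "X d ^ 2 = s^2 * real d / L" using d L by (simp add: X power_mult_distrib)
    define t where "t = real (k d) * L"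
    have tk: "t \<ge> real (k d)" using L by (simp add: t_def mult_le_cancel_left1)
    define Z where "Z = B * (real d * L / s^2)"
    have Z1: "Z \<ge> 1" using elim by (simp add: Z_def L_def)
    have "B * real d ^ 2 / real (k d) ^ 2 \<le> B * real d ^ 2 / X d ^ 2"
      using kX Xpos B by (intro divide_left_mono mult_nonneg_nonneg power_mono) auto
    also have "\<dots> = Z" unfolding X2 Z_def using d L s(1) by (simp add: power2_eq_square)
    finally have Zk: "B * real d ^ 2 / real (k d) ^ 2 \<le> Z" .
    have lnZ: "ln Z = L + ln L + b"
    proof -
      have "Z = (B / s^2) * (real d * L)" by (simp add: Z_def)
      moreover have "ln ((B / s^2) * (real d * L)) = ln (B / s^2) + ln (real d * L)"
        by (rule ln_mult_pos) (use B s d L in auto)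
      moreover have "ln (real d * L) = ln (real d) + ln L"
        by (rule ln_mult_pos) (use d L in auto)
      ultimately show ?thesis by (simp only: b_def L_def)
    qed
    define Y where "Y = 2 * s * sqrt (real d * L) + (s + 1) * err d"
    define R where "R = exp Y / (real d + 1)"
    have R_ge: "x \<le> R" if "ln (real d + 1) + ln x \<le> Y" "x > 0" for x
    proof -
      have "ln ((real d + 1) * x) \<le> Y" using that d by (simp add: ln_mult)
      then have "(real d + 1) * x \<le> exp Y" using that d by (simp add: ln_le_cancel_iff[of _ "exp Y", symmetric] del: ln_le_cancel_iff)
      then show ?thesis using d by (simp add: R_def field_simps)
    qed
    have "BH_deg d q \<le> ereal ((real d + 1) * R)"
    proof (rule BH_deg_le, rule BH_bound_nonasymptotic[OF q _ k1(1) k2 _ tk r01 _ k1(2) Zk[unfolded B_def] Z1])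
      show "d \<ge> 1" using elim by simp
      show "1 \<le> t" using tk k1 by simp
      show "lsi_const q / real r0 \<le> 1 / 2" using r0 C by (simp add: C_def field_simps)
      show "(BH_base q * real d) ^ r0 \<le> R"
      proof (rule R_ge)
        have "ln ((B * real d) ^ r0) = real r0 * (ln B + L)" using B d by (simp add: ln_realpow ln_mult L_def)
        then show "ln (real d + 1) + ln ((BH_base q * real d) ^ r0) \<le> Y"
          using elim(2) by (simp add: B_def Y_def L_def)
      qed (use B d in \<open>auto simp: B_def\<close>)
      show "exp (t + 2 * real (k d)) * (BH_base q * real d ^ 2) ^ (3 * r0) \<le> R"
      proof (rule R_ge)
        have "ln (exp (t + 2 * real (k d)) * (B * real d ^ 2) ^ (3 * r0)) = t + 2 * real (k d) + real (3 * r0) * (ln B + 2 * L)"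
          using B d by (simp add: ln_mult_pos ln_realpow L_def)
        moreover have "t \<le> (X d + 1) * L" unfolding t_def using kX L by (intro mult_right_mono) auto
        ultimately show "ln (real d + 1) + ln (exp (t + 2 * real (k d)) * (BH_base q * real d ^ 2) ^ (3 * r0)) \<le> Y"
        proof -
          assume e: "ln (exp (t + 2 * real (k d)) * (B * real d ^ 2) ^ (3 * r0)) = t + 2 * real (k d) + real (3 * r0) * (ln B + 2 * L)"
            and tX: "t \<le> (X d + 1) * L"
          have "lt + (t + 2 * \<kappa> + n) \<le> y" if "t \<le> p" "\<kappa> \<le> x" "lt + p + 2 * x + n \<le> y" for lt n p x y \<kappa> :: real
            using that by linarith
          from this[OF tX kX(2) elim(3)[folded L_def, folded X]]
          show ?thesis unfolding B_def[symmetric] e Y_def .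
        qed
      qed (use B d in \<open>auto simp: B_def\<close>)
      show "exp (real d * (lsi_const q / (2 * real (k d)) + (lsi_const q / real (k d))^2) + 2 * real (k d)) * Z powr (real (k d) + 2 * real (k d) ^ 2 / t) \<le> R"
      proof (rule R_ge)
        have lnv: "ln (exp (real d * (C / (2 * real (k d)) + (C / real (k d))^2) + 2 * real (k d)) * Z powr (real (k d) + 2 * real (k d) ^ 2 / t))
          = real d * (C / (2 * real (k d)) + (C / real (k d))^2) + 2 * real (k d) + (real (k d) + 2 * real (k d) ^ 2 / t) * ln Z"
          using Z1 by (simp add: ln_mult_pos ln_powr)
        have "real d * (C / (2 * real (k d))) \<le> real d * (C / (2 * X d))"
          using kX Xpos C d by (intro mult_left_mono divide_left_mono) auto
        also have "\<dots> = s * sqrt (real d * L)"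
        proof -
          have "sqrt (real d * L) = sqrt (real d / L) * L" using sqrt_mult_ln[of d] L by (simp add: L_def)
          moreover have "sqrt (real d / L) ^ 2 = real d / L" using d L by simp
          then have "sqrt (real d / L) * (sqrt (real d / L) * L) = real d" using L by (simp add: power2_eq_square field_simps)
          moreover have "C = 2 * s * s" using s(2) by (simp add: power2_eq_square)
          ultimately show ?thesis using s(1) d L by (simp add: X field_simps)
        qed
        finally have 1: "real d * (C / (2 * real (k d))) \<le> s * sqrt (real d * L)" .
        have "real d * (C / real (k d))^2 \<le> real d * (C / X d)^2"
          using kX Xpos C by (intro mult_left_mono power_mono divide_left_mono) auto
        also have "\<dots> = 4 * s^2 * L"
        proof -
          have "(C / X d)^2 = C^2 / (s^2 * real d / L)" by (simp add: power_divide X2)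
          moreover have "C = 2 * s^2" using s(2) by simp
          ultimately show ?thesis using s(1) d L by (simp add: power2_eq_square)
        qed
        finally have 2: "real d * (C / real (k d))^2 \<le> 4 * s^2 * L" .
        have "2 * real (k d) ^ 2 / t = 2 * real (k d) / L" using k1 L by (simp add: t_def power2_eq_square)
        then have "real (k d) + 2 * real (k d) ^ 2 / t = real (k d) * (1 + 2 / L)" by (simp add: distrib_left)
        also have "\<dots> \<le> (X d + 1) * (1 + 2 / L)" using kX L by (intro mult_right_mono) auto
        finally have "(real (k d) + 2 * real (k d) ^ 2 / t) * ln Z \<le> (X d + 1) * (1 + 2 / L) * ln Z"
          using Z1 by (intro mult_right_mono) auto
        then have 3: "(real (k d) + 2 * real (k d) ^ 2 / t) * ln Z \<le> (X d + 1) * (1 + 2 / L) * (L + ln L + b)"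
          by (simp add: lnZ)
        have 4: "real d * (C / (2 * real (k d)) + (C / real (k d))^2) = real d * (C / (2 * real (k d))) + real d * (C / real (k d))^2"
          by (rule distrib_left)
        show "ln (real d + 1) + ln (exp (real d * (lsi_const q / (2 * real (k d)) + (lsi_const q / real (k d))^2) + 2 * real (k d)) * Z powr (real (k d) + 2 * real (k d) ^ 2 / t)) \<le> Y"
        proof -
          have "lt + (u + v + 2 * \<kappa> + w) \<le> y"
            if "u \<le> u'" "v \<le> v'" "w \<le> w'" "\<kappa> \<le> x" "lt + u' + v' + 2 * x + w' \<le> y" for lt u u' v v' w w' x y \<kappa> :: real
            using that by linarith
          from this[OF 1 2 3 kX(2) elim(1)[folded L_def, folded X]]
          show ?thesis unfolding C_def[symmetric] lnv unfolding 4 Y_def .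
        qed
      qed (use Z1 in auto)
    qed
    also have "(real d + 1) * R = exp Y" using d by (simp add: R_def)
    finally show ?case by (simp add: Y_def c_eq L_def)
  qed
qed

theorem corollary1p1:
  fixes q :: nat
  assumes "q \<ge> 2"
  shows "(\<exists>E :: nat \<Rightarrow> real.
            E \<in> O(\<lambda>d. sqrt (real d / ln (real d)) * ln (ln (real d))) \<and>
            (\<forall>\<^sub>F d in sequentially.
               BH_deg d q \<le> ereal (exp (BH_c q * sqrt (real d * ln (real d)) + E d)))) \<and>
         (\<exists>r :: nat \<Rightarrow> real.
            r \<in> o(\<lambda>d. real d) \<and>
            (\<forall>\<^sub>F d in sequentially. BH_deg d q = ereal (exp (r d))))"
proof -
  define s where "s = sqrt (lsi_const q / 2)"
  define E where "E d = (s + 1) * err d" for d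
  have EO: "E \<in> O(\<lambda>d. sqrt (real d / ln (real d)) * ln (ln (real d)))"
    unfolding E_def err_def by simp
  have up: "\<forall>\<^sub>F d in sequentially. BH_deg d q \<le> ereal (exp (BH_c q * sqrt (real d * ln (real d)) + E d))"
    unfolding E_def s_def by (rule eventually_BH_deg_le[OF assms])
  define u where "u d = BH_c q * sqrt (real d * ln (real d)) + E d" for d
  have "(\<lambda>d. sqrt (real d * ln (real d))) \<in> o(\<lambda>d. real d)" by real_asymp
  moreover have "err \<in> o(\<lambda>d. real d)" unfolding err_def by real_asymp
  ultimately have uo: "u \<in> o(\<lambda>d. real d)"
    unfolding u_def E_def by (intro sum_in_smallo smallo_cmult_left)
  define r where "r d = ln (real_of_ereal (BH_deg d q))" for d
  have both: "\<forall>\<^sub>F d in sequentially. BH_deg d q = ereal (exp (r d)) \<and> 0 \<le> r d \<and> r d \<le> u d"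
    using up eventually_ge_at_top[of 1]
  proof eventually_elim
    case (elim d)
    have lo: "1 \<le> BH_deg d q" by (rule BH_deg_ge_1[OF assms elim(2)])
    have hi: "BH_deg d q \<le> ereal (exp (u d))" using elim by (simp add: u_def)
    obtain x where x: "BH_deg d q = ereal x" using lo hi by (cases "BH_deg d q") auto
    have "1 \<le> x" "x \<le> exp (u d)" using lo hi by (auto simp: x one_ereal_def)
    moreover have "ln x \<le> ln (exp (u d))" using \<open>1 \<le> x\<close> \<open>x \<le> exp (u d)\<close> by (subst ln_le_cancel_iff) auto
    ultimately show ?case by (simp add: r_def x)
  qed
  have "r \<in> O(u)"
    by (rule bigoI[of _ 1]) (use both in \<open>auto elim!: eventually_mono\<close>)
  then have "r \<in> o(\<lambda>d. real d)" using uo by (rule landau_o.big_small_trans)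
  moreover have "\<forall>\<^sub>F d in sequentially. BH_deg d q = ereal (exp (r d))"
    using both by (auto elim!: eventually_mono)
  ultimately show ?thesis using EO up by blast
qed

end
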